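(* Let $G$ be an étale groupoid that is covered by countably many open bisections, with singular ideal $J\trianglelefteq C^*_r(G)$. For $x\in G^{(0)}$ let $b\colon G^x_x\to\mathbb{C}$ be a function with finite support $\{g_1,\dots,g_n\}$ (the $g_i$ distinct) such that $$\sum_{g\in kX}b(g)=0\quad\text{for all }k\in G^x_x\text{ and }X\in\mathcal{X}(x).$$ Then, given any $h\in G_x$ and any open bisections $V_1,\dots,V_n$ containing $hg_1,\dots,hg_n$ respectively, there exists an admissible open neighbourhood $W\subseteq\bigcap_{i=1}^n s(V_i)$ of $x$, and for every such $W$ the function $$f^\psi:=\sum_{i=1}^n b(g_i)\,(\psi\circ s|_{V_i})$$ belongs to $J\cap\mathscr{C}_c(G)$ for all $\psi\in C_c(W)$. Furthermore, the linear span of all such functions $f^\psi$ (over all choices of $x,b,h,V_1,\dots,V_n$, admissible $W$ and $\psi\in C_c(W)$) is dense in $J\cap\mathscr{C}_c(G)$ with respect to any $C^*$-norm on $\mathscr{C}_c(G)$.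
   Context: An étale groupoid $G$ is a locally compact topological groupoid (possibly non-Hausdorff) whose unit space $G^{(0)}$ is Hausdorff and whose range and source maps $r,s\colon G\to G^{(0)}$ are local homeomorphisms. $G_x=s^{-1}(x)$ and $G^x_x=\{g: r(g)=s(g)=x\}$. An open bisection is an open $U\subseteq G$ on which $r$ and $s$ restrict to homeomorphisms onto $r(U)$, $s(U)$. Connes' algebra $\mathscr{C}_c(G)$ is the linear span of functions $f\colon G\to\mathbb{C}$ for which there is an open bisection $U$ with $f|_U\in C_c(U)$, $f|_{G\setminus U}=0$, with convolution product and involution $f^*(g)=\overline{f(g^{-1})}$. $C^*_r(G)$ is the completion of $\mathscr{C}_c(G)$ in the norm $\sup_{x}\|\lambda_x(f)\|$, where $\lambda_x(f)\xi=f*\xi$ on $\ell^2(G_x)$. Elements $a\in C^*_r(G)$ are viewed as functions on $G$ via $a(g)=\langle\lambda_{s(g)}(a)\delta_{s(g)},\delta_g\rangle$. The singular ideal is $J=\{a\in C^*_r(G): \{g\in G: a(g)\neq0\}\text{ has empty interior}\}$. A unit $x\in G^{(0)}$ is Hausdorff if every $g\in G^x_x\setminus\{x\}$ has an open neighbourhood $U$ with $U\cap G^{(0)}=\emptyset$; $C\subseteq G^{(0)}$ is the set of Hausdorff units. For $x\in G^{(0)}$, $\mathcal{X}(x)$ is the set of subgroups $X\subseteq G^x_x$ for which there is a net $(x_\alpha)$ in $C$ whose set of limits in $G$ is precisely $X$ and such that every subnet of $(x_\alpha)$ has all of its limits contained in $X$. Given $x,b,h,V_1,\dots,V_n$ as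 in the claim, an open neighbourhood $W\subseteq\bigcap_i s(V_i)$ of $x$ is called admissible if, with $U_i:=V_i\cap s^{-1}(W)$, one has $W_I:=s\big(\bigcap_{i\in I}U_i\setminus\bigcup_{j\notin I}U_j\big)\cap C=\emptyset$ for every non-empty $I\subseteq\{1,\dots,n\}$ that is not of the form $\{hg_i: i\in I\}=kX\cap\{hg_1,\dots,hg_n\}$ for some $k\in G_x$ and $X\in\mathcal{X}(x)$. Functions in $C_c(W)$ are extended by zero to $G^{(0)}$, and $\psi\circ s|_{V_i}$ is extended by zero from $V_i$ to $G$. *)

theory Defs
  imports "HOL-Analysis.Analysis" "HOL-Algebra.Group" "HOL-Library.Function_Algebras"
begin

section \<open>Etale groupoids\<close>

text \<open>A groupoid is given by its arrows alone: the arrows are the points of the topology, and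
  units are identified with their identity arrows.  The operations are only meaningful on arrows,
  and \<open>gmul G g h\<close> only if \<open>src G g = rng G h\<close>.\<close>

record 'a groupoid =
  topo :: "'a topology"
  gmul :: "'a \<Rightarrow> 'a \<Rightarrow> 'a"
  ginv :: "'a \<Rightarrow> 'a"
  src :: "'a \<Rightarrow> 'a"
  rng :: "'a \<Rightarrow> 'a"

abbreviation arrows :: "'a groupoid \<Rightarrow> 'a set"
  where "arrows G \<equiv> topspace (topo G)"

definition units :: "'a groupoid \<Rightarrow> 'a set"
  where "units G = src G ` arrows G"

definition composable :: "'a groupoid \<Rightarrow> ('a \<times> 'a) set"
  where "composable G = {(g, h). g \<in> arrows G \<and> h \<in> arrows G \<and> src G g = rng G h}"

definition source_fibre :: "'a groupoid \<Rightarrow> 'a \<Rightarrow> 'a set"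
  where "source_fibre G x = {g \<in> arrows G. src G g = x}"

definition isotropy :: "'a groupoid \<Rightarrow> 'a \<Rightarrow> 'a set"
  where "isotropy G x = {g \<in> arrows G. rng G g = x \<and> src G g = x}"

definition isotropy_group :: "'a groupoid \<Rightarrow> 'a \<Rightarrow> 'a monoid"
  where "isotropy_group G x = \<lparr>carrier = isotropy G x, monoid.mult = gmul G, one = x\<rparr>"

definition local_homeomorphism :: "'a topology \<Rightarrow> 'b topology \<Rightarrow> ('a \<Rightarrow> 'b) \<Rightarrow> bool"
  where "local_homeomorphism X Y f \<longleftrightarrow>
    f \<in> topspace X \<rightarrow> topspace Y \<and>
    (\<forall>x \<in> topspace X. \<exists>U. openin X U \<and> x \<in> U \<and> openin Y (f ` U) \<and>
      homeomorphic_map (subtopology X U) (subtopology Y (f ` U)) f)"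

locale groupoid =
  fixes G :: "'a groupoid"
  assumes src_closed: "g \<in> arrows G \<Longrightarrow> src G g \<in> arrows G"
    and rng_closed: "g \<in> arrows G \<Longrightarrow> rng G g \<in> units G"
    and src_unit: "x \<in> units G \<Longrightarrow> src G x = x"
    and rng_unit: "x \<in> units G \<Longrightarrow> rng G x = x"
    and mul_closed: "(g, h) \<in> composable G \<Longrightarrow> gmul G g h \<in> arrows G"
    and src_mul: "(g, h) \<in> composable G \<Longrightarrow> src G (gmul G g h) = src G h"
    and rng_mul: "(g, h) \<in> composable G \<Longrightarrow> rng G (gmul G g h) = rng G g"
    and mul_assoc: "(g, h) \<in> composable G \<Longrightarrow> (h, k) \<in> composable G \<Longrightarrow>
      gmul G (gmul G g h) k = gmul G g (gmul G h k)"
    and mul_src: "g \<in> arrows G \<Longrightarrow> gmul G g (src G g) = g"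
    and rng_mul_left: "g \<in> arrows G \<Longrightarrow> gmul G (rng G g) g = g"
    and inv_closed: "g \<in> arrows G \<Longrightarrow> ginv G g \<in> arrows G"
    and src_inv: "g \<in> arrows G \<Longrightarrow> src G (ginv G g) = rng G g"
    and rng_inv: "g \<in> arrows G \<Longrightarrow> rng G (ginv G g) = src G g"
    and mul_inv: "g \<in> arrows G \<Longrightarrow> gmul G g (ginv G g) = rng G g"
    and inv_mul: "g \<in> arrows G \<Longrightarrow> gmul G (ginv G g) g = src G g"

locale etale_groupoid = groupoid +
  assumes locally_compact: "locally_compact_space (topo G)"
    and continuous_mul: "continuous_map
      (subtopology (prod_topology (topo G) (topo G)) (composable G)) (topo G)
      (\<lambda>(g, h). gmul G g h)"
    and continuous_inv: "continuous_map (topo G) (topo G) (ginv G)"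
    and Hausdorff_units: "Hausdorff_space (subtopology (topo G) (units G))"
    and src_local_homeo:
      "local_homeomorphism (topo G) (subtopology (topo G) (units G)) (src G)"
    and rng_local_homeo:
      "local_homeomorphism (topo G) (subtopology (topo G) (units G)) (rng G)"

definition open_bisection :: "'a groupoid \<Rightarrow> 'a set \<Rightarrow> bool"
  where "open_bisection G U \<longleftrightarrow>
    openin (topo G) U \<and>
    homeomorphic_map (subtopology (topo G) U) (subtopology (topo G) (src G ` U)) (src G) \<and>
    homeomorphic_map (subtopology (topo G) U) (subtopology (topo G) (rng G ` U)) (rng G)"

definition covered_by_countably_many_bisections :: "'a groupoid \<Rightarrow> bool"
  where "covered_by_countably_many_bisections G \<longleftrightarrow>
    (\<exists>\<U>. countable \<U> \<and> (\<forall>U \<in> \<U>. open_bisection G U) \<and> \<Union>\<U> = arrows G)"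


section \<open>Connes' algebra\<close>

interpretation cfun: vector_space "\<lambda>(c::complex) (f :: 'a \<Rightarrow> complex) x. c * f x"
  by unfold_locales (auto simp: fun_eq_iff algebra_simps)

text \<open>\<open>C\<^sub>c(U)\<close> for a subset \<open>U\<close>, each function being extended by zero off \<open>U\<close>.  Closure and
  compactness refer to \<open>U\<close>, not to the ambient, possibly non-Hausdorff space.\<close>

definition Cc_on :: "'a topology \<Rightarrow> 'a set \<Rightarrow> ('a \<Rightarrow> complex) set"
  where "Cc_on X U = {f.
    continuous_map (subtopology X U) euclidean f \<and>
    compactin (subtopology X U) (subtopology X U closure_of {x \<in> U. f x \<noteq> 0}) \<and>
    (\<forall>x. x \<notin> U \<longrightarrow> f x = 0)}"

definition Connes_algebra :: "'a groupoid \<Rightarrow> ('a \<Rightarrow> complex) set"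
  where "Connes_algebra G = cfun.span (\<Union>U \<in> Collect (open_bisection G). Cc_on (topo G) U)"

text \<open>On arrows this is \<open>(f * f')(g) = \<Sum> f(g h\<^sup>-\<^sup>1) f'(h)\<close>, summed over the arrows \<open>h\<close> with the
  same source as \<open>g\<close>.  If \<open>f\<close> belongs to Connes' algebra, only finitely many terms are nonzero,
  whatever \<open>f'\<close> is.\<close>

definition conv :: "'a groupoid \<Rightarrow> ('a \<Rightarrow> complex) \<Rightarrow> ('a \<Rightarrow> complex) \<Rightarrow> 'a \<Rightarrow> complex"
  where "conv G f f' g = (if g \<in> arrows G
    then \<Sum>\<^sub>\<infinity>h \<in> source_fibre G (src G g). f (gmul G g (ginv G h)) * f' h else 0)"

definition invol :: "'a groupoid \<Rightarrow> ('a \<Rightarrow> complex) \<Rightarrow> 'a \<Rightarrow> complex"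
  where "invol G f g = (if g \<in> arrows G then cnj (f (ginv G g)) else 0)"

definition cstar_norm :: "'a groupoid \<Rightarrow> (('a \<Rightarrow> complex) \<Rightarrow> real) \<Rightarrow> bool"
  where "cstar_norm G N \<longleftrightarrow>
    (\<forall>f \<in> Connes_algebra G. 0 \<le> N f \<and> (N f = 0 \<longleftrightarrow> f = 0)) \<and>
    (\<forall>f \<in> Connes_algebra G. \<forall>c. N (\<lambda>g. c * f g) = cmod c * N f) \<and>
    (\<forall>f \<in> Connes_algebra G. \<forall>f' \<in> Connes_algebra G. N (f + f') \<le> N f + N f') \<and>
    (\<forall>f \<in> Connes_algebra G. \<forall>f' \<in> Connes_algebra G. N (conv G f f') \<le> N f * N f') \<and>
    (\<forall>f \<in> Connes_algebra G. N (conv G (invol G f) f) = (N f)\<^sup>2)"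

definition norm_dense :: "(('a \<Rightarrow> complex) \<Rightarrow> real) \<Rightarrow> ('a \<Rightarrow> complex) set
    \<Rightarrow> ('a \<Rightarrow> complex) set \<Rightarrow> bool"
  where "norm_dense N A B \<longleftrightarrow> A \<subseteq> B \<and> (\<forall>f \<in> B. \<forall>e > 0. \<exists>f' \<in> A. N (f - f') < e)"


section \<open>The reduced algebra and the singular ideal\<close>

definition ell2 :: "'a set \<Rightarrow> ('a \<Rightarrow> complex) set"
  where "ell2 A = {\<xi>. (\<forall>g. g \<notin> A \<longrightarrow> \<xi> g = 0) \<and> (\<lambda>g. (cmod (\<xi> g))\<^sup>2) summable_on A}"

definition ell2_norm :: "'a set \<Rightarrow> ('a \<Rightarrow> complex) \<Rightarrow> real"
  where "ell2_norm A \<xi> = sqrt (\<Sum>\<^sub>\<infinity>g \<in> A. (cmod (\<xi> g))\<^sup>2)"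

definition ell2_inner :: "'a set \<Rightarrow> ('a \<Rightarrow> complex) \<Rightarrow> ('a \<Rightarrow> complex) \<Rightarrow> complex"
  where "ell2_inner A \<xi> \<eta> = (\<Sum>\<^sub>\<infinity>g \<in> A. \<xi> g * cnj (\<eta> g))"

definition delta :: "'a \<Rightarrow> 'a \<Rightarrow> complex"
  where "delta g h = (if h = g then 1 else 0)"

definition ell2_opnorm :: "'a set \<Rightarrow> (('a \<Rightarrow> complex) \<Rightarrow> 'a \<Rightarrow> complex) \<Rightarrow> ennreal"
  where "ell2_opnorm A T = (SUP \<xi> \<in> {\<xi> \<in> ell2 A. ell2_norm A \<xi> \<le> 1}. ennreal (ell2_norm A (T \<xi>)))"

text \<open>Families \<open>(a\<^sub>x)\<close> with \<open>a\<^sub>x\<close> an operator on \<open>\<ell>\<^sup>2(G\<^sub>x)\<close>, with the supremum of the operator norms.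
  Operators are extended by zero to arguments outside \<open>\<ell>\<^sup>2(G\<^sub>x)\<close>, and families to non-units.\<close>

type_synonym 'a op_family = "'a \<Rightarrow> ('a \<Rightarrow> complex) \<Rightarrow> 'a \<Rightarrow> complex"

definition family_norm :: "'a groupoid \<Rightarrow> 'a op_family \<Rightarrow> ennreal"
  where "family_norm G a = (SUP x \<in> units G. ell2_opnorm (source_fibre G x) (a x))"

definition bounded_families :: "'a groupoid \<Rightarrow> 'a op_family set"
  where "bounded_families G = {a.
    (\<forall>x \<in> units G. \<forall>\<xi> \<in> ell2 (source_fibre G x).
      a x \<xi> \<in> ell2 (source_fibre G x) \<and>
      (\<forall>c. a x (\<lambda>g. c * \<xi> g) = (\<lambda>g. c * a x \<xi> g)) \<and>
      (\<forall>\<eta> \<in> ell2 (source_fibre G x). a x (\<xi> + \<eta>) = a x \<xi> + a x \<eta>)) \<and>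
    (\<forall>x \<xi>. x \<notin> units G \<or> \<xi> \<notin> ell2 (source_fibre G x) \<longrightarrow> a x \<xi> = 0) \<and>
    family_norm G a < \<infinity>}"

definition regular_rep :: "'a groupoid \<Rightarrow> ('a \<Rightarrow> complex) \<Rightarrow> 'a op_family"
  where "regular_rep G f x \<xi> =
    (if x \<in> units G \<and> \<xi> \<in> ell2 (source_fibre G x) then conv G f \<xi> else 0)"

text \<open>\<^term>\<open>regular_rep G\<close> is an isometric embedding of Connes' algebra, with the norm
  \<open>sup\<^sub>x \<parallel>\<lambda>\<^sub>x(f)\<parallel>\<close>, into the Banach space of bounded families.  The completion is
  therefore realised as the closure of its image, with \<open>\<lambda>\<^sub>x(a)\<close> being \<open>a x\<close>.\<close>

definition reduced_cstar :: "'a groupoid \<Rightarrow> 'a op_family set"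
  where "reduced_cstar G = {a \<in> bounded_families G.
    \<forall>e > (0::real). \<exists>f \<in> Connes_algebra G. family_norm G (a - regular_rep G f) < ennreal e}"

definition as_function :: "'a groupoid \<Rightarrow> 'a op_family \<Rightarrow> 'a \<Rightarrow> complex"
  where "as_function G a g =
    ell2_inner (source_fibre G (src G g)) (a (src G g) (delta (src G g))) (delta g)"

definition singular_ideal :: "'a groupoid \<Rightarrow> 'a op_family set"
  where "singular_ideal G =
    {a \<in> reduced_cstar G. topo G interior_of {g \<in> arrows G. as_function G a g \<noteq> 0} = {}}"

text \<open>\<open>J \<inter> \<C>\<^sub>c(G)\<close>, where Connes' algebra is regarded as a subalgebra of the reduced algebra.\<close>

definition singular_Cc :: "'a groupoid \<Rightarrow> ('a \<Rightarrow> complex) set"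
  where "singular_Cc G = {f \<in> Connes_algebra G. regular_rep G f \<in> singular_ideal G}"


section \<open>Nets and limit subgroups\<close>

definition directed :: "'i set \<Rightarrow> ('i \<Rightarrow> 'i \<Rightarrow> bool) \<Rightarrow> bool"
  where "directed D prec \<longleftrightarrow> D \<noteq> {} \<and>
    (\<forall>d \<in> D. prec d d) \<and>
    (\<forall>d \<in> D. \<forall>e \<in> D. \<forall>k \<in> D. prec d e \<longrightarrow> prec e k \<longrightarrow> prec d k) \<and>
    (\<forall>d \<in> D. \<forall>e \<in> D. \<exists>k \<in> D. prec d k \<and> prec e k)"

definition net_limits :: "'a topology \<Rightarrow> 'i set \<Rightarrow> ('i \<Rightarrow> 'i \<Rightarrow> bool) \<Rightarrow> ('i \<Rightarrow> 'a) \<Rightarrow> 'a set"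
  where "net_limits X D prec z = {y \<in> topspace X.
    \<forall>U. openin X U \<and> y \<in> U \<longrightarrow> (\<exists>d \<in> D. \<forall>e \<in> D. prec d e \<longrightarrow> z e \<in> U)}"

text \<open>The net \<open>z \<circ> \<phi>\<close> on \<open>D'\<close> is a subnet of the net \<open>z\<close> on \<open>D\<close> (in Kelley's sense).\<close>

definition subnet_map :: "'i set \<Rightarrow> ('i \<Rightarrow> 'i \<Rightarrow> bool) \<Rightarrow> 'j set \<Rightarrow> ('j \<Rightarrow> 'j \<Rightarrow> bool)
    \<Rightarrow> ('j \<Rightarrow> 'i) \<Rightarrow> bool"
  where "subnet_map D prec D' prec' \<phi> \<longleftrightarrow> \<phi> \<in> D' \<rightarrow> D \<and>
    (\<forall>d \<in> D. \<exists>d' \<in> D'. \<forall>e \<in> D'. prec' d' e \<longrightarrow> prec d (\<phi> e))"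

definition Hausdorff_unit_set :: "'a groupoid \<Rightarrow> 'a set"
  where "Hausdorff_unit_set G = {x \<in> units G. \<forall>g \<in> isotropy G x - {x}.
    \<exists>U. openin (topo G) U \<and> g \<in> U \<and> U \<inter> units G = {}}"

text \<open>HOL cannot quantify over index types inside a formula, so nets are indexed by subsets of
  \<^typ>\<open>'a set \<times> 'a\<close> and subnets by subsets of \<^typ>\<open>('a set \<times> 'a) \<times> 'a set\<close>.  These types are
  large enough for the result not to depend on the choice: see \<open>limit_subgroupsI\<close> and
  \<open>limit_subgroupsE\<close> below, where the index types are arbitrary.\<close>

definition limit_subgroups :: "'a groupoid \<Rightarrow> 'a \<Rightarrow> 'a set set"
  where "limit_subgroups G x = {X. subgroup X (isotropy_group G x) \<and>
    (\<exists>(D :: ('a set \<times> 'a) set) prec z.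
      directed D prec \<and> z \<in> D \<rightarrow> Hausdorff_unit_set G \<and> net_limits (topo G) D prec z = X \<and>
      (\<forall>(D' :: (('a set \<times> 'a) \<times> 'a set) set) prec' \<phi>.
        directed D' prec' \<and> subnet_map D prec D' prec' \<phi> \<longrightarrow>
        net_limits (topo G) D' prec' (z \<circ> \<phi>) \<subseteq> X))}"

definition cluster_points :: "'a topology \<Rightarrow> 'i set \<Rightarrow> ('i \<Rightarrow> 'i \<Rightarrow> bool) \<Rightarrow> ('i \<Rightarrow> 'a) \<Rightarrow> 'a set"
  where "cluster_points X D prec z = {y \<in> topspace X.
    \<forall>U. openin X U \<and> y \<in> U \<longrightarrow> (\<forall>d \<in> D. \<exists>e \<in> D. prec d e \<and> z e \<in> U)}"

lemma
  assumes "directed D prec"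
  shows directed_nonempty: "D \<noteq> {}"
    and directed_refl: "d \<in> D \<Longrightarrow> prec d d"
    and directed_trans: "d \<in> D \<Longrightarrow> e \<in> D \<Longrightarrow> k \<in> D \<Longrightarrow> prec d e \<Longrightarrow> prec e k \<Longrightarrow> prec d k"
    and directed_ub: "d \<in> D \<Longrightarrow> e \<in> D \<Longrightarrow> \<exists>k \<in> D. prec d k \<and> prec e k"
  using assms unfolding directed_def by blast+

lemma subnet_limit_is_cluster_point:
  assumes "directed D' prec'" "subnet_map D prec D' prec' \<phi>"
  shows "net_limits X D' prec' (z \<circ> \<phi>) \<subseteq> cluster_points X D prec z"
proof
  fix y assume y: "y \<in> net_limits X D' prec' (z \<circ> \<phi>)"
  have "\<exists>e \<in> D. prec d e \<and> z e \<in> U" if U: "openin X U" "y \<in> U" and "d \<in> D" for U d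
  proof -
    obtain p where p: "p \<in> D'" "\<forall>e \<in> D'. prec' p e \<longrightarrow> prec d (\<phi> e)"
      using assms(2) \<open>d \<in> D\<close> unfolding subnet_map_def by blast
    obtain q where q: "q \<in> D'" "\<forall>e \<in> D'. prec' q e \<longrightarrow> z (\<phi> e) \<in> U"
      using y U unfolding net_limits_def comp_def by blast
    obtain k where "k \<in> D'" "prec' p k" "prec' q k"
      using directed_ub[OF assms(1) p(1) q(1)] by blast
    then show ?thesis
      using p q assms(2) unfolding subnet_map_def by blast
  qed
  then show "y \<in> cluster_points X D prec z"
    using y by (auto simp: cluster_points_def net_limits_def)
qed

lemma cluster_point_is_subnet_limit:
  fixes D :: "'i set" and z :: "'i \<Rightarrow> 'a"
  assumes D: "directed D prec" and y: "y \<in> cluster_points X D prec z"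
  obtains D' :: "('i \<times> 'a set) set" and prec' \<phi>
  where "directed D' prec'" "subnet_map D prec D' prec' \<phi>" "y \<in> net_limits X D' prec' (z \<circ> \<phi>)"
proof -
  define D' where "D' = {(d, U). d \<in> D \<and> openin X U \<and> y \<in> U \<and> z d \<in> U}"
  define prec' where "prec' = (\<lambda>(d, U) (e, V). prec d e \<and> (V :: 'a set) \<subseteq> U)"
  have yX: "y \<in> topspace X"
    using y by (simp add: cluster_points_def)
  have cl: "\<exists>e \<in> D. prec d e \<and> z e \<in> U" if "openin X U" "y \<in> U" "d \<in> D" for U d
    using y that by (auto simp: cluster_points_def)
  note refl = directed_refl[OF D] and trans = directed_trans[OF D] and ub = directed_ub[OF D]
  have ex: "\<exists>e. prec d e \<and> (e, U) \<in> D'" if "openin X U" "y \<in> U" "d \<in> D" for U d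
    using cl[OF that] that by (auto simp: D'_def)
  have dir: "directed D' prec'"
    unfolding directed_def
  proof (intro conjI ballI impI)
    show "D' \<noteq> {}"
      using directed_nonempty[OF D] ex[OF openin_topspace yX] by blast
    show "prec' p p" if "p \<in> D'" for p
      using that refl by (auto simp: D'_def prec'_def)
    show "prec' p r" if "p \<in> D'" "q \<in> D'" "r \<in> D'" "prec' p q" "prec' q r" for p q r
    proof -
      obtain d U e V k Z where "p = (d, U)" "q = (e, V)" "r = (k, Z)"
        by (cases p, cases q, cases r)
      with that trans[of d e k] show ?thesis
        by (auto simp: D'_def prec'_def)
    qed
    show "\<exists>r \<in> D'. prec' p r \<and> prec' q r" if pq: "p \<in> D'" "q \<in> D'" for p q
    proof -
      obtain d U e V where eqs: "p = (d, U)" "q = (e, V)"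
        by (cases p, cases q)
      have *: "d \<in> D" "e \<in> D" "openin X (U \<inter> V)" "y \<in> U \<inter> V"
        using pq by (auto simp: eqs D'_def)
      obtain k where k: "k \<in> D" "prec d k" "prec e k"
        using ub * by blast
      obtain l where l: "prec k l" "(l, U \<inter> V) \<in> D'"
        using ex *(3,4) k(1) by blast
      then have "l \<in> D"
        by (simp add: D'_def)
      with k l(1) * have "prec d l" "prec e l"
        using trans by blast+
      with l(2) show ?thesis
        by (auto simp: eqs prec'_def intro!: bexI[of _ "(l, U \<inter> V)"])
    qed
  qed
  have sub: "subnet_map D prec D' prec' fst"
    unfolding subnet_map_def
  proof (intro conjI ballI)
    show "fst \<in> D' \<rightarrow> D"
      by (auto simp: D'_def)
    show "\<exists>p \<in> D'. \<forall>q \<in> D'. prec' p q \<longrightarrow> prec d (fst q)" if d: "d \<in> D" for d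
    proof -
      obtain e where e: "prec d e" "(e, topspace X) \<in> D'"
        using ex[OF openin_topspace yX d] by blast
      then have "e \<in> D"
        by (simp add: D'_def)
      with e d show ?thesis
        using trans[of d e] by (intro bexI[of _ "(e, topspace X)"]) (auto simp: D'_def prec'_def)
    qed
  qed
  have lim: "\<exists>p \<in> D'. \<forall>q \<in> D'. prec' p q \<longrightarrow> (z \<circ> fst) q \<in> U" if U: "openin X U" "y \<in> U" for U
  proof -
    obtain d where "d \<in> D"
      using directed_nonempty[OF D] by blast
    then obtain e where "(e, U) \<in> D'"
      using ex[OF U] by blast
    then show ?thesis
      by (intro bexI[of _ "(e, U)"]) (auto simp: D'_def prec'_def)
  qed
  then have "y \<in> net_limits X D' prec' (z \<circ> fst)"
    using yX by (auto simp: net_limits_def)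
  with dir sub show thesis
    by (rule that)
qed

lemma limit_subgroupsI:
  fixes D :: "'i set" and z :: "'i \<Rightarrow> 'a" and G :: "'a groupoid"
  assumes "subgroup X (isotropy_group G x)"
    and D: "directed D prec" and z: "z \<in> D \<rightarrow> Hausdorff_unit_set G"
    and lim: "net_limits (topo G) D prec z = X"
    and sub: "\<And>(D' :: ('i \<times> 'a set) set) prec' \<phi>. directed D' prec' \<Longrightarrow> subnet_map D prec D' prec' \<phi> \<Longrightarrow>
      net_limits (topo G) D' prec' (z \<circ> \<phi>) \<subseteq> X"
  shows "X \<in> limit_subgroups G x"
proof -
  define tail where "tail d = z ` {e \<in> D. prec d e}" for d
  define E where "E = {(S, p). S \<in> tail ` D \<and> p \<in> S}"
  define ge where "ge = (\<lambda>(S :: 'a set, p :: 'a) (S' :: 'a set, p' :: 'a). S' \<subseteq> S)"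
  have ne: "z d \<in> tail d" if "d \<in> D" for d
    using directed_refl[OF D] that by (auto simp: tail_def)
  have E: "directed E ge"
    unfolding directed_def
  proof (intro conjI ballI impI)
    show "E \<noteq> {}"
      using directed_nonempty[OF D] ne by (auto simp: E_def)
    show "\<exists>r \<in> E. ge p r \<and> ge q r" if pq: "p \<in> E" "q \<in> E" for p q
    proof -
      obtain d e where de: "d \<in> D" "e \<in> D" "fst p = tail d" "fst q = tail e"
        using pq by (auto simp: E_def)
      then obtain k where k: "k \<in> D" "prec d k" "prec e k"
        using directed_ub[OF D] by blast
      have "tail k \<subseteq> tail d" "tail k \<subseteq> tail e"
        using directed_trans[OF D de(1) k(1) _ k(2)] directed_trans[OF D de(2) k(1) _ k(3)]
        by (auto simp: tail_def)
      with k(1) de(3,4) ne show ?thesis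
        by (intro bexI[of _ "(tail k, z k)"]) (auto simp: E_def ge_def split: prod.splits)
    qed
  qed (auto simp: ge_def)
  have in_E: "(\<forall>q \<in> E. ge (tail d, p) q \<longrightarrow> snd q \<in> U) \<longleftrightarrow> tail d \<subseteq> U" if d: "d \<in> D" for d p U
  proof
    assume all: "\<forall>q \<in> E. ge (tail d, p) q \<longrightarrow> snd q \<in> U"
    show "tail d \<subseteq> U"
    proof
      fix y assume "y \<in> tail d"
      then have "(tail d, y) \<in> E"
        using d by (simp add: E_def)
      with all show "y \<in> U"
        by (force simp: ge_def)
    qed
  qed (auto simp: E_def ge_def)
  have ex_E: "(\<exists>p \<in> E. \<forall>q \<in> E. ge p q \<longrightarrow> snd q \<in> U) \<longleftrightarrow>
      (\<exists>d \<in> D. \<forall>e \<in> D. prec d e \<longrightarrow> z e \<in> U)" (is "?L \<longleftrightarrow> ?R") for U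
  proof -
    have "?L \<longleftrightarrow> (\<exists>d \<in> D. \<exists>p \<in> tail d. \<forall>q \<in> E. ge (tail d, p) q \<longrightarrow> snd q \<in> U)"
      by (simp add: E_def Bex_def)
    also have "\<dots> \<longleftrightarrow> (\<exists>d \<in> D. tail d \<subseteq> U)"
      using in_E ne by (metis (no_types, lifting))
    also have "\<dots> \<longleftrightarrow> ?R"
      by (auto simp: tail_def)
    finally show ?thesis .
  qed
  have lim_E: "net_limits (topo G) E ge snd = X"
    unfolding lim[symmetric] net_limits_def ex_E ..
  have cl_E: "cluster_points (topo G) E ge snd \<subseteq> cluster_points (topo G) D prec z"
  proof
    fix y assume y: "y \<in> cluster_points (topo G) E ge snd"
    have "\<exists>e \<in> D. prec d e \<and> z e \<in> U" if U: "openin (topo G) U" "y \<in> U" and d: "d \<in> D" for U d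
    proof -
      have "(tail d, z d) \<in> E"
        using d ne by (auto simp: E_def)
      then obtain q where "q \<in> E" "ge (tail d, z d) q" "snd q \<in> U"
        using y U unfolding cluster_points_def by blast
      then have "snd q \<in> tail d" "snd q \<in> U"
        by (auto simp: E_def ge_def)
      then show ?thesis
        by (auto simp: tail_def)
    qed
    then show "y \<in> cluster_points (topo G) D prec z"
      using y by (auto simp: cluster_points_def)
  qed
  have cl_D: "cluster_points (topo G) D prec z \<subseteq> X"
  proof
    fix y assume "y \<in> cluster_points (topo G) D prec z"
    then obtain D' :: "('i \<times> 'a set) set" and prec' \<phi> where "directed D' prec'"
      "subnet_map D prec D' prec' \<phi>" "y \<in> net_limits (topo G) D' prec' (z \<circ> \<phi>)"
      by (rule cluster_point_is_subnet_limit[OF D])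
    with sub show "y \<in> X"
      by blast
  qed
  have "snd \<in> E \<rightarrow> Hausdorff_unit_set G"
    using z by (auto simp: E_def tail_def)
  moreover have "net_limits (topo G) E' prec' (snd \<circ> \<phi>) \<subseteq> X"
    if "directed E' prec'" "subnet_map E ge E' prec' \<phi>"
    for E' :: "(('a set \<times> 'a) \<times> 'a set) set" and prec' \<phi>
    by (rule order_trans[OF subnet_limit_is_cluster_point[OF that] order_trans[OF cl_E cl_D]])
  ultimately show ?thesis
    unfolding limit_subgroups_def using assms(1) E lim_E
    by (intro CollectI conjI exI[of _ E] exI[of _ ge] exI[of _ snd]) auto
qed

lemma limit_subgroupsE:
  fixes G :: "'a groupoid"
  assumes "X \<in> limit_subgroups G x"
  obtains D :: "('a set \<times> 'a) set" and prec z
  where "subgroup X (isotropy_group G x)" "directed D prec" "z \<in> D \<rightarrow> Hausdorff_unit_set G"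
    "net_limits (topo G) D prec z = X"
    "\<And>(D' :: 'j set) prec' \<phi>. directed D' prec' \<Longrightarrow> subnet_map D prec D' prec' \<phi> \<Longrightarrow>
      net_limits (topo G) D' prec' (z \<circ> \<phi>) \<subseteq> X"
proof -
  obtain D :: "('a set \<times> 'a) set" and prec z
    where *: "subgroup X (isotropy_group G x)" "directed D prec" "z \<in> D \<rightarrow> Hausdorff_unit_set G"
      "net_limits (topo G) D prec z = X"
      and sub: "\<And>(D' :: (('a set \<times> 'a) \<times> 'a set) set) prec' \<phi>. directed D' prec' \<Longrightarrow>
        subnet_map D prec D' prec' \<phi> \<Longrightarrow> net_limits (topo G) D' prec' (z \<circ> \<phi>) \<subseteq> X"
    using assms unfolding limit_subgroups_def by auto
  have "cluster_points (topo G) D prec z \<subseteq> X"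
  proof
    fix y assume "y \<in> cluster_points (topo G) D prec z"
    then obtain D' :: "(('a set \<times> 'a) \<times> 'a set) set" and prec' \<phi> where "directed D' prec'"
      "subnet_map D prec D' prec' \<phi>" "y \<in> net_limits (topo G) D' prec' (z \<circ> \<phi>)"
      by (rule cluster_point_is_subnet_limit[OF *(2)])
    with sub show "y \<in> X"
      by blast
  qed
  then have "net_limits (topo G) D' prec' (z \<circ> \<phi>) \<subseteq> X"
    if "directed D' prec'" "subnet_map D prec D' prec' \<phi>" for D' :: "'j set" and prec' \<phi>
    by (rule order_trans[OF subnet_limit_is_cluster_point[OF that]])
  with * show thesis
    by (rule that)
qed


section \<open>Admissible neighbourhoods\<close>

definition coset :: "'a groupoid \<Rightarrow> 'a \<Rightarrow> 'a set \<Rightarrow> 'a set"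
  where "coset G k X = gmul G k ` X"

text \<open>The support of \<open>b\<close>, as a function on the isotropy group at \<open>x\<close>, is enumerated without
  repetition by \<open>\<gamma> 1, \<dots>, \<gamma> n\<close>; values of \<open>b\<close> elsewhere are irrelevant.\<close>

definition coset_null :: "'a groupoid \<Rightarrow> 'a \<Rightarrow> ('a \<Rightarrow> complex) \<Rightarrow> nat \<Rightarrow> (nat \<Rightarrow> 'a) \<Rightarrow> bool"
  where "coset_null G x b n \<gamma> \<longleftrightarrow>
    x \<in> units G \<and>
    inj_on \<gamma> {1..n} \<and> {g \<in> isotropy G x. b g \<noteq> 0} = \<gamma> ` {1..n} \<and>
    (\<forall>k \<in> isotropy G x. \<forall>X \<in> limit_subgroups G x. (\<Sum>g \<in> {g \<in> coset G k X. b g \<noteq> 0}. b g) = 0)"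

definition bisections_at :: "'a groupoid \<Rightarrow> 'a \<Rightarrow> nat \<Rightarrow> (nat \<Rightarrow> 'a) \<Rightarrow> 'a \<Rightarrow> (nat \<Rightarrow> 'a set) \<Rightarrow> bool"
  where "bisections_at G x n \<gamma> h V \<longleftrightarrow>
    h \<in> source_fibre G x \<and> (\<forall>i \<in> {1..n}. open_bisection G (V i) \<and> gmul G h (\<gamma> i) \<in> V i)"

definition admissible :: "'a groupoid \<Rightarrow> 'a \<Rightarrow> nat \<Rightarrow> (nat \<Rightarrow> 'a) \<Rightarrow> 'a \<Rightarrow> (nat \<Rightarrow> 'a set) \<Rightarrow> 'a set \<Rightarrow> bool"
  where "admissible G x n \<gamma> h V W \<longleftrightarrow>
    openin (subtopology (topo G) (units G)) W \<and> x \<in> W \<and> (\<forall>i \<in> {1..n}. W \<subseteq> src G ` V i) \<and>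
    (let U = (\<lambda>i. {g \<in> V i. src G g \<in> W}) in
      \<forall>I \<subseteq> {1..n}. I \<noteq> {} \<and>
        \<not> (\<exists>k \<in> source_fibre G x. \<exists>X \<in> limit_subgroups G x.
            (\<lambda>i. gmul G h (\<gamma> i)) ` I = coset G k X \<inter> (\<lambda>i. gmul G h (\<gamma> i)) ` {1..n}) \<longrightarrow>
        src G ` ((\<Inter>i \<in> I. U i) - (\<Union>j \<in> {1..n} - I. U j)) \<inter> Hausdorff_unit_set G = {})"

definition f_psi :: "'a groupoid \<Rightarrow> ('a \<Rightarrow> complex) \<Rightarrow> nat \<Rightarrow> (nat \<Rightarrow> 'a) \<Rightarrow> (nat \<Rightarrow> 'a set)
    \<Rightarrow> ('a \<Rightarrow> complex) \<Rightarrow> 'a \<Rightarrow> complex"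
  where "f_psi G b n \<gamma> V \<psi> g = (\<Sum>i = 1..n. b (\<gamma> i) * (if g \<in> V i then \<psi> (src G g) else 0))"

end

theory Submission
  imports Defs
begin

text \<open>By Baire's theorem the Hausdorff units \<open>C\<close> are dense in the unit space, and elements of Connes'
  algebra are continuous at arrows with source in \<open>C\<close>; hence such an element is singular iff it
  vanishes on \<open>s\<^sup>-\<^sup>1(C)\<close>.  Along a filter of units in \<open>C\<close> that converges to \<open>x\<close> and whose limits form
  \<open>X\<close>, the value of \<open>f\<close> on a local section through \<open>k\<close> tends to the sum of \<open>f\<close> over \<open>k X\<close>, so these
  sums vanish for singular \<open>f\<close>.  Conversely, ultrafilters produce admissible neighbourhoods, over
  which the coset conditions make \<open>f\<^sup>\<psi>\<close> vanish on \<open>s\<^sup>-\<^sup>1(C)\<close>.  For density, a singular \<open>f\<close> is near each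
  unit uniformly close to a finite sum of functions \<open>f\<^sup>\<psi>\<close> whose coefficients are the values of \<open>f\<close> on
  one fibre; a partition of unity patches these, and on each bisection every C*-norm is dominated by
  the supremum norm.\<close>

section \<open>Topology of the unit space\<close>

text \<open>A function supported on one bisection is continuous there, but its extension by zero to
  the non-Hausdorff space \<open>G\<close> may jump. The source map separates two effects: such a
  function is a continuous function on the Hausdorff unit space, composed with the source, times the
  indicator of the bisection, and only the indicator jumps. Everything then turns on which
  bisections contain the arrow \<open>sec V z\<close> as \<open>z\<close> tends to \<open>x\<close>.
  Two limits of such arrows differ by a limit of the units \<open>z\<close> themselves, which is how
  subgroups of the isotropy group and their cosets enter. Ultrafilters are convenient because each
  of their cluster points is a limit, which is what the condition on subnets in
  \<open>limit_subgroups\<close> asks for. One function f^\<psi> only reaches arrows of a fibre with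
  a common range, so the values of \<open>f\<close> on a fibre contribute one function for each
  range. A fixed decomposition of \<open>f\<close> into \<open>m\<close> summands is kept throughout
  the approximation: the error is measured on these \<open>m\<close> bisections, however many
  neighbourhoods the partition of unity uses.\<close>

lemma closure_of_meets_open:
  assumes "x \<in> X closure_of S" "openin X T" "x \<in> T"
  obtains y where "y \<in> S" "y \<in> T"
  using assms unfolding in_closure_of by metis

section \<open>Cancellation laws in groupoids\<close>

context groupoid
begin

lemma units_subset_arrows: "units G \<subseteq> arrows G"
  using src_closed by (auto simp: units_def)

lemma unit_arrow: "x \<in> units G \<Longrightarrow> x \<in> arrows G"
  using units_subset_arrows by blast

lemma src_in_units: "g \<in> arrows G \<Longrightarrow> src G g \<in> units G"
  by (simp add: units_def)

lemma inv_unit: "x \<in> units G \<Longrightarrow> ginv G x = x"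
  by (metis inv_closed inv_mul mul_src rng_unit src_inv src_unit unit_arrow)

lemma inv_mul_cancel:
  assumes "(g, h) \<in> composable G"
  shows "gmul G (ginv G g) (gmul G g h) = h"
proof -
  have gh: "g \<in> arrows G" "h \<in> arrows G" "src G g = rng G h"
    using assms by (auto simp: composable_def)
  then have "gmul G (ginv G g) (gmul G g h) = gmul G (gmul G (ginv G g) g) h"
    by (intro mul_assoc[symmetric]) (auto simp: composable_def inv_closed src_inv)
  with gh show ?thesis
    by (simp add: inv_mul rng_mul_left)
qed

lemma mul_inv_cancel:
  assumes "g \<in> arrows G" "h \<in> arrows G" "rng G g = rng G h"
  shows "gmul G g (gmul G (ginv G g) h) = h"
proof -
  have "gmul G g (gmul G (ginv G g) h) = gmul G (gmul G g (ginv G g)) h"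
    using assms by (intro mul_assoc[symmetric]) (auto simp: composable_def inv_closed src_inv rng_inv)
  with assms show ?thesis
    by (simp add: mul_inv rng_mul_left)
qed

lemma inv_inv: "g \<in> arrows G \<Longrightarrow> ginv G (ginv G g) = g"
  by (metis inv_closed inv_mul mul_inv mul_inv_cancel mul_src rng_inv src_inv)

end

context etale_groupoid
begin

text \<open>Near a unit the source is injective on some open \<open>U\<close>. If both
  \<open>g\<close> and \<open>src G g\<close> lie in \<open>U\<close>, they have the same source and
  hence coincide, so \<open>g\<close> is a unit.\<close>

lemma openin_units: "openin (topo G) (units G)"
proof (subst openin_subopen, intro ballI)
  fix x assume x: "x \<in> units G"
  obtain U where U: "openin (topo G) U" "x \<in> U"
    and homeo: "homeomorphic_map (subtopology (topo G) U)
      (subtopology (subtopology (topo G) (units G)) (src G ` U)) (src G)"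
    using src_local_homeo unit_arrow[OF x] unfolding local_homeomorphism_def by metis
  have sub: "U \<subseteq> arrows G"
    using U openin_subset by blast
  have inj: "inj_on (src G) U"
    using homeomorphic_imp_injective_map[OF homeo] sub by (simp add: inf.absorb2)
  have "continuous_map (subtopology (topo G) U) (topo G) (src G)"
    using homeomorphic_imp_continuous_map[OF homeo] continuous_map_in_subtopology by blast
  then have "openin (subtopology (topo G) U)
      {g \<in> topspace (subtopology (topo G) U). src G g \<in> U}"
    using U(1) openin_continuous_map_preimage by blast
  then have op: "openin (topo G) {g \<in> U. src G g \<in> U}"
    using U(1) sub openin_open_subtopology by (auto simp: inf.absorb2)
  have "g \<in> units G" if "g \<in> U" "src G g \<in> U" for g
    using that inj sub by (metis inj_onD src_in_units src_unit subsetD)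
  with U x op show "\<exists>T. openin (topo G) T \<and> x \<in> T \<and> T \<subseteq> units G"
    by (intro exI[of _ "{g \<in> U. src G g \<in> U}"]) (auto simp: src_unit)
qed

lemma openin_unit_space: "openin (subtopology (topo G) (units G)) W \<longleftrightarrow> openin (topo G) W \<and> W \<subseteq> units G"
  by (rule openin_open_subtopology[OF openin_units])

lemma topspace_units [simp]: "topspace (subtopology (topo G) (units G)) = units G"
  using units_subset_arrows by auto

text \<open>As the units form an open set, sets open in the unit space are open in \<open>G\<close>;
  the local statements about maps into the unit space thus become global ones about maps into
  \<open>G\<close>.\<close>

lemma local_homeomorphism_units:
  assumes "local_homeomorphism (topo G) (subtopology (topo G) (units G)) f"
  shows "continuous_map (topo G) (topo G) f" "open_map (topo G) (topo G) f"
proof -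
  have loc: "\<exists>U. openin (topo G) U \<and> g \<in> U \<and> openin (topo G) (f ` U) \<and>
      homeomorphic_map (subtopology (topo G) U) (subtopology (topo G) (f ` U)) f" if "g \<in> arrows G" for g
  proof -
    from assms that obtain U where U: "openin (topo G) U" "g \<in> U"
        "openin (subtopology (topo G) (units G)) (f ` U)"
        "homeomorphic_map (subtopology (topo G) U)
          (subtopology (subtopology (topo G) (units G)) (f ` U)) f"
      unfolding local_homeomorphism_def by metis
    from U(3) have "openin (topo G) (f ` U)" "units G \<inter> f ` U = f ` U"
      unfolding openin_unit_space by auto
    with U show ?thesis
      by (auto simp: subtopology_subtopology)
  qed
  show "open_map (topo G) (topo G) f"
    unfolding open_map_def
  proof (intro allI impI)
    fix S assume S: "openin (topo G) S"
    show "openin (topo G) (f ` S)"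
    proof (subst openin_subopen, safe)
      fix g assume g: "g \<in> S"
      then have "g \<in> arrows G"
        using S openin_subset by blast
      from loc[OF this] obtain U where U: "openin (topo G) U" "g \<in> U" "openin (topo G) (f ` U)"
        and h: "homeomorphic_map (subtopology (topo G) U) (subtopology (topo G) (f ` U)) f"
        by blast
      have "openin (subtopology (topo G) U) (U \<inter> S)"
        using S U(1) by (simp add: openin_open_subtopology openin_Int)
      then have "openin (subtopology (topo G) (f ` U)) (f ` (U \<inter> S))"
        using homeomorphic_imp_open_map[OF h] by (simp add: open_map_def)
      then have "openin (topo G) (f ` (U \<inter> S))"
        using U(3) openin_open_subtopology by blast
      then show "\<exists>T. openin (topo G) T \<and> f g \<in> T \<and> T \<subseteq> f ` S"
        using g U(2) by blast
    qed
  qed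
  show "continuous_map (topo G) (topo G) f"
  proof (rule pasting_lemma[where T = "\<lambda>U. U" and f = "\<lambda>_. f"])
    let ?I = "{U. openin (topo G) U \<and>
      homeomorphic_map (subtopology (topo G) U) (subtopology (topo G) (f ` U)) f}"
    show "\<exists>U. U \<in> ?I \<and> g \<in> U \<and> f g = f g" if "g \<in> arrows G" for g
      using loc[OF that] by auto
    show "continuous_map (subtopology (topo G) U) (topo G) f" if "U \<in> ?I" for U
      using that homeomorphic_imp_continuous_map continuous_map_in_subtopology by blast
  qed auto
qed

lemmas continuous_src = local_homeomorphism_units(1)[OF src_local_homeo]
  and open_src = local_homeomorphism_units(2)[OF src_local_homeo]
  and continuous_rng = local_homeomorphism_units(1)[OF rng_local_homeo]
  and open_rng = local_homeomorphism_units(2)[OF rng_local_homeo]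

lemma openin_src_image: "openin (topo G) U \<Longrightarrow> openin (topo G) (src G ` U)"
  using open_src by (simp add: open_map_def)

lemma openin_src_vimage:
  assumes "openin (topo G) U" "openin (topo G) W"
  shows "openin (topo G) {g \<in> U. src G g \<in> W}"
proof -
  have "openin (topo G) {g \<in> arrows G. src G g \<in> W}"
    using continuous_src assms(2) openin_continuous_map_preimage by blast
  moreover have "{g \<in> U. src G g \<in> W} = U \<inter> {g \<in> arrows G. src G g \<in> W}"
    using openin_subset[OF assms(1)] by blast
  ultimately show ?thesis
    using assms(1) by auto
qed

text \<open>Source and range are continuous and open on all of \<open>G\<close>, so on an open set
  being a homeomorphism onto the image amounts to injectivity.\<close>

lemma open_bisection_iff:
  "open_bisection G U \<longleftrightarrow> openin (topo G) U \<and> inj_on (src G) U \<and> inj_on (rng G) U"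
proof -
  have homeo: "homeomorphic_map (subtopology (topo G) U) (subtopology (topo G) (f ` U)) f \<longleftrightarrow> inj_on f U"
    if U: "openin (topo G) U" and f: "continuous_map (topo G) (topo G) f" "open_map (topo G) (topo G) f" for f
  proof -
    have top: "topspace (subtopology (topo G) U) = U" "topspace (subtopology (topo G) (f ` U)) = f ` U"
      using openin_subset[OF U] f(1) by (auto simp: continuous_map_def Pi_iff)
    have "open_map (subtopology (topo G) U) (subtopology (topo G) (f ` U)) f"
      using U f(2) by (auto simp: open_map_def openin_open_subtopology)
    moreover have "continuous_map (subtopology (topo G) U) (subtopology (topo G) (f ` U)) f"
      using f(1) by (simp add: continuous_map_in_subtopology continuous_map_from_subtopology image_mono)
    ultimately show ?thesis
      using top bijective_open_imp_homeomorphic_map homeomorphic_imp_injective_map by metis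
  qed
  then show ?thesis
    using homeo continuous_src open_src continuous_rng open_rng unfolding open_bisection_def by blast
qed

lemma open_bisection_subset:
  "open_bisection G U \<Longrightarrow> openin (topo G) V \<Longrightarrow> V \<subseteq> U \<Longrightarrow> open_bisection G V"
  unfolding open_bisection_iff using inj_on_subset by blast

lemma open_bisection_units: "open_bisection G (units G)"
  unfolding open_bisection_iff by (auto simp: openin_units inj_on_def src_unit rng_unit)

lemma bisection_arrow: "open_bisection G U \<Longrightarrow> g \<in> U \<Longrightarrow> g \<in> arrows G"
  unfolding open_bisection_iff using openin_subset by blast

lemma src_bisection_subset: "open_bisection G U \<Longrightarrow> src G ` U \<subseteq> units G"
  using bisection_arrow src_in_units by blast

lemma Hausdorff_bisection:
  assumes "open_bisection G U"
  shows "Hausdorff_space (subtopology (topo G) U)"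
proof -
  have "src G ` U \<subseteq> units G"
    by (rule src_bisection_subset[OF assms])
  then have "Hausdorff_space (subtopology (topo G) (src G ` U))"
    using Hausdorff_space_subtopology[OF Hausdorff_units, of "src G ` U"]
    by (simp add: subtopology_subtopology inf.absorb2)
  moreover have "subtopology (topo G) U homeomorphic_space subtopology (topo G) (src G ` U)"
    using assms unfolding open_bisection_def homeomorphic_space by blast
  ultimately show ?thesis
    using homeomorphic_Hausdorff_space by blast
qed

text \<open>The units need not be closed in \<open>G\<close>, so intersecting a compact
  neighbourhood with them may destroy compactness. Its image under the retraction
  \<open>src G\<close> is compact and still a neighbourhood.\<close>

lemma locally_compact_units: "locally_compact_space (subtopology (topo G) (units G))"
  unfolding locally_compact_space_def
proof
  fix x assume "x \<in> topspace (subtopology (topo G) (units G))"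
  then have x: "x \<in> units G"
    by simp
  from locally_compact[unfolded locally_compact_space_def, rule_format, OF unit_arrow[OF x]]
  obtain U K where UK: "openin (topo G) U" "compactin (topo G) K" "x \<in> U" "U \<subseteq> K"
    by (elim exE conjE)
  have K: "src G ` K \<subseteq> units G"
    using compactin_subset_topspace[OF UK(2)] src_in_units by blast
  then have "compactin (subtopology (topo G) (units G)) (src G ` K)"
    using image_compactin[OF UK(2) continuous_src] by (simp add: compactin_subtopology)
  moreover have "U \<inter> units G \<subseteq> src G ` K"
  proof
    fix y assume "y \<in> U \<inter> units G"
    then show "y \<in> src G ` K"
      using UK(4) by (intro image_eqI[of _ _ y]) (auto simp: src_unit)
  qed
  ultimately show "\<exists>U K. openin (subtopology (topo G) (units G)) U \<and>
      compactin (subtopology (topo G) (units G)) K \<and> x \<in> U \<and> U \<subseteq> K"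
    using UK(1,3) x openin_units
    by (intro exI[of _ "U \<inter> units G"] exI[of _ "src G ` K"]) (auto simp: openin_unit_space openin_Int)
qed

lemma regular_units: "regular_space (subtopology (topo G) (units G))"
  using locally_compact_units Hausdorff_units locally_compact_Hausdorff_imp_regular_space by blast

lemma Hausdorff_unit_set_subset: "Hausdorff_unit_set G \<subseteq> units G"
  by (auto simp: Hausdorff_unit_set_def)

text \<open>A unit that is not Hausdorff is the source of an arrow in the boundary of the unit space, and
  the part of that boundary inside a bisection is closed and nowhere dense there.\<close>

lemma Hausdorff_units_dense:
  assumes cov: "covered_by_countably_many_bisections G"
    and W: "openin (topo G) W" "W \<subseteq> units G" "W \<noteq> {}"
  shows "W \<inter> Hausdorff_unit_set G \<noteq> {}"
proof
  assume empty: "W \<inter> Hausdorff_unit_set G = {}"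
  let ?X = "subtopology (topo G) (units G)"
  obtain \<U> where "countable \<U> \<and> (\<forall>U \<in> \<U>. open_bisection G U) \<and> \<Union>\<U> = arrows G"
    using cov unfolding covered_by_countably_many_bisections_def by (elim exE)
  then have \<U>: "countable \<U>" "\<And>U. U \<in> \<U> \<Longrightarrow> open_bisection G U" "\<Union>\<U> = arrows G"
    by auto
  \<comment> \<open>The part inside \<open>U\<close> of the boundary of the open set of units; its
    source image is to be nowhere dense.\<close>
  define B where "B U = (topo G closure_of units G) \<inter> U - units G" for U
  define T where "T U = ?X closure_of (src G ` B U)" for U
  have nowhere: "?X interior_of T U = {}" if "U \<in> \<U>" for U
  proof (rule ccontr)
    assume ne: "?X interior_of T U \<noteq> {}"
    have opU: "openin (topo G) U" and inj: "inj_on (src G) U"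
      using \<U>(2)[OF that] open_bisection_iff by auto
    define O1 where "O1 = ?X interior_of T U"
    have O1: "openin (topo G) O1" "O1 \<subseteq> units G" "O1 \<noteq> {}"
      using ne openin_interior_of[of ?X "T U"] unfolding O1_def[symmetric] openin_unit_space by simp_all
    have "O1 \<subseteq> ?X closure_of (src G ` B U)"
      unfolding O1_def T_def by (rule interior_of_subset)
    then obtain z where "z \<in> ?X closure_of (src G ` B U)" "z \<in> O1"
      using O1(3) by auto
    moreover have "openin ?X O1"
      using O1 by (simp add: openin_unit_space)
    ultimately obtain c where "c \<in> src G ` B U" "c \<in> O1"
      using closure_of_meets_open by metis
    then obtain b where b: "b \<in> B U" "src G b \<in> O1"
      by auto
    define O2 where "O2 = {g \<in> U. src G g \<in> O1}"
    have O2: "openin (topo G) O2"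
      unfolding O2_def by (rule openin_src_vimage[OF opU O1(1)])
    have "b \<in> O2" "b \<in> topo G closure_of units G"
      using b by (auto simp: O2_def B_def)
    then obtain y where y: "y \<in> units G" "y \<in> O2"
      using O2 closure_of_meets_open by metis
    \<comment> \<open>\<open>O3\<close> consists of units lying in \<open>U\<close>. A point
      \<open>c\<close> of \<open>B U\<close> with source in \<open>O3\<close> lies in
      \<open>U\<close> together with its source, so injectivity makes \<open>c\<close> a unit, which
      \<open>B U\<close> excludes.\<close>
    define O3 where "O3 = O2 \<inter> units G"
    have O3: "openin (topo G) O3" "openin ?X O3"
      using O2 openin_units unfolding O3_def openin_unit_space by auto
    have "y \<in> T U"
      using y interior_of_subset[of ?X "T U"] unfolding O1_def[symmetric] O2_def by (auto simp: src_unit)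
    moreover have "y \<in> O3"
      using y by (simp add: O3_def)
    ultimately obtain d where "d \<in> src G ` B U" "d \<in> O3"
      using O3(2) closure_of_meets_open unfolding T_def by metis
    then obtain c where c: "c \<in> B U" "src G c \<in> O3"
      by auto
    then have "src G c \<in> U" "c \<in> U" "c \<in> arrows G" "c \<notin> units G"
      using opU openin_subset by (auto simp: B_def O3_def O2_def)
    then show False
      using inj by (metis inj_onD src_in_units src_unit)
  qed
  have "?X interior_of \<Union>(T ` \<U>) = {}"
    by (rule Baire_category_alt)
       (use locally_compact_units regular_units \<U>(1) nowhere in \<open>auto simp: T_def\<close>)
  moreover have "W \<subseteq> \<Union>(T ` \<U>)"
  proof
    fix x assume x: "x \<in> W"
    then have "x \<in> units G" "x \<notin> Hausdorff_unit_set G"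
      using empty W(2) by auto
    then obtain g where g: "g \<in> isotropy G x" "g \<noteq> x"
        "\<And>U. openin (topo G) U \<Longrightarrow> g \<in> U \<Longrightarrow> U \<inter> units G \<noteq> {}"
      unfolding Hausdorff_unit_set_def by blast
    then have ga: "g \<in> arrows G" "src G g = x"
      by (auto simp: isotropy_def)
    then obtain U where U: "U \<in> \<U>" "g \<in> U"
      using \<U>(3) by blast
    have "g \<in> topo G closure_of units G"
      using ga g(3) unfolding in_closure_of by blast
    moreover have "g \<notin> units G"
      using g(2) ga(2) src_unit by auto
    ultimately have "x \<in> src G ` B U"
      using U ga(2) by (auto simp: B_def)
    moreover have "src G ` B U \<subseteq> units G"
      using src_bisection_subset[OF \<U>(2)[OF U(1)]] by (auto simp: B_def)
    then have "src G ` B U \<subseteq> T U"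
      unfolding T_def by (intro closure_of_subset) (simp only: topspace_units)
    ultimately have "x \<in> T U"
      by blast
    with U(1) show "x \<in> \<Union>(T ` \<U>)"
      by blast
  qed
  then have "W \<subseteq> ?X interior_of \<Union>(T ` \<U>)"
    using W(1,2) by (intro interior_of_maximal) (simp_all add: openin_unit_space)
  ultimately have "W \<subseteq> {}"
    by simp
  with W(3) show False
    by blast
qed

end

section \<open>Filters of units and limit subgroups\<close>

text \<open>Zorn's lemma for the reversed order on the proper filters below \<open>F\<close>. If the
  negation of \<open>P\<close> is not eventual, then intersecting a minimal filter with the
  principal filter of \<open>P\<close> keeps it proper, so by minimality \<open>P\<close> was
  already eventual.\<close>

lemma exists_ultrafilter:
  fixes F :: "'a filter"
  assumes "F \<noteq> bot"
  obtains F' where "F' \<le> F" "F' \<noteq> bot" "\<And>P. eventually P F' \<or> eventually (\<lambda>x. \<not> P x) F'"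
proof -
  define A where "A = {F'. F' \<le> F \<and> F' \<noteq> bot}"
  have "\<exists>m \<in> A. \<forall>a \<in> A. m \<ge> a \<longrightarrow> a = m"
  proof (rule predicate_Zorn)
    show "partial_order_on A (relation_of (\<ge>) A)"
      by (rule partial_order_on_relation_ofI) auto
    fix \<C> assume \<C>: "\<C> \<in> Chains (relation_of (\<ge>) A)"
    then have sub: "\<C> \<subseteq> A" and chain: "\<And>a b. a \<in> \<C> \<Longrightarrow> b \<in> \<C> \<Longrightarrow> a \<le> b \<or> b \<le> a"
      by (auto simp: Chains_def relation_of_def)
    show "\<exists>u \<in> A. \<forall>a \<in> \<C>. a \<ge> u"
    proof (cases "\<C> = {}")
      case True
      then show ?thesis
        using assms by (intro bexI[of _ F]) (auto simp: A_def)
    next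
      case False
      have "eventually P (Inf \<C>) \<longleftrightarrow> (\<exists>b \<in> \<C>. eventually P b)" for P
        using False
      proof (rule eventually_Inf_base)
        show "\<exists>x \<in> \<C>. x \<le> inf a b" if "a \<in> \<C>" "b \<in> \<C>" for a b
          using chain[OF that] that by (auto simp: inf_absorb1 inf_absorb2)
      qed
      then have "Inf \<C> \<noteq> bot"
        using sub by (auto simp: A_def trivial_limit_def)
      moreover have "Inf \<C> \<le> F"
      proof -
        obtain a where "a \<in> \<C>"
          using False by blast
        then have "Inf \<C> \<le> a" "a \<le> F"
          using sub by (auto simp: A_def Inf_lower)
        then show ?thesis
          by (rule order_trans)
      qed
      ultimately show ?thesis
        by (intro bexI[of _ "Inf \<C>"]) (auto simp: A_def Inf_lower)
    qed
  qed
  then obtain m where m: "m \<in> A" "\<And>a. a \<in> A \<Longrightarrow> a \<le> m \<Longrightarrow> a = m"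
    by blast
  have "eventually P m \<or> eventually (\<lambda>x. \<not> P x) m" for P
  proof (rule disjCI)
    assume "\<not> eventually (\<lambda>x. \<not> P x) m"
    then have "inf m (principal {x. P x}) \<in> A"
      using m(1) unfolding A_def by (auto simp: trivial_limit_def eventually_inf_principal intro: le_infI1)
    then have "inf m (principal {x. P x}) = m"
      by (rule m(2)) simp
    moreover have "eventually P (inf m (principal {x. P x}))"
      by (simp add: eventually_inf_principal)
    ultimately show "eventually P m"
      by simp
  qed
  with m(1) show thesis
    by (intro that[of m]) (auto simp: A_def)
qed

definition filter_limits :: "'a topology \<Rightarrow> 'a filter \<Rightarrow> 'a set"
  where "filter_limits X F = {y. limitin X (\<lambda>z. z) y F}"

text \<open>These points stand in for the limits of all subnets.\<close>

definition filter_cluster_points :: "'a topology \<Rightarrow> 'a filter \<Rightarrow> 'a set"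
  where "filter_cluster_points X F =
    {y \<in> topspace X. \<forall>U. openin X U \<and> y \<in> U \<longrightarrow> frequently (\<lambda>z. z \<in> U) F}"

lemma limit_of_finer_is_cluster_point:
  assumes "F' \<le> F" "F' \<noteq> bot" "y \<in> filter_limits X F'"
  shows "y \<in> filter_cluster_points X F"
proof -
  have "frequently (\<lambda>z. z \<in> U) F" if U: "openin X U" "y \<in> U" for U
  proof -
    have "eventually (\<lambda>z. z \<in> U) F'"
      using assms(3) U by (simp add: filter_limits_def limitin_def)
    then have "frequently (\<lambda>z. z \<in> U) F'"
      by (rule eventually_frequently[OF assms(2)])
    then show ?thesis
      using assms(1) by (auto simp: frequently_def dest: filter_leD)
  qed
  moreover have "y \<in> topspace X"
    using assms(3) by (simp add: filter_limits_def limitin_def)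
  ultimately show ?thesis
    by (simp add: filter_cluster_points_def)
qed

text \<open>Nets are only looked at through the filters that they generate.\<close>

lemma limit_subgroups_iff_filter:
  fixes G :: "'a groupoid"
  shows "X \<in> limit_subgroups G x \<longleftrightarrow> subgroup X (isotropy_group G x) \<and>
    (\<exists>F. F \<noteq> bot \<and> eventually (\<lambda>z. z \<in> Hausdorff_unit_set G) F \<and>
      filter_limits (topo G) F = X \<and> filter_cluster_points (topo G) F \<subseteq> X)"
proof
  assume "X \<in> limit_subgroups G x"
  then obtain D :: "('a set \<times> 'a) set" and prec z
    where sub: "subgroup X (isotropy_group G x)" and D: "directed D prec"
      and z: "z \<in> D \<rightarrow> Hausdorff_unit_set G" and lim: "net_limits (topo G) D prec z = X"
      and subnet: "\<And>(D' :: (('a set \<times> 'a) \<times> 'a set) set) prec' \<phi>. directed D' prec' \<Longrightarrow>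
        subnet_map D prec D' prec' \<phi> \<Longrightarrow> net_limits (topo G) D' prec' (z \<circ> \<phi>) \<subseteq> X"
    by (rule limit_subgroupsE) blast
  \<comment> \<open>The filter generated by the tails of the net; directedness makes the tails a
    base, so a single index witnesses each eventual property.\<close>
  define F where "F = (INF d \<in> D. principal (z ` {e \<in> D. prec d e}))"
  have ev: "eventually P F \<longleftrightarrow> (\<exists>d \<in> D. \<forall>e \<in> D. prec d e \<longrightarrow> P (z e))" for P
  proof -
    have "eventually P F \<longleftrightarrow> (\<exists>d \<in> D. eventually P (principal (z ` {e \<in> D. prec d e})))"
      unfolding F_def
    proof (rule eventually_INF_base)
      show "D \<noteq> {}"
        by (rule directed_nonempty[OF D])
      fix a b assume ab: "a \<in> D" "b \<in> D"
      then obtain k where k: "k \<in> D" "prec a k" "prec b k"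
        using directed_ub[OF D] by blast
      have "{e \<in> D. prec k e} \<subseteq> {e \<in> D. prec a e} \<inter> {e \<in> D. prec b e}"
        using directed_trans[OF D] ab k by blast
      then have "z ` {e \<in> D. prec k e} \<subseteq> z ` {e \<in> D. prec a e} \<inter> z ` {e \<in> D. prec b e}"
        by blast
      then show "\<exists>k \<in> D. principal (z ` {e \<in> D. prec k e}) \<le>
          inf (principal (z ` {e \<in> D. prec a e})) (principal (z ` {e \<in> D. prec b e}))"
        using k(1) by (intro bexI[of _ k]) auto
    qed
    then show ?thesis
      unfolding eventually_principal by blast
  qed
  have "F \<noteq> bot"
    using directed_refl[OF D] by (auto simp: trivial_limit_def ev)
  moreover have "eventually (\<lambda>z. z \<in> Hausdorff_unit_set G) F"
    using directed_nonempty[OF D] z unfolding ev by blast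
  moreover have "filter_limits (topo G) F = X"
    unfolding lim[symmetric] by (auto simp: filter_limits_def net_limits_def limitin_def ev)
  moreover have "filter_cluster_points (topo G) F \<subseteq> X"
  proof
    fix y assume "y \<in> filter_cluster_points (topo G) F"
    then have "y \<in> cluster_points (topo G) D prec z"
      unfolding filter_cluster_points_def cluster_points_def frequently_def ev by blast
    then obtain D' :: "(('a set \<times> 'a) \<times> 'a set) set" and prec' \<phi>
      where "directed D' prec'" "subnet_map D prec D' prec' \<phi>"
        "y \<in> net_limits (topo G) D' prec' (z \<circ> \<phi>)"
      by (rule cluster_point_is_subnet_limit[OF D])
    with subnet show "y \<in> X"
      by blast
  qed
  ultimately show "subgroup X (isotropy_group G x) \<and>
    (\<exists>F. F \<noteq> bot \<and> eventually (\<lambda>z. z \<in> Hausdorff_unit_set G) F \<and>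
      filter_limits (topo G) F = X \<and> filter_cluster_points (topo G) F \<subseteq> X)"
    using sub by blast
next
  assume *: "subgroup X (isotropy_group G x) \<and>
    (\<exists>F. F \<noteq> bot \<and> eventually (\<lambda>z. z \<in> Hausdorff_unit_set G) F \<and>
      filter_limits (topo G) F = X \<and> filter_cluster_points (topo G) F \<subseteq> X)"
  then obtain F where F: "F \<noteq> bot" "eventually (\<lambda>z. z \<in> Hausdorff_unit_set G) F"
      "filter_limits (topo G) F = X" "filter_cluster_points (topo G) F \<subseteq> X"
    by blast
  \<comment> \<open>An index is a large set with a chosen point of it in \<open>C\<close>, and the
    order only compares the sets. The net \<open>snd\<close> therefore runs through all points of
    \<open>C\<close> in every large set, and its tails generate exactly \<open>F\<close>.\<close>
  define D where "D = {(S, p). eventually (\<lambda>z. z \<in> S) F \<and> p \<in> S \<inter> Hausdorff_unit_set G}"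
  define prec where "prec = (\<lambda>(S :: 'a set, p :: 'a) (S' :: 'a set, p' :: 'a). S' \<subseteq> S)"
  have ne: "\<exists>p. (S, p) \<in> D" if "eventually (\<lambda>z. z \<in> S) F" for S
  proof -
    have "eventually (\<lambda>z. z \<in> S \<and> z \<in> Hausdorff_unit_set G) F"
      using that F(2) by (rule eventually_conj)
    then obtain p where "p \<in> S \<and> p \<in> Hausdorff_unit_set G"
      using F(1) eventually_happens by blast
    with that show ?thesis
      by (auto simp: D_def)
  qed
  have D: "directed D prec"
    unfolding directed_def
  proof (intro conjI ballI impI)
    show "D \<noteq> {}"
      using ne[of UNIV] by auto
    fix d e assume "d \<in> D" "e \<in> D"
    then have "eventually (\<lambda>z. z \<in> fst d) F" "eventually (\<lambda>z. z \<in> fst e) F"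
      by (auto simp: D_def)
    then have "eventually (\<lambda>z. z \<in> fst d \<inter> fst e) F"
      by eventually_elim simp
    then obtain p where "(fst d \<inter> fst e, p) \<in> D"
      using ne by blast
    then show "\<exists>k \<in> D. prec d k \<and> prec e k"
      by (intro bexI[of _ "(fst d \<inter> fst e, p)"]) (auto simp: prec_def split: prod.splits)
  qed (auto simp: prec_def)
  have ev: "(\<exists>d \<in> D. \<forall>e \<in> D. prec d e \<longrightarrow> snd e \<in> U) \<longleftrightarrow> eventually (\<lambda>z. z \<in> U) F" for U
  proof
    assume "\<exists>d \<in> D. \<forall>e \<in> D. prec d e \<longrightarrow> snd e \<in> U"
    then obtain S p where S: "(S, p) \<in> D" "\<And>e. e \<in> D \<Longrightarrow> prec (S, p) e \<Longrightarrow> snd e \<in> U"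
      by auto
    have "q \<in> U" if "q \<in> S" "q \<in> Hausdorff_unit_set G" for q
      using S(2)[of "(S, q)"] S(1) that by (auto simp: D_def prec_def)
    moreover have "eventually (\<lambda>z. z \<in> S) F"
      using S(1) by (simp add: D_def)
    ultimately show "eventually (\<lambda>z. z \<in> U) F"
      using F(2) by (auto elim: eventually_elim2)
  next
    assume "eventually (\<lambda>z. z \<in> U) F"
    then obtain p where "(U, p) \<in> D"
      using ne by blast
    then show "\<exists>d \<in> D. \<forall>e \<in> D. prec d e \<longrightarrow> snd e \<in> U"
      by (intro bexI[of _ "(U, p)"]) (auto simp: D_def prec_def)
  qed
  have cl: "cluster_points (topo G) D prec snd \<subseteq> X"
  proof (rule order_trans[OF _ F(4)], rule subsetI)
    fix y assume y: "y \<in> cluster_points (topo G) D prec snd"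
    have "frequently (\<lambda>z. z \<in> U) F" if U: "openin (topo G) U" "y \<in> U" for U
      unfolding frequently_def
    proof
      assume "eventually (\<lambda>z. z \<notin> U) F"
      then have "eventually (\<lambda>z. z \<in> - U) F"
        by simp
      then obtain p where p: "(- U, p) \<in> D"
        using ne by blast
      then obtain e where "e \<in> D" "prec (- U, p) e" "snd e \<in> U"
        using y U unfolding cluster_points_def by blast
      then show False
        by (auto simp: D_def prec_def)
    qed
    then show "y \<in> filter_cluster_points (topo G) F"
      using y by (simp add: filter_cluster_points_def cluster_points_def)
  qed
  show "X \<in> limit_subgroups G x"
  proof (rule limit_subgroupsI[OF _ D])
    show "subgroup X (isotropy_group G x)"
      using * by blast
    show "snd \<in> D \<rightarrow> Hausdorff_unit_set G"
      by (auto simp: D_def)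
    show "net_limits (topo G) D prec snd = X"
      unfolding F(3)[symmetric] by (simp add: net_limits_def filter_limits_def limitin_def ev)
    show "net_limits (topo G) D' prec' (snd \<circ> \<phi>) \<subseteq> X"
      if "directed D' prec'" "subnet_map D prec D' prec' \<phi>"
      for D' :: "(('a set \<times> 'a) \<times> 'a set) set" and prec' \<phi>
      by (rule order_trans[OF subnet_limit_is_cluster_point[OF that] cl])
  qed
qed

section \<open>Isotropy groups\<close>

context groupoid
begin

lemma inv_isotropy:
  assumes "g \<in> isotropy G x"
  shows "ginv G g \<in> isotropy G x" "gmul G (ginv G g) g = x"
  using assms by (auto simp: isotropy_def inv_closed src_inv rng_inv inv_mul)

lemma mul_isotropy:
  "g \<in> isotropy G x \<Longrightarrow> h \<in> isotropy G x \<Longrightarrow> gmul G g h \<in> isotropy G x"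
  by (auto simp: isotropy_def mul_closed src_mul rng_mul composable_def)

lemma unit_isotropy: "x \<in> units G \<Longrightarrow> x \<in> isotropy G x"
  by (simp add: isotropy_def unit_arrow src_unit rng_unit)

lemma group_isotropy: "x \<in> units G \<Longrightarrow> group (isotropy_group G x)"
proof (rule groupI)
  fix g h k
  assume "g \<in> carrier (isotropy_group G x)" "h \<in> carrier (isotropy_group G x)"
    "k \<in> carrier (isotropy_group G x)"
  then show "g \<otimes>\<^bsub>isotropy_group G x\<^esub> h \<otimes>\<^bsub>isotropy_group G x\<^esub> k =
      g \<otimes>\<^bsub>isotropy_group G x\<^esub> (h \<otimes>\<^bsub>isotropy_group G x\<^esub> k)"
    by (auto simp: isotropy_group_def isotropy_def composable_def intro: mul_assoc)
next
  fix g assume g: "g \<in> carrier (isotropy_group G x)"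
  show "\<one>\<^bsub>isotropy_group G x\<^esub> \<otimes>\<^bsub>isotropy_group G x\<^esub> g = g"
    using g by (auto simp: isotropy_group_def isotropy_def rng_mul_left)
  show "\<exists>h \<in> carrier (isotropy_group G x). h \<otimes>\<^bsub>isotropy_group G x\<^esub> g = \<one>\<^bsub>isotropy_group G x\<^esub>"
    using g inv_isotropy[of g x]
    by (intro bexI[of _ "ginv G g"]) (simp_all add: isotropy_group_def)
qed (auto simp: isotropy_group_def mul_isotropy unit_isotropy)

lemma inv_isotropy_group:
  assumes "x \<in> units G" "g \<in> isotropy G x"
  shows "inv\<^bsub>isotropy_group G x\<^esub> g = ginv G g"
  using group.inv_equality[OF group_isotropy[OF assms(1)], of "ginv G g" g] assms(2)
    inv_isotropy[OF assms(2)] by (simp add: isotropy_group_def)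

end

section \<open>Local sections and limits of units\<close>

context etale_groupoid
begin

definition sec :: "'a set \<Rightarrow> 'a \<Rightarrow> 'a"
  where "sec V = inv_into V (src G)"

lemma sec_in: "z \<in> src G ` V \<Longrightarrow> sec V z \<in> V"
  and src_sec: "z \<in> src G ` V \<Longrightarrow> src G (sec V z) = z"
  by (simp_all add: sec_def inv_into_into f_inv_into_f)

lemma sec_eqI: "open_bisection G V \<Longrightarrow> g \<in> V \<Longrightarrow> src G g = z \<Longrightarrow> sec V z = g"
  unfolding sec_def open_bisection_iff by (metis inv_into_f_f)

text \<open>Limits in \<open>G\<close> are not unique, but two that are units can be compared inside
  the open Hausdorff subspace of units.\<close>

lemma limitin_unit_unique:
  assumes "limitin (topo G) f x F" "limitin (topo G) f y F" "x \<in> units G" "y \<in> units G" "F \<noteq> bot"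
  shows "x = y"
proof -
  have "eventually (\<lambda>z. f z \<in> units G) F"
    by (rule limitinD[OF assms(1) openin_units assms(3)])
  then have "limitin (subtopology (topo G) (units G)) f x F"
      "limitin (subtopology (topo G) (units G)) f y F"
    using assms unfolding limitin_subtopology by auto
  then show ?thesis
    by (rule limitin_Hausdorff_unique[OF _ _ assms(5) Hausdorff_units])
qed

lemma limitin_src: "limitin (topo G) f g F \<Longrightarrow> limitin (topo G) (\<lambda>z. src G (f z)) (src G g) F"
  and limitin_rng: "limitin (topo G) f g F \<Longrightarrow> limitin (topo G) (\<lambda>z. rng G (f z)) (rng G g) F"
  and limitin_inv: "limitin (topo G) f g F \<Longrightarrow> limitin (topo G) (\<lambda>z. ginv G (f z)) (ginv G g) F"
  using continuous_map_limit[OF continuous_src, of f g F] continuous_map_limit[OF continuous_rng, of f g F]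
    continuous_map_limit[OF continuous_inv, of f g F] by (simp_all add: o_def)

lemma limitin_mul:
  assumes "limitin (topo G) f g F" "limitin (topo G) f' h F"
    and "eventually (\<lambda>z. (f z, f' z) \<in> composable G) F" "(g, h) \<in> composable G"
  shows "limitin (topo G) (\<lambda>z. gmul G (f z) (f' z)) (gmul G g h) F"
proof -
  have "limitin (prod_topology (topo G) (topo G)) (\<lambda>z. (f z, f' z)) (g, h) F"
    using assms(1,2) by (simp add: limitin_pairwise o_def)
  then have "limitin (subtopology (prod_topology (topo G) (topo G)) (composable G)) (\<lambda>z. (f z, f' z)) (g, h) F"
    using assms(3,4) by (simp add: limitin_subtopology)
  from continuous_map_limit[OF continuous_mul this] show ?thesis
    by (simp add: o_def)
qed

text \<open>The source is open: a neighbourhood of \<open>k\<close> inside \<open>V\<close> has an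
  open source image around \<open>src G k\<close>, and over that image the section takes its values
  in the neighbourhood.\<close>

lemma
  assumes V: "open_bisection G V" "k \<in> V" and lim: "limitin (topo G) (\<lambda>z. z) (src G k) F"
  shows eventually_src_image: "eventually (\<lambda>z. z \<in> src G ` V) F"
    and limitin_sec: "limitin (topo G) (sec V) k F"
proof -
  have ev: "eventually (\<lambda>z. z \<in> src G ` O') F" if "openin (topo G) O'" "k \<in> O'" for O'
    using limitinD[OF lim openin_src_image[OF that(1)]] that(2) by blast
  then show "eventually (\<lambda>z. z \<in> src G ` V) F"
    using V by (simp add: open_bisection_iff)
  show "limitin (topo G) (sec V) k F"
    unfolding limitin_def
  proof (intro conjI allI impI)
    show "k \<in> arrows G"
      using V bisection_arrow by blast
    fix U assume U: "openin (topo G) U \<and> k \<in> U"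
    then have "eventually (\<lambda>z. z \<in> src G ` (U \<inter> V)) F"
      using V by (intro ev) (auto simp: open_bisection_iff)
    then show "eventually (\<lambda>z. sec V z \<in> U) F"
    proof eventually_elim
      case (elim z)
      then obtain g where "g \<in> U" "g \<in> V" "src G g = z"
        by auto
      then show ?case
        using sec_eqI[OF V(1)] by metis
    qed
  qed
qed

text \<open>Source and range fix units, so by continuity the source and the range of any limit are
  again limits of the same units, and among units the limit is unique.\<close>

lemma filter_limit_isotropy:
  assumes F: "F \<noteq> bot" "eventually (\<lambda>z. z \<in> units G) F"
    and x: "x \<in> units G" "limitin (topo G) (\<lambda>z. z) x F" and g: "g \<in> filter_limits (topo G) F"
  shows "g \<in> isotropy G x"
proof -
  have lim: "limitin (topo G) (\<lambda>z. z) g F"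
    using g by (simp add: filter_limits_def)
  have ga: "g \<in> arrows G"
    using lim by (rule limitin_topspace)
  have "limitin (topo G) (\<lambda>z. z) (src G g) F"
    by (rule limitin_transform_eventually[OF _ limitin_src[OF lim]])
       (use F(2) in \<open>eventually_elim, simp add: src_unit\<close>)
  moreover have "limitin (topo G) (\<lambda>z. z) (rng G g) F"
    by (rule limitin_transform_eventually[OF _ limitin_rng[OF lim]])
       (use F(2) in \<open>eventually_elim, simp add: rng_unit\<close>)
  ultimately have "src G g = x" "rng G g = x"
    using limitin_unit_unique[OF _ x(2) _ x(1) F(1)] src_in_units[OF ga] rng_closed[OF ga] by auto
  with ga show ?thesis
    by (simp add: isotropy_def)
qed

text \<open>Units satisfy \<open>gmul G z z = z\<close> and \<open>ginv G z = z\<close>. Continuity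
  of the operations therefore turns products and inverses of limits into limits of the same
  filter.\<close>

lemma subgroup_filter_limits:
  assumes F: "F \<noteq> bot" "eventually (\<lambda>z. z \<in> units G) F"
    and x: "x \<in> units G" "limitin (topo G) (\<lambda>z. z) x F"
  shows "subgroup (filter_limits (topo G) F) (isotropy_group G x)"
proof (rule group.subgroupI[OF group_isotropy[OF x(1)]])
  note iso = filter_limit_isotropy[OF F x]
  show "filter_limits (topo G) F \<subseteq> carrier (isotropy_group G x)"
    using iso by (auto simp: isotropy_group_def)
  show "filter_limits (topo G) F \<noteq> {}"
    using x(2) by (auto simp: filter_limits_def)
  fix g assume g: "g \<in> filter_limits (topo G) F"
  then have lim: "limitin (topo G) (\<lambda>z. z) g F"
    by (simp add: filter_limits_def)
  have "limitin (topo G) (\<lambda>z. z) (ginv G g) F"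
    by (rule limitin_transform_eventually[OF _ limitin_inv[OF lim]])
       (use F(2) in \<open>eventually_elim, simp add: inv_unit\<close>)
  then show "inv\<^bsub>isotropy_group G x\<^esub> g \<in> filter_limits (topo G) F"
    using inv_isotropy_group[OF x(1) iso[OF g]] by (simp add: filter_limits_def)
  fix h assume h: "h \<in> filter_limits (topo G) F"
  then have lim': "limitin (topo G) (\<lambda>z. z) h F"
    by (simp add: filter_limits_def)
  have "limitin (topo G) (\<lambda>z. gmul G z z) (gmul G g h) F"
  proof (rule limitin_mul[OF lim lim'])
    show "eventually (\<lambda>z. (z, z) \<in> composable G) F"
      using F(2) by eventually_elim (simp add: composable_def unit_arrow src_unit rng_unit)
    show "(g, h) \<in> composable G"
      using iso[OF g] iso[OF h] by (simp add: composable_def isotropy_def)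
  qed
  then have "limitin (topo G) (\<lambda>z. z) (gmul G g h) F"
    by (rule limitin_transform_eventually[rotated])
       (use F(2) in \<open>eventually_elim, metis mul_src src_unit unit_arrow\<close>)
  then show "g \<otimes>\<^bsub>isotropy_group G x\<^esub> h \<in> filter_limits (topo G) F"
    by (simp add: filter_limits_def isotropy_group_def)
qed

text \<open>Since \<open>sec V z\<close> equals its product with the unit \<open>z\<close>, it
  converges to \<open>gmul G k g\<close> for every limit \<open>g\<close> of the units, not only to
  \<open>k\<close>.\<close>

lemma eventually_sec_in:
  assumes V: "open_bisection G V" "k \<in> V" and V': "openin (topo G) V'"
    and F: "eventually (\<lambda>z. z \<in> units G) F" "limitin (topo G) (\<lambda>z. z) (src G k) F"
    and g: "g \<in> filter_limits (topo G) F" "(k, g) \<in> composable G" "gmul G k g \<in> V'"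
  shows "eventually (\<lambda>z. sec V z \<in> V') F"
proof -
  have ev: "eventually (\<lambda>z. z \<in> units G \<and> z \<in> src G ` V) F"
    using F(1) eventually_src_image[OF V F(2)] by (rule eventually_conj)
  have "limitin (topo G) (\<lambda>z. gmul G (sec V z) z) (gmul G k g) F"
  proof (rule limitin_mul[OF limitin_sec[OF V F(2)]])
    show "limitin (topo G) (\<lambda>z. z) g F"
      using g by (simp add: filter_limits_def)
    show "eventually (\<lambda>z. (sec V z, z) \<in> composable G) F"
      using ev
    proof eventually_elim
      case (elim z)
      then show ?case
        using sec_in[of z V] src_sec[of z V] bisection_arrow[OF V(1)]
        by (simp add: composable_def unit_arrow rng_unit)
    qed
  qed fact
  then have "eventually (\<lambda>z. gmul G (sec V z) z \<in> V') F"
    using V' g(3) by (rule limitinD)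
  with ev show ?thesis
  proof eventually_elim
    case (elim z)
    then have "gmul G (sec V z) z = sec V z"
      using sec_in[of z V] src_sec[of z V] bisection_arrow[OF V(1)] mul_src by metis
    with elim show ?case
      by simp
  qed
qed

text \<open>The converse direction. On the finer filter where \<open>sec V z\<close> lies in
  \<open>V'\<close>, this arrow tends to both \<open>k\<close> and \<open>k'\<close>; multiplying
  its inverse by the arrow itself gives \<open>z\<close>, which must then tend to the product of the
  inverse of \<open>k\<close> with \<open>k'\<close>.\<close>

lemma
  assumes V: "open_bisection G V" "k \<in> V" and V': "open_bisection G V'" "k' \<in> V'"
    and src: "src G k' = src G k"
    and F: "eventually (\<lambda>z. z \<in> units G) F" "limitin (topo G) (\<lambda>z. z) (src G k) F"
    and freq: "frequently (\<lambda>z. sec V z \<in> V') F"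
  shows frequently_sec_in_rng: "rng G k' = rng G k"
    and frequently_sec_in: "gmul G (ginv G k) k' \<in> filter_cluster_points (topo G) F"
proof -
  define F' where "F' = inf F (principal {z. sec V z \<in> V'})"
  have F': "F' \<le> F" "F' \<noteq> bot"
    using freq by (auto simp: F'_def trivial_limit_def eventually_inf_principal frequently_def)
  have lim': "limitin (topo G) (\<lambda>z. z) (src G k) F'"
    using F(2) F'(1) by (auto simp: limitin_def dest: filter_leD)
  have ka: "k \<in> arrows G" "k' \<in> arrows G"
    using V V' bisection_arrow by auto
  have "eventually (\<lambda>z. sec V z \<in> V') F'"
    by (simp add: F'_def eventually_inf_principal)
  \<comment> \<open>An arrow of \<open>V'\<close> with source \<open>z\<close> is the value of the
    section of \<open>V'\<close> at \<open>z\<close>.\<close>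
  with eventually_src_image[OF V lim'] have eq: "eventually (\<lambda>z. sec V' z = sec V z) F'"
    by eventually_elim (use sec_eqI[OF V'(1)] src_sec in blast)
  have lk: "limitin (topo G) (sec V) k F'"
    by (rule limitin_sec[OF V lim'])
  have "limitin (topo G) (sec V') k' F'"
    using limitin_sec[OF V'] lim' src by simp
  then have lk': "limitin (topo G) (sec V) k' F'"
    by (rule limitin_transform_eventually[OF eq])
  show rng: "rng G k' = rng G k"
    by (rule limitin_unit_unique[OF limitin_rng[OF lk'] limitin_rng[OF lk]])
       (use ka rng_closed F'(2) in auto)
  have evV: "eventually (\<lambda>z. z \<in> src G ` V) F'"
    by (rule eventually_src_image[OF V lim'])
  have lim: "limitin (topo G) (\<lambda>z. gmul G (ginv G (sec V z)) (sec V z)) (gmul G (ginv G k) k') F'"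
  proof (rule limitin_mul[OF limitin_inv[OF lk] lk'])
    show "eventually (\<lambda>z. (ginv G (sec V z), sec V z) \<in> composable G) F'"
      using evV
    proof eventually_elim
      case (elim z)
      then have "sec V z \<in> arrows G"
        using sec_in bisection_arrow[OF V(1)] by blast
      then show ?case
        by (simp add: composable_def inv_closed src_inv)
    qed
    show "(ginv G k, k') \<in> composable G"
      using ka rng by (simp add: composable_def inv_closed src_inv)
  qed
  have "eventually (\<lambda>z. gmul G (ginv G (sec V z)) (sec V z) = z) F'"
    using evV
  proof eventually_elim
    case (elim z)
    then have "sec V z \<in> arrows G"
      using sec_in bisection_arrow[OF V(1)] by blast
    with elim show ?case
      by (simp add: inv_mul src_sec)
  qed
  then have "limitin (topo G) (\<lambda>z. z) (gmul G (ginv G k) k') F'"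
    using lim by (rule limitin_transform_eventually)
  then show "gmul G (ginv G k) k' \<in> filter_cluster_points (topo G) F"
    by (intro limit_of_finer_is_cluster_point[OF F']) (simp add: filter_limits_def)
qed

end

section \<open>Compactly supported functions on bisections\<close>

lemma continuous_map_tendsto_iff:
  "continuous_map X euclidean f \<longleftrightarrow> (\<forall>x \<in> topspace X. (f \<longlongrightarrow> f x) (atin X x))"
  by (simp add: continuous_map_atin)

lemma continuous_map_mult_field:
  fixes f g :: "'a \<Rightarrow> 'b::real_normed_algebra"
  assumes "continuous_map X euclidean f" "continuous_map X euclidean g"
  shows "continuous_map X euclidean (\<lambda>x. f x * g x)"
  using assms by (auto simp: continuous_map_tendsto_iff intro!: tendsto_mult)

text \<open>Hausdorffness of \<open>U\<close> makes the compact set \<open>K\<close> closed in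
  \<open>U\<close>, so it contains the closure of the set where \<open>f\<close> does not
  vanish.\<close>

lemma Cc_onI:
  assumes "Hausdorff_space (subtopology X U)"
    and "continuous_map (subtopology X U) euclidean f"
    and K: "compactin X K" "K \<subseteq> U" and supp: "\<And>x. f x \<noteq> 0 \<Longrightarrow> x \<in> K"
  shows "f \<in> Cc_on X U"
proof -
  let ?S = "subtopology X U closure_of {x \<in> U. f x \<noteq> 0}"
  have cK: "compactin (subtopology X U) K"
    using K by (simp add: compactin_subtopology)
  then have "closedin (subtopology X U) K"
    using assms(1) compactin_imp_closedin by blast
  then have "?S \<subseteq> K"
    using supp by (intro closure_of_minimal) auto
  then have "compactin (subtopology X U) ?S"
    using closed_compactin[OF cK _ closedin_closure_of] by blast
  then show ?thesis
    using assms(2) K(2) supp by (auto simp: Cc_on_def)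
qed

lemma Cc_on_continuous: "f \<in> Cc_on X U \<Longrightarrow> continuous_map (subtopology X U) euclidean f"
  by (simp add: Cc_on_def)

lemma Cc_on_support:
  assumes "f \<in> Cc_on X U" "U \<subseteq> topspace X"
  obtains K where "compactin X K" "K \<subseteq> U" "\<And>x. f x \<noteq> 0 \<Longrightarrow> x \<in> K"
proof -
  let ?S = "subtopology X U closure_of {x \<in> U. f x \<noteq> 0}"
  have "compactin X ?S" "?S \<subseteq> U"
    using assms(1) by (auto simp: Cc_on_def compactin_subtopology)
  moreover have "x \<in> ?S" if "f x \<noteq> 0" for x
  proof -
    have "{x \<in> U. f x \<noteq> 0} \<subseteq> ?S"
      using assms(2) by (intro closure_of_subset) auto
    moreover have "x \<in> U"
      using that assms(1) by (auto simp: Cc_on_def)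
    ultimately show ?thesis
      using that by blast
  qed
  ultimately show thesis
    by (rule that)
qed

lemma Cc_on_bounded:
  assumes "f \<in> Cc_on X U" "U \<subseteq> topspace X"
  obtains M where "\<And>x. cmod (f x) \<le> M" "M \<ge> 0"
proof -
  obtain K where K: "compactin X K" "K \<subseteq> U" "\<And>x. f x \<noteq> 0 \<Longrightarrow> x \<in> K"
    using Cc_on_support[OF assms] by metis
  have "compactin (subtopology X U) K"
    using K by (simp add: compactin_subtopology)
  then have "compactin euclidean (f ` K)"
    by (rule image_compactin[OF _ Cc_on_continuous[OF assms(1)]])
  then have "bounded (f ` K)"
    by (simp add: compact_imp_bounded)
  then obtain M where M: "\<And>x. x \<in> K \<Longrightarrow> cmod (f x) \<le> M"
    unfolding bounded_iff by auto
  have "cmod (f x) \<le> max 0 M" for x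
    using M[of x] K(3)[of x] by (cases "f x = 0") auto
  then show thesis
    by (intro that[of "max 0 M"]) auto
qed

lemma Cc_on_add:
  assumes "Hausdorff_space (subtopology X U)" "U \<subseteq> topspace X" "f \<in> Cc_on X U" "f' \<in> Cc_on X U"
  shows "(\<lambda>x. f x + f' x) \<in> Cc_on X U"
proof -
  obtain K where K: "compactin X K" "K \<subseteq> U" "\<And>x. f x \<noteq> 0 \<Longrightarrow> x \<in> K"
    using Cc_on_support[OF assms(3,2)] by metis
  obtain K' where K': "compactin X K'" "K' \<subseteq> U" "\<And>x. f' x \<noteq> 0 \<Longrightarrow> x \<in> K'"
    using Cc_on_support[OF assms(4,2)] by metis
  show ?thesis
  proof (rule Cc_onI[OF assms(1), of _ "K \<union> K'"])
    show "continuous_map (subtopology X U) euclidean (\<lambda>x. f x + f' x)"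
      by (intro continuous_map_add Cc_on_continuous assms)
    show "x \<in> K \<union> K'" if "f x + f' x \<noteq> 0" for x
      using that K(3)[of x] K'(3)[of x] by (cases "f x = 0") auto
  qed (use K K' in \<open>auto intro: compactin_Un\<close>)
qed

lemma Cc_on_mult_left:
  assumes "Hausdorff_space (subtopology X U)" "U \<subseteq> topspace X" "f \<in> Cc_on X U"
    and "continuous_map (subtopology X U) euclidean c"
  shows "(\<lambda>x. c x * f x) \<in> Cc_on X U"
proof -
  obtain K where K: "compactin X K" "K \<subseteq> U" "\<And>x. f x \<noteq> 0 \<Longrightarrow> x \<in> K"
    using Cc_on_support[OF assms(3,2)] by metis
  show ?thesis
    by (rule Cc_onI[OF assms(1) _ K(1,2)])
       (use K(3) Cc_on_continuous[OF assms(3)] assms(4) in \<open>auto intro: continuous_map_mult_field\<close>)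
qed

lemma Cc_on_cmult:
  assumes "Hausdorff_space (subtopology X U)" "U \<subseteq> topspace X" "f \<in> Cc_on X U"
  shows "(\<lambda>x. c * f x) \<in> Cc_on X U"
  using Cc_on_mult_left[OF assms, of "\<lambda>_. c"] by simp

lemma Cc_on_zero: "Hausdorff_space (subtopology X U) \<Longrightarrow> (\<lambda>x. 0) \<in> Cc_on X U"
  by (rule Cc_onI[where K = "{}"]) auto

lemma Cc_on_sum:
  assumes "Hausdorff_space (subtopology X U)" "U \<subseteq> topspace X" "\<And>i. i \<in> I \<Longrightarrow> f i \<in> Cc_on X U"
  shows "(\<lambda>x. \<Sum>i \<in> I. f i x) \<in> Cc_on X U"
  using assms(3)
  by (induction I rule: infinite_finite_induct)
     (use assms(1,2) in \<open>auto intro: Cc_on_add Cc_on_zero\<close>)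

text \<open>The support is closed in the Hausdorff space \<open>X\<close>, so extension by zero is continuous.\<close>

lemma Cc_on_extend:
  assumes X: "Hausdorff_space X" and W: "openin X W" and f: "f \<in> Cc_on X W"
  shows "continuous_map X euclidean f"
proof -
  obtain K where K: "compactin X K" "K \<subseteq> W" "\<And>x. f x \<noteq> 0 \<Longrightarrow> x \<in> K"
    using Cc_on_support[OF f openin_subset[OF W]] by metis
  have cl: "closedin X K"
    by (rule compactin_imp_closedin[OF X K(1)])
  show ?thesis
  proof (rule pasting_lemma[where I = "{W, topspace X - K}" and T = "\<lambda>T. T" and f = "\<lambda>_. f"])
    fix T assume T: "T \<in> {W, topspace X - K}"
    then show "openin X T"
      using W cl by auto
    have "continuous_map (subtopology X (topspace X - K)) euclidean f"
      by (rule continuous_map_eq[of _ _ "\<lambda>_. 0"]) (use K(3) in auto)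
    then show "continuous_map (subtopology X T) euclidean f"
      using T Cc_on_continuous[OF f] by auto
  qed (use K(2) in auto)
qed

section \<open>Transfer between bisections and the unit space\<close>

context etale_groupoid
begin

definition lift :: "'a set \<Rightarrow> ('a \<Rightarrow> complex) \<Rightarrow> 'a \<Rightarrow> complex"
  where "lift V \<psi> g = (if g \<in> V then \<psi> (src G g) else 0)"

text \<open>For \<open>f\<close> in \<open>Cc_on (topo G) V\<close> this is continuous on the whole
  unit space, whereas \<open>f\<close> itself may be discontinuous on \<open>G\<close>.\<close>

definition descend :: "'a set \<Rightarrow> ('a \<Rightarrow> complex) \<Rightarrow> 'a \<Rightarrow> complex"
  where "descend V f z = (if z \<in> src G ` V then f (sec V z) else 0)"

lemma lift_descend:
  assumes "open_bisection G V" "f \<in> Cc_on (topo G) V"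
  shows "lift V (descend V f) = f"
proof
  fix g show "lift V (descend V f) g = f g"
    using assms sec_eqI[OF assms(1), of g "src G g"] by (auto simp: lift_def descend_def Cc_on_def)
qed

lemma bisection_subset_arrows: "open_bisection G V \<Longrightarrow> V \<subseteq> arrows G"
  using bisection_arrow by blast

lemma continuous_src_units:
  "continuous_map (topo G) (subtopology (topo G) (units G)) (src G)"
  using continuous_src src_in_units by (auto simp: continuous_map_in_subtopology)

lemma unit_function_tendsto:
  assumes "continuous_map (subtopology (topo G) (units G)) euclidean \<psi>"
    and "x \<in> units G" "limitin (topo G) (\<lambda>z. z) x F"
  shows "(\<psi> \<longlongrightarrow> \<psi> x) F"
proof -
  have "limitin (subtopology (topo G) (units G)) (\<lambda>z. z) x F"
    using assms(2,3) limitinD[OF assms(3) openin_units assms(2)] by (simp add: limitin_subtopology)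
  from continuous_map_limit[OF assms(1) this] show ?thesis
    by (simp add: o_def)
qed

lemma Cc_on_units_extend:
  assumes "openin (topo G) W" "W \<subseteq> units G" "\<psi> \<in> Cc_on (topo G) W"
  shows "continuous_map (subtopology (topo G) (units G)) euclidean \<psi>"
proof (rule Cc_on_extend[OF Hausdorff_units])
  show "openin (subtopology (topo G) (units G)) W"
    using assms by (simp add: openin_unit_space)
  show "\<psi> \<in> Cc_on (subtopology (topo G) (units G)) W"
    using assms by (simp add: Cc_on_def subtopology_subtopology inf.absorb2)
qed

lemma Hausdorff_subset_units: "W \<subseteq> units G \<Longrightarrow> Hausdorff_space (subtopology (topo G) W)"
  using Hausdorff_space_subtopology[OF Hausdorff_units, of W]
  by (simp add: subtopology_subtopology inf.absorb2)

lemma continuous_lift_factor: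
  assumes "continuous_map (subtopology (topo G) (units G)) euclidean \<psi>"
  shows "continuous_map (subtopology (topo G) V) euclidean (\<lambda>g. \<psi> (src G g))"
  using continuous_map_from_subtopology[OF continuous_map_compose[OF continuous_src_units assms]]
  by (simp add: o_def)

text \<open>The source homeomorphism of \<open>V\<close> pulls the compact support in
  \<open>W\<close> back to a compact set \<open>L\<close>. Continuity rests on extending \<psi> by
  zero to all units, because \<open>V\<close> may reach beyond \<open>W\<close>.\<close>

lemma lift_Cc:
  assumes V: "open_bisection G V" and W: "openin (topo G) W" "W \<subseteq> src G ` V"
    and \<psi>: "\<psi> \<in> Cc_on (topo G) W"
  shows "lift V \<psi> \<in> Cc_on (topo G) V"
proof -
  have Wu: "W \<subseteq> units G"
    using W(2) src_bisection_subset[OF V] by blast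
  obtain K where K: "compactin (topo G) K" "K \<subseteq> W" "\<And>x. \<psi> x \<noteq> 0 \<Longrightarrow> x \<in> K"
    using Cc_on_support[OF \<psi> openin_subset[OF W(1)]] by metis
  define L where "L = {g \<in> V. src G g \<in> K}"
  have im: "src G ` L = K"
    using K(2) W(2) by (auto simp: L_def)
  have homeo: "homeomorphic_map (subtopology (topo G) V) (subtopology (topo G) (src G ` V)) (src G)"
    using V by (simp add: open_bisection_def)
  have top: "topspace (subtopology (topo G) V) = V"
    using bisection_subset_arrows[OF V] by auto
  have "compactin (subtopology (topo G) (src G ` V)) (src G ` L)"
    using K W(2) by (auto simp: im compactin_subtopology)
  then have "compactin (subtopology (topo G) V) L"
    using homeomorphic_map_compactness[OF homeo, of L] unfolding top by (simp add: L_def)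
  then have L: "compactin (topo G) L"
    by (simp add: compactin_subtopology)
  show ?thesis
  proof (rule Cc_onI[OF Hausdorff_bisection[OF V] _ L])
    have "continuous_map (subtopology (topo G) V) euclidean (\<lambda>g. \<psi> (src G g))"
      by (rule continuous_lift_factor[OF Cc_on_units_extend[OF W(1) Wu \<psi>]])
    then show "continuous_map (subtopology (topo G) V) euclidean (lift V \<psi>)"
      by (rule continuous_map_eq) (simp add: lift_def)
    show "L \<subseteq> V"
      by (auto simp: L_def)
    show "g \<in> L" if "lift V \<psi> g \<noteq> 0" for g
      using that K(3) by (auto simp: L_def lift_def split: if_splits)
  qed
qed

lemma descend_Cc:
  assumes V: "open_bisection G V" and f: "f \<in> Cc_on (topo G) V"
  shows "descend V f \<in> Cc_on (topo G) (src G ` V)"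
proof -
  obtain K where K: "compactin (topo G) K" "K \<subseteq> V" "\<And>x. f x \<noteq> 0 \<Longrightarrow> x \<in> K"
    using Cc_on_support[OF f bisection_subset_arrows[OF V]] by metis
  have top: "topspace (subtopology (topo G) V) = V"
      "topspace (subtopology (topo G) (src G ` V)) = src G ` V"
    using bisection_subset_arrows[OF V] src_closed by auto
  obtain s where s: "homeomorphic_maps (subtopology (topo G) V) (subtopology (topo G) (src G ` V)) (src G) s"
    using V unfolding open_bisection_def homeomorphic_map_maps by blast
  then have cont: "continuous_map (subtopology (topo G) (src G ` V)) (subtopology (topo G) V) s"
    and inv: "\<And>z. z \<in> src G ` V \<Longrightarrow> src G (s z) = z" "\<And>g. g \<in> V \<Longrightarrow> s (src G g) = g"
    unfolding homeomorphic_maps_def top by auto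
  have "sec V z = s z" if "z \<in> src G ` V" for z
    using that inv sec_eqI[OF V] by auto
  then have "continuous_map (subtopology (topo G) (src G ` V)) (subtopology (topo G) V) (sec V)"
    using continuous_map_eq[OF cont] top by metis
  from continuous_map_compose[OF this Cc_on_continuous[OF f]]
  have c: "continuous_map (subtopology (topo G) (src G ` V)) euclidean (descend V f)"
    by (rule continuous_map_eq) (simp add: descend_def top)
  show ?thesis
  proof (rule Cc_onI[OF Hausdorff_subset_units[OF src_bisection_subset[OF V]] c])
    show "compactin (topo G) (src G ` K)"
      by (rule image_compactin[OF K(1) continuous_src])
    show "src G ` K \<subseteq> src G ` V"
      using K(2) by blast
    show "z \<in> src G ` K" if "descend V f z \<noteq> 0" for z
    proof -
      have "z \<in> src G ` V" "f (sec V z) \<noteq> 0"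
        using that by (auto simp: descend_def split: if_splits)
      then show ?thesis
        using K(3) src_sec by (metis image_eqI)
    qed
  qed
qed

lemma descend_continuous:
  assumes V: "open_bisection G V" and f: "f \<in> Cc_on (topo G) V"
  shows "continuous_map (subtopology (topo G) (units G)) euclidean (descend V f)"
  by (rule Cc_on_units_extend[OF _ src_bisection_subset[OF V] descend_Cc[OF assms]])
     (use V in \<open>simp add: openin_src_image open_bisection_iff\<close>)

text \<open>Members of the span come with no preferred bisections, so limits and estimates refer to
  a chosen finite decomposition. Several summands may use the same bisection, and different
  bisections may overlap.\<close>

definition decomposes :: "('a \<Rightarrow> complex) \<Rightarrow> nat \<Rightarrow> (nat \<Rightarrow> 'a set) \<Rightarrow> (nat \<Rightarrow> 'a \<Rightarrow> complex) \<Rightarrow> bool"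
  where "decomposes f m U \<phi> \<longleftrightarrow>
    (\<forall>i < m. open_bisection G (U i) \<and> \<phi> i \<in> Cc_on (topo G) (U i)) \<and> (\<forall>g. f g = (\<Sum>i < m. \<phi> i g))"

lemma decomposesD:
  assumes "decomposes f m U \<phi>"
  shows "i < m \<Longrightarrow> open_bisection G (U i)" "i < m \<Longrightarrow> \<phi> i \<in> Cc_on (topo G) (U i)"
    "f g = (\<Sum>i < m. \<phi> i g)"
  using assms by (auto simp: decomposes_def)

lemma Connes_algebra_decompose:
  assumes "f \<in> Connes_algebra G"
  obtains m U \<phi> where "decomposes f m U \<phi>"
proof -
  have "\<exists>m U \<phi>. decomposes f m U \<phi>"
    using assms unfolding Connes_algebra_def
  proof (induction rule: cfun.span_induct_alt)
    case base
    have "decomposes 0 0 (\<lambda>_. {}) (\<lambda>_ _. 0)"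
      by (simp add: decomposes_def)
    then show ?case
      by blast
  next
    case (step c f f')
    then obtain U where U: "open_bisection G U" "f \<in> Cc_on (topo G) U"
      by blast
    obtain m U' \<phi> where d: "decomposes f' m U' \<phi>"
      using step by blast
    have "(\<lambda>g. c * f g) \<in> Cc_on (topo G) U"
      by (rule Cc_on_cmult[OF Hausdorff_bisection[OF U(1)] bisection_subset_arrows[OF U(1)] U(2)])
    then have "decomposes ((\<lambda>g. c * f g) + f') (Suc m) (U'(m := U)) (\<phi>(m := \<lambda>g. c * f g))"
      using d U(1) by (auto simp: decomposes_def less_Suc_eq add.commute)
    then show ?case
      by blast
  qed
  then show thesis
    using that by blast
qed

lemma Cc_on_Connes: "open_bisection G U \<Longrightarrow> f \<in> Cc_on (topo G) U \<Longrightarrow> f \<in> Connes_algebra G"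
  unfolding Connes_algebra_def by (rule cfun.span_base) blast

lemma Connes_sum: "(\<And>i. i \<in> I \<Longrightarrow> f i \<in> Connes_algebra G) \<Longrightarrow> (\<lambda>g. \<Sum>i \<in> I. f i g) \<in> Connes_algebra G"
proof -
  assume "\<And>i. i \<in> I \<Longrightarrow> f i \<in> Connes_algebra G"
  then have "sum f I \<in> Connes_algebra G"
    unfolding Connes_algebra_def by (rule cfun.span_sum)
  moreover have "sum f I = (\<lambda>g. \<Sum>i \<in> I. f i g)"
    by (induction I rule: infinite_finite_induct) auto
  ultimately show ?thesis
    by simp
qed

lemma Connes_cmult: "f \<in> Connes_algebra G \<Longrightarrow> (\<lambda>g. c * f g) \<in> Connes_algebra G"
  unfolding Connes_algebra_def by (rule cfun.span_scale)

text \<open>This separates the continuous factor, a function of the source alone, from the indicator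
  of the bisection, which carries all discontinuity.\<close>

lemma decomposes_value:
  assumes d: "decomposes f m U \<phi>" and i: "i < m"
  shows "\<phi> i g = (if g \<in> U i then descend (U i) (\<phi> i) (src G g) else 0)"
  using lift_descend[OF decomposesD(1,2)[OF d i]] by (metis lift_def)

lemma decomposes_support:
  assumes d: "decomposes f m U \<phi>" and "f g \<noteq> 0"
  obtains i where "i < m" "g \<in> U i" "\<phi> i g \<noteq> 0"
proof -
  obtain i where "i < m" "\<phi> i g \<noteq> 0"
    using assms by (metis decomposesD(3) lessThan_iff sum.neutral)
  moreover from this have "g \<in> U i"
    using decomposes_value[OF d] by metis
  ultimately show thesis
    using that by blast
qed

section \<open>Limits along units and coset sums\<close>

text \<open>Each bisection \<open>U i\<close> has at most one arrow over \<open>x\<close>, namely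
  \<open>sec (U i) x\<close>. Different indices may give the same arrow, so the sum over arrows is
  regrouped as a sum over indices, whose terms can be treated one by one in a limit.\<close>

lemma sum_fibre_subset:
  assumes d: "decomposes f m U \<phi>" and x: "Y \<subseteq> source_fibre G x"
  shows "(\<Sum>g \<in> {g \<in> Y. f g \<noteq> 0}. f g) =
    (\<Sum>i < m. if x \<in> src G ` U i \<and> sec (U i) x \<in> Y then descend (U i) (\<phi> i) x else 0)"
proof -
  define P where "P = {i. i < m \<and> x \<in> src G ` U i \<and> sec (U i) x \<in> Y}"
  define Q where "Q = (\<lambda>i. sec (U i) x) ` P"
  have fin: "finite Q"
    by (simp add: Q_def P_def)
  have val: "\<phi> i g = (if i \<in> P \<and> sec (U i) x = g then descend (U i) (\<phi> i) x else 0)"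
    if "g \<in> Y" "i < m" for g i
  proof -
    have "src G g = x"
      using that x by (auto simp: source_fibre_def)
    have "g \<in> U i \<longleftrightarrow> i \<in> P \<and> sec (U i) x = g"
    proof
      assume g: "g \<in> U i"
      then have "sec (U i) x = g"
        using sec_eqI[OF decomposesD(1)[OF d that(2)]] \<open>src G g = x\<close> by simp
      moreover have "x \<in> src G ` U i"
        using g \<open>src G g = x\<close> by blast
      ultimately show "i \<in> P \<and> sec (U i) x = g"
        using that by (simp add: P_def)
    next
      assume "i \<in> P \<and> sec (U i) x = g"
      then show "g \<in> U i"
        using sec_in[of x "U i"] by (auto simp: P_def)
    qed
    then show ?thesis
      using decomposes_value[OF d that(2), of g] \<open>src G g = x\<close> by simp
  qed
  have "{g \<in> Y. f g \<noteq> 0} \<subseteq> Q"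
  proof
    fix g assume "g \<in> {g \<in> Y. f g \<noteq> 0}"
    then have g: "g \<in> Y" "f g \<noteq> 0"
      by auto
    then obtain i where "i < m" "\<phi> i g \<noteq> 0"
      using decomposes_support[OF d] by metis
    then have "i \<in> P" "sec (U i) x = g"
      using val[OF g(1)] by (auto split: if_splits)
    then show "g \<in> Q"
      by (auto simp: Q_def)
  qed
  moreover have "Q \<subseteq> Y"
    by (auto simp: Q_def P_def)
  ultimately have "(\<Sum>g \<in> {g \<in> Y. f g \<noteq> 0}. f g) = (\<Sum>g \<in> Q. f g)"
    using fin by (intro sum.mono_neutral_left) auto
  also have "\<dots> = (\<Sum>g \<in> Q. \<Sum>i < m. if i \<in> P \<and> sec (U i) x = g then descend (U i) (\<phi> i) x else 0)"
    using val \<open>Q \<subseteq> Y\<close> by (intro sum.cong refl) (auto simp: decomposesD(3)[OF d] intro!: sum.cong)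
  also have "\<dots> = (\<Sum>i < m. \<Sum>g \<in> Q. if i \<in> P \<and> sec (U i) x = g then descend (U i) (\<phi> i) x else 0)"
    by (rule sum.swap)
  also have "\<dots> = (\<Sum>i < m. if i \<in> P then descend (U i) (\<phi> i) x else 0)"
  proof (intro sum.cong refl)
    fix i
    show "(\<Sum>g \<in> Q. if i \<in> P \<and> sec (U i) x = g then descend (U i) (\<phi> i) x else 0) =
        (if i \<in> P then descend (U i) (\<phi> i) x else 0)"
      using fin by (cases "i \<in> P") (auto simp: Q_def sum.delta)
  qed
  also have "\<dots> = (\<Sum>i < m. if x \<in> src G ` U i \<and> sec (U i) x \<in> Y then descend (U i) (\<phi> i) x else 0)"
    by (intro sum.cong) (auto simp: P_def)
  finally show ?thesis .
qed

text \<open>Each summand obeys a dichotomy over \<open>x\<close>: if the arrow of \<open>U i\<close>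
  over \<open>x\<close> lies in the coset of \<open>k\<close>, the section through \<open>k\<close>
  eventually lies in \<open>U i\<close>; if not, it eventually avoids \<open>U i\<close>. Hence
  precisely the indices seen by the coset survive in the limit.\<close>

lemma tendsto_coset_sum:
  assumes d: "decomposes f m U \<phi>" and V: "open_bisection G V" "k \<in> V" and k: "src G k = x"
    and F: "eventually (\<lambda>z. z \<in> units G) F" "limitin (topo G) (\<lambda>z. z) x F"
    and X: "filter_limits (topo G) F = X" "filter_cluster_points (topo G) F \<subseteq> X" "X \<subseteq> isotropy G x"
  shows "((\<lambda>z. f (sec V z)) \<longlongrightarrow> (\<Sum>g \<in> {g \<in> coset G k X. f g \<noteq> 0}. f g)) F"
proof -
  have ka: "k \<in> arrows G" and x: "x \<in> units G"
    using V k bisection_arrow src_in_units by auto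
  have comp: "(k, g) \<in> composable G" if "g \<in> X" for g
    using that X(3) ka k by (auto simp: composable_def isotropy_def)
  have Y: "coset G k X \<subseteq> source_fibre G x"
  proof
    fix g assume "g \<in> coset G k X"
    then obtain h where h: "h \<in> X" "g = gmul G k h"
      by (auto simp: coset_def)
    then show "g \<in> source_fibre G x"
      using comp X(3) by (auto simp: source_fibre_def mul_closed src_mul isotropy_def)
  qed
  have evV: "eventually (\<lambda>z. z \<in> src G ` V) F"
    using eventually_src_image[OF V] F(2) k by simp
  have lim: "((\<lambda>z. \<phi> i (sec V z)) \<longlongrightarrow>
      (if x \<in> src G ` U i \<and> sec (U i) x \<in> coset G k X then descend (U i) (\<phi> i) x else 0)) F"
    if i: "i < m" for i
  proof -
    note Ui = decomposesD(1)[OF d i]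
    let ?p = "descend (U i) (\<phi> i)"
    have tend: "(?p \<longlongrightarrow> ?p x) F"
      by (rule unit_function_tendsto[OF descend_continuous[OF decomposesD(1,2)[OF d i]] x F(2)])
    have val: "eventually (\<lambda>z. \<phi> i (sec V z) = (if sec V z \<in> U i then ?p z else 0)) F"
      using evV by eventually_elim (metis decomposes_value[OF d i] src_sec)
    show ?thesis
    proof (cases "x \<in> src G ` U i")
      \<comment> \<open>The section may enter and leave \<open>U i\<close> without end, but the
        continuous factor \<open>?p\<close> vanishes at \<open>x\<close> and forces the product to
        zero.\<close>
      case False
      then have "((\<lambda>z. cmod (?p z)) \<longlongrightarrow> 0) F"
        using tendsto_norm[OF tend] by (simp add: descend_def)
      then have "((\<lambda>z. \<phi> i (sec V z)) \<longlongrightarrow> 0) F"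
        by (rule Lim_null_comparison[rotated]) (use val in \<open>eventually_elim, auto\<close>)
      with False show ?thesis
        by simp
    next
      case True
      then have k': "sec (U i) x \<in> U i" "src G (sec (U i) x) = src G k"
        using sec_in src_sec k by auto
      then have ka': "sec (U i) x \<in> arrows G"
        using bisection_arrow[OF Ui] by blast
      have F': "limitin (topo G) (\<lambda>z. z) (src G k) F"
        using F(2) k by simp
      show ?thesis
      proof (cases "sec (U i) x \<in> coset G k X")
        case in_coset: True
        then obtain g where g: "g \<in> X" "sec (U i) x = gmul G k g"
          by (auto simp: coset_def)
        have "eventually (\<lambda>z. sec V z \<in> U i) F"
          by (rule eventually_sec_in[OF V _ F(1) F', of _ g])
             (use Ui comp g X(1) k'(1) in \<open>auto simp: open_bisection_iff\<close>)
        with val have "eventually (\<lambda>z. ?p z = \<phi> i (sec V z)) F"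
          by eventually_elim simp
        from Lim_transform_eventually[OF tend this] True in_coset show ?thesis
          by simp
      next
        \<comment> \<open>Visiting \<open>U i\<close> frequently would produce a cluster point of
          the units outside \<open>X\<close>; this is where the control of cluster points, and not
          just of limits, enters.\<close>
        case out: False
        have "\<not> frequently (\<lambda>z. sec V z \<in> U i) F"
        proof
          assume freq: "frequently (\<lambda>z. sec V z \<in> U i) F"
          have "rng G (sec (U i) x) = rng G k"
            by (rule frequently_sec_in_rng[OF V Ui k' F(1) F' freq])
          then have "gmul G k (gmul G (ginv G k) (sec (U i) x)) = sec (U i) x"
            using mul_inv_cancel[OF ka ka'] by simp
          moreover have "gmul G (ginv G k) (sec (U i) x) \<in> X"
            using frequently_sec_in[OF V Ui k' F(1) F' freq] X(2) by blast
          ultimately have "sec (U i) x \<in> coset G k X"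
            unfolding coset_def by (metis image_eqI)
          with out show False
            by blast
        qed
        then have "eventually (\<lambda>z. sec V z \<notin> U i) F"
          by (simp add: not_frequently)
        with val have "eventually (\<lambda>z. 0 = \<phi> i (sec V z)) F"
          by eventually_elim simp
        from Lim_transform_eventually[OF tendsto_const this] out show ?thesis
          by simp
      qed
    qed
  qed
  have "((\<lambda>z. \<Sum>i < m. \<phi> i (sec V z)) \<longlongrightarrow>
      (\<Sum>i < m. if x \<in> src G ` U i \<and> sec (U i) x \<in> coset G k X then descend (U i) (\<phi> i) x else 0)) F"
    by (rule tendsto_sum) (simp add: lim)
  then show ?thesis
    unfolding sum_fibre_subset[OF d Y] decomposesD(3)[OF d, symmetric] .
qed

end

section \<open>The regular representation\<close>

lemma infsum_eq_single:
  fixes f :: "'a \<Rightarrow> 'b::{comm_monoid_add, t2_space}"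
  assumes "a \<in> A" "\<And>x. x \<in> A \<Longrightarrow> x \<noteq> a \<Longrightarrow> f x = 0"
  shows "infsum f A = f a"
proof -
  have "infsum f A = infsum f {a}"
    using assms by (intro infsum_cong_neutral) auto
  then show ?thesis
    by simp
qed

lemma infsum_finite_sum:
  fixes f :: "'i \<Rightarrow> 'a \<Rightarrow> 'b::{topological_comm_monoid_add, t2_space}"
  assumes "\<And>i. i \<in> I \<Longrightarrow> f i summable_on A"
  shows "infsum (\<lambda>x. \<Sum>i \<in> I. f i x) A = (\<Sum>i \<in> I. infsum (f i) A)"
proof -
  have "((\<lambda>x. \<Sum>i \<in> I. f i x) has_sum (\<Sum>i \<in> I. infsum (f i) A)) A"
    using assms
    by (induction I rule: infinite_finite_induct) (auto intro!: has_sum_add has_sum_infsum)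
  then show ?thesis
    by (rule infsumI)
qed

lemma nonneg_summable_finite_bound:
  fixes f :: "'a \<Rightarrow> real"
  assumes "\<And>x. x \<in> A \<Longrightarrow> f x \<ge> 0" "\<And>T. finite T \<Longrightarrow> T \<subseteq> A \<Longrightarrow> sum f T \<le> b"
  shows "f summable_on A" "infsum f A \<le> b"
proof -
  show s: "f summable_on A"
    by (rule nonneg_bdd_above_summable_on) (use assms in \<open>auto intro!: bdd_aboveI[of _ b]\<close>)
  show "infsum f A \<le> b"
    by (rule infsum_le_finite_sums[OF s]) (use assms(2) in auto)
qed

lemma ell2_summable: "\<xi> \<in> ell2 A \<Longrightarrow> (\<lambda>g. (cmod (\<xi> g))\<^sup>2) summable_on A"
  by (simp add: ell2_def)

lemma ell2_cmult: "\<xi> \<in> ell2 A \<Longrightarrow> (\<lambda>g. c * \<xi> g) \<in> ell2 A"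
  by (auto simp: ell2_def norm_mult power_mult_distrib intro: summable_on_cmult_right)

lemma ell2_add:
  assumes "\<xi> \<in> ell2 A" "\<eta> \<in> ell2 A"
  shows "\<xi> + \<eta> \<in> ell2 A"
proof -
  have "(\<lambda>g. 2 * (cmod (\<xi> g))\<^sup>2 + 2 * (cmod (\<eta> g))\<^sup>2) summable_on A"
    by (intro summable_on_add summable_on_cmult_right ell2_summable assms)
  moreover have "(cmod (\<xi> g + \<eta> g))\<^sup>2 \<le> 2 * (cmod (\<xi> g))\<^sup>2 + 2 * (cmod (\<eta> g))\<^sup>2" for g
  proof -
    have "(cmod (\<xi> g + \<eta> g))\<^sup>2 \<le> (cmod (\<xi> g) + cmod (\<eta> g))\<^sup>2"
      by (intro power_mono norm_triangle_ineq) simp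
    also have "\<dots> \<le> 2 * (cmod (\<xi> g))\<^sup>2 + 2 * (cmod (\<eta> g))\<^sup>2"
      using zero_le_power2[of "cmod (\<xi> g) - cmod (\<eta> g)"]
      by (simp add: power2_eq_square algebra_simps)
    finally show ?thesis .
  qed
  ultimately have "(\<lambda>g. (cmod ((\<xi> + \<eta>) g))\<^sup>2) summable_on A"
    by (intro summable_on_comparison_test[of _ A "\<lambda>g. (cmod ((\<xi> + \<eta>) g))\<^sup>2"]) simp_all
  then show ?thesis
    using assms by (simp add: ell2_def)
qed

lemma delta_ell2: "a \<in> A \<Longrightarrow> delta a \<in> ell2 A"
  by (auto simp: ell2_def delta_def
      intro!: finite_nonzero_values_imp_summable_on finite_subset[of _ "{a}"] split: if_splits)

section \<open>Convolution by a bisection as a weighted partial injection of a fibre\<close>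

context etale_groupoid
begin

text \<open>The products all have the range of \<open>g\<close>, and \<open>U\<close> has at most
  one arrow with that range. In matrix terms, convolution by a function supported on
  \<open>U\<close> has at most one nonzero entry in each row.\<close>

lemma translate_unique:
  assumes U: "open_bisection G U" and g: "g \<in> arrows G"
    and h: "h \<in> source_fibre G (src G g)" "gmul G g (ginv G h) \<in> U"
    and h': "h' \<in> source_fibre G (src G g)" "gmul G g (ginv G h') \<in> U"
  shows "h = h'"
proof -
  have comp: "(g, ginv G h) \<in> composable G" "(g, ginv G h') \<in> composable G"
    using g h(1) h'(1) by (auto simp: composable_def source_fibre_def inv_closed rng_inv)
  then have "gmul G g (ginv G h) = gmul G g (ginv G h')"
    using U h(2) h'(2) unfolding open_bisection_iff by (metis inj_onD rng_mul)
  then have "ginv G h = ginv G h'"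
    using inv_mul_cancel comp by metis
  then show ?thesis
    using inv_inv h(1) h'(1) unfolding source_fibre_def by (metis mem_Collect_eq)
qed

text \<open>The same for columns: the products all have the source \<open>rng G h\<close>.\<close>

lemma translate_unique':
  assumes U: "open_bisection G U" and h: "h \<in> arrows G"
    and g: "g \<in> source_fibre G (src G h)" "gmul G g (ginv G h) \<in> U"
    and g': "g' \<in> source_fibre G (src G h)" "gmul G g' (ginv G h) \<in> U"
  shows "g = g'"
proof -
  have comp: "(g, ginv G h) \<in> composable G" "(g', ginv G h) \<in> composable G" "(ginv G h, h) \<in> composable G"
    using h g(1) g'(1) by (auto simp: composable_def source_fibre_def inv_closed rng_inv src_inv)
  then have eq: "gmul G g (ginv G h) = gmul G g' (ginv G h)"
    using U g(2) g'(2) unfolding open_bisection_iff by (metis inj_onD src_mul)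
  have cancel: "gmul G (gmul G k (ginv G h)) h = k" if "k \<in> source_fibre G (src G h)" "(k, ginv G h) \<in> composable G" for k
  proof -
    have k: "k \<in> arrows G" "src G k = src G h"
      using that(1) by (auto simp: source_fibre_def)
    have "gmul G (gmul G k (ginv G h)) h = gmul G k (gmul G (ginv G h) h)"
      by (rule mul_assoc[OF that(2) comp(3)])
    also have "\<dots> = gmul G k (src G k)"
      by (simp only: inv_mul[OF h] k(2))
    also have "\<dots> = k"
      by (rule mul_src[OF k(1)])
    finally show ?thesis .
  qed
  show ?thesis
    by (rule trans[OF cancel[OF g(1) comp(1), unfolded eq, symmetric] cancel[OF g'(1) comp(2)]])
qed

lemma finite_translates:
  assumes d: "decomposes f m U \<phi>" and g: "g \<in> arrows G"
  shows "finite {h \<in> source_fibre G (src G g). f (gmul G g (ginv G h)) \<noteq> 0}"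
proof (rule finite_subset)
  show "{h \<in> source_fibre G (src G g). f (gmul G g (ginv G h)) \<noteq> 0} \<subseteq>
      (\<Union>i < m. {h \<in> source_fibre G (src G g). gmul G g (ginv G h) \<in> U i})"
  proof
    fix h assume h: "h \<in> {h \<in> source_fibre G (src G g). f (gmul G g (ginv G h)) \<noteq> 0}"
    then have "f (gmul G g (ginv G h)) \<noteq> 0"
      by simp
    then obtain i where "i < m" "gmul G g (ginv G h) \<in> U i"
      by (rule decomposes_support[OF d])
    with h show "h \<in> (\<Union>i < m. {h \<in> source_fibre G (src G g). gmul G g (ginv G h) \<in> U i})"
      by auto
  qed
  show "finite (\<Union>i < m. {h \<in> source_fibre G (src G g). gmul G g (ginv G h) \<in> U i})"
  proof (intro finite_UN_I finite_lessThan)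
    fix i assume "i \<in> {..<m}"
    then have U: "open_bisection G (U i)"
      using decomposesD(1)[OF d] by simp
    show "finite {h \<in> source_fibre G (src G g). gmul G g (ginv G h) \<in> U i}" (is "finite ?S")
    proof (cases "?S = {}")
      case False
      then obtain h where "h \<in> ?S"
        by blast
      then have "?S \<subseteq> {h}"
        using translate_unique[OF U g] by blast
      then show ?thesis
        by (rule finite_subset) simp
    next
      case True
      then show ?thesis
        by (simp only: finite.emptyI)
    qed
  qed
qed

lemma conv_summable:
  assumes d: "decomposes f m U \<phi>" and g: "g \<in> arrows G"
  shows "(\<lambda>h. f (gmul G g (ginv G h)) * \<xi> h) summable_on source_fibre G (src G g)"
  by (rule finite_nonzero_values_imp_summable_on, rule finite_subset[OF _ finite_translates[OF assms]]) auto

lemma single_decomposes: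
  "open_bisection G U \<Longrightarrow> e \<in> Cc_on (topo G) U \<Longrightarrow> decomposes e 1 (\<lambda>_. U) (\<lambda>_. e)"
  by (simp add: decomposes_def)

lemma conv_decompose:
  assumes d: "decomposes f m U \<phi>" and g: "g \<in> arrows G"
  shows "conv G f \<xi> g = (\<Sum>i < m. conv G (\<phi> i) \<xi> g)"
proof -
  have "(\<Sum>\<^sub>\<infinity>h \<in> source_fibre G (src G g). f (gmul G g (ginv G h)) * \<xi> h) =
      (\<Sum>\<^sub>\<infinity>h \<in> source_fibre G (src G g). \<Sum>i < m. \<phi> i (gmul G g (ginv G h)) * \<xi> h)"
    by (simp add: decomposesD(3)[OF d] sum_distrib_right)
  also have "\<dots> = (\<Sum>i < m. \<Sum>\<^sub>\<infinity>h \<in> source_fibre G (src G g). \<phi> i (gmul G g (ginv G h)) * \<xi> h)"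
    by (rule infsum_finite_sum)
       (use conv_summable[OF single_decomposes[OF decomposesD(1,2)[OF d]] g] in auto)
  finally show ?thesis
    using g by (simp add: conv_def)
qed

text \<open>Row \<open>g\<close> of the convolution matrix has its only possible entry in column
  \<open>\<sigma> g\<close>, and \<sigma> is injective because columns also have at most one entry.
  The entries are bounded by \<open>M\<close>, so no value of \<xi> is counted twice.\<close>

lemma conv_bisection_bound:
  assumes U: "open_bisection G U" and e: "\<And>g. e g \<noteq> 0 \<Longrightarrow> g \<in> U" "\<And>g. cmod (e g) \<le> M"
    and \<xi>: "\<xi> \<in> ell2 (source_fibre G x)" and T: "finite T" "T \<subseteq> source_fibre G x"
  shows "(\<Sum>g \<in> T. (cmod (conv G e \<xi> g))\<^sup>2) \<le> M\<^sup>2 * (\<Sum>\<^sub>\<infinity>h \<in> source_fibre G x. (cmod (\<xi> h))\<^sup>2)"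
proof -
  let ?P = "\<lambda>g h. h \<in> source_fibre G x \<and> gmul G g (ginv G h) \<in> U"
  define T' where "T' = {g \<in> T. \<exists>h. ?P g h}"
  define \<sigma> where "\<sigma> g = (SOME h. ?P g h)" for g
  have T_arr: "g \<in> arrows G" "src G g = x" if "g \<in> T" for g
    using T(2) that by (auto simp: source_fibre_def)
  have \<sigma>: "?P g (\<sigma> g)" if "g \<in> T'" for g
    using that someI_ex[of "?P g"] unfolding T'_def \<sigma>_def by blast
  have val: "conv G e \<xi> g = e (gmul G g (ginv G (\<sigma> g))) * \<xi> (\<sigma> g)" if "g \<in> T'" for g
  proof -
    have g: "g \<in> arrows G" "src G g = x"
      using that T_arr by (auto simp: T'_def)
    have "(\<Sum>\<^sub>\<infinity>h \<in> source_fibre G x. e (gmul G g (ginv G h)) * \<xi> h) = e (gmul G g (ginv G (\<sigma> g))) * \<xi> (\<sigma> g)"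
    proof (rule infsum_eq_single)
      show "\<sigma> g \<in> source_fibre G x"
        using \<sigma>[OF that] by blast
      fix h assume h: "h \<in> source_fibre G x" "h \<noteq> \<sigma> g"
      have "gmul G g (ginv G h) \<notin> U"
        using translate_unique[OF U g(1), of h "\<sigma> g"] \<sigma>[OF that] h g(2) by blast
      then show "e (gmul G g (ginv G h)) * \<xi> h = 0"
        using e(1) by auto
    qed
    then show ?thesis
      using g by (simp add: conv_def)
  qed
  have zero: "conv G e \<xi> g = 0" if "g \<in> T - T'" for g
  proof -
    have "e (gmul G g (ginv G h)) = 0" if "h \<in> source_fibre G x" for h
      using \<open>g \<in> T - T'\<close> that e(1) unfolding T'_def by blast
    then show ?thesis
      using T_arr that by (auto simp: conv_def intro: infsum_0)
  qed
  have inj: "inj_on \<sigma> T'"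
  proof (rule inj_onI)
    fix g g' assume gg: "g \<in> T'" "g' \<in> T'" "\<sigma> g = \<sigma> g'"
    have h: "\<sigma> g \<in> arrows G" "src G (\<sigma> g) = x"
      using \<sigma>[OF gg(1)] by (auto simp: source_fibre_def)
    show "g = g'"
      by (rule translate_unique'[OF U h(1)])
         (use h gg \<sigma>[OF gg(1)] \<sigma>[OF gg(2)] T(2) in \<open>auto simp: T'_def\<close>)
  qed
  have M: "M \<ge> 0"
    using e(2) norm_ge_zero order_trans by blast
  have "(\<Sum>g \<in> T. (cmod (conv G e \<xi> g))\<^sup>2) = (\<Sum>g \<in> T'. (cmod (conv G e \<xi> g))\<^sup>2)"
    using T(1) zero by (intro sum.mono_neutral_right) (auto simp: T'_def)
  also have "\<dots> \<le> (\<Sum>g \<in> T'. M\<^sup>2 * (cmod (\<xi> (\<sigma> g)))\<^sup>2)"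
    using val e(2) by (intro sum_mono) (auto simp: norm_mult power_mult_distrib intro!: mult_right_mono power_mono)
  also have "\<dots> = M\<^sup>2 * (\<Sum>h \<in> \<sigma> ` T'. (cmod (\<xi> h))\<^sup>2)"
    using inj by (simp add: sum_distrib_left sum.reindex)
  also have "\<dots> \<le> M\<^sup>2 * (\<Sum>\<^sub>\<infinity>h \<in> source_fibre G x. (cmod (\<xi> h))\<^sup>2)"
    using T(1) \<sigma> M by (intro mult_left_mono finite_sum_le_infsum ell2_summable[OF \<xi>]) (auto simp: T'_def)
  finally show ?thesis .
qed

lemma conv_bound:
  assumes d: "decomposes f m U \<phi>"
  obtains B where "B \<ge> 0" "\<And>x \<xi> T. \<xi> \<in> ell2 (source_fibre G x) \<Longrightarrow> finite T \<Longrightarrow> T \<subseteq> source_fibre G x \<Longrightarrow>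
    (\<Sum>g \<in> T. (cmod (conv G f \<xi> g))\<^sup>2) \<le> B * (\<Sum>\<^sub>\<infinity>h \<in> source_fibre G x. (cmod (\<xi> h))\<^sup>2)"
proof -
  have "\<exists>M. M \<ge> 0 \<and> (\<forall>g. cmod (\<phi> i g) \<le> M)" if "i < m" for i
    using Cc_on_bounded[OF decomposesD(2)[OF d that] bisection_subset_arrows[OF decomposesD(1)[OF d that]]] by metis
  then obtain M where M: "\<And>i. i < m \<Longrightarrow> M i \<ge> 0" "\<And>i g. i < m \<Longrightarrow> cmod (\<phi> i g) \<le> M i"
    by metis
  show thesis
  \<comment> \<open>The factor \<open>m\<close> comes from bounding the square of a sum of
    \<open>m\<close> terms by \<open>m\<close> times the sum of their squares.\<close>
  proof (rule that[of "m * (\<Sum>i < m. (M i)\<^sup>2)"])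
    show "0 \<le> real m * (\<Sum>i < m. (M i)\<^sup>2)"
      by (intro mult_nonneg_nonneg sum_nonneg) auto
    fix x \<xi> T assume \<xi>: "\<xi> \<in> ell2 (source_fibre G x)" and T: "finite T" "T \<subseteq> source_fibre G x"
    let ?S = "\<Sum>\<^sub>\<infinity>h \<in> source_fibre G x. (cmod (\<xi> h))\<^sup>2"
    have "(\<Sum>g \<in> T. (cmod (conv G f \<xi> g))\<^sup>2) \<le> (\<Sum>g \<in> T. m * (\<Sum>i < m. (cmod (conv G (\<phi> i) \<xi> g))\<^sup>2))"
    proof (rule sum_mono)
      fix g assume "g \<in> T"
      then have "g \<in> arrows G"
        using T(2) by (auto simp: source_fibre_def)
      from conv_decompose[OF d this, of \<xi>]
      have "(cmod (conv G f \<xi> g))\<^sup>2 \<le> (\<Sum>i < m. cmod (conv G (\<phi> i) \<xi> g))\<^sup>2"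
        by (auto intro!: power_mono norm_sum)
      also have "\<dots> \<le> (\<Sum>i < m. (cmod (conv G (\<phi> i) \<xi> g))\<^sup>2) * card {..<m}"
        by (rule sum_squared_le_sum_of_squares)
      finally show "(cmod (conv G f \<xi> g))\<^sup>2 \<le> m * (\<Sum>i < m. (cmod (conv G (\<phi> i) \<xi> g))\<^sup>2)"
        by (simp add: mult.commute)
    qed
    also have "\<dots> = m * (\<Sum>i < m. \<Sum>g \<in> T. (cmod (conv G (\<phi> i) \<xi> g))\<^sup>2)"
      unfolding sum_distrib_left[symmetric] by (subst sum.swap) rule
    also have "\<dots> \<le> m * (\<Sum>i < m. (M i)\<^sup>2 * ?S)"
    proof (intro mult_left_mono sum_mono)
      fix i assume "i \<in> {..<m}"
      then have i: "i < m"
        by simp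
      show "(\<Sum>g \<in> T. (cmod (conv G (\<phi> i) \<xi> g))\<^sup>2) \<le> (M i)\<^sup>2 * ?S"
        by (rule conv_bisection_bound[OF decomposesD(1)[OF d i] _ M(2)[OF i] \<xi> T])
           (use decomposesD(2)[OF d i] in \<open>auto simp: Cc_on_def\<close>)
    qed simp
    finally show "(\<Sum>g \<in> T. (cmod (conv G f \<xi> g))\<^sup>2) \<le> m * (\<Sum>i < m. (M i)\<^sup>2) * ?S"
      by (simp add: sum_distrib_right mult.assoc)
  qed
qed

text \<open>The substance is boundedness of the operators; the approximation condition is met by
  \<open>f\<close> itself with error zero.\<close>

lemma regular_rep_reduced:
  assumes f: "f \<in> Connes_algebra G"
  shows "regular_rep G f \<in> reduced_cstar G"
proof -
  obtain m U \<phi> where d: "decomposes f m U \<phi>"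
    using Connes_algebra_decompose[OF f] by metis
  obtain B where B: "B \<ge> 0" "\<And>x \<xi> T. \<xi> \<in> ell2 (source_fibre G x) \<Longrightarrow> finite T \<Longrightarrow> T \<subseteq> source_fibre G x \<Longrightarrow>
    (\<Sum>g \<in> T. (cmod (conv G f \<xi> g))\<^sup>2) \<le> B * (\<Sum>\<^sub>\<infinity>h \<in> source_fibre G x. (cmod (\<xi> h))\<^sup>2)"
    using conv_bound[OF d] by metis
  have conv_ell2: "conv G f \<xi> \<in> ell2 (source_fibre G x)"
    and conv_norm: "ell2_norm (source_fibre G x) (conv G f \<xi>) \<le> sqrt B * ell2_norm (source_fibre G x) \<xi>"
    if \<xi>: "\<xi> \<in> ell2 (source_fibre G x)" for x \<xi>
  proof -
    note b = nonneg_summable_finite_bound[of "source_fibre G x" "\<lambda>g. (cmod (conv G f \<xi> g))\<^sup>2", OF _ B(2)[OF \<xi>]]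
    have "conv G f \<xi> g = 0" if "g \<notin> source_fibre G x" for g
    proof (cases "g \<in> arrows G")
      case True
      then have "\<xi> h = 0" if "h \<in> source_fibre G (src G g)" for h
        using \<xi> \<open>g \<notin> source_fibre G x\<close> that by (auto simp: ell2_def source_fibre_def)
      then show ?thesis
        by (auto simp: conv_def intro: infsum_0)
    qed (simp add: conv_def)
    with b(1) show "conv G f \<xi> \<in> ell2 (source_fibre G x)"
      by (simp add: ell2_def)
    show "ell2_norm (source_fibre G x) (conv G f \<xi>) \<le> sqrt B * ell2_norm (source_fibre G x) \<xi>"
      using b(2) by (simp add: ell2_norm_def real_sqrt_mult[symmetric])
  qed
  have rep: "regular_rep G f x \<xi> = conv G f \<xi>" if "x \<in> units G" "\<xi> \<in> ell2 (source_fibre G x)" for x \<xi>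
    using that by (simp add: regular_rep_def)
  have "family_norm G (regular_rep G f) \<le> ennreal (sqrt B)"
    unfolding family_norm_def ell2_opnorm_def
  proof (intro SUP_least ennreal_leI)
    fix x \<xi> assume x: "x \<in> units G"
      and \<xi>: "\<xi> \<in> {\<xi> \<in> ell2 (source_fibre G x). ell2_norm (source_fibre G x) \<xi> \<le> 1}"
    have "ell2_norm (source_fibre G x) (conv G f \<xi>) \<le> sqrt B * 1"
      using \<xi> B(1) by (intro order_trans[OF conv_norm] mult_left_mono) auto
    then show "ell2_norm (source_fibre G x) (regular_rep G f x \<xi>) \<le> sqrt B"
      using rep x \<xi> by simp
  qed
  then have "family_norm G (regular_rep G f) < \<infinity>"
    by (rule le_less_trans) simp
  moreover have "conv G f (\<lambda>g. c * \<xi> g) = (\<lambda>g. c * conv G f \<xi> g)" for c \<xi>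
  proof
    show "conv G f (\<lambda>g. c * \<xi> g) g = c * conv G f \<xi> g" for g
      unfolding conv_def by (simp add: mult.left_commute infsum_cmult_right')
  qed
  moreover have "conv G f (\<xi> + \<eta>) = conv G f \<xi> + conv G f \<eta>" for \<xi> \<eta>
  proof
    show "conv G f (\<xi> + \<eta>) g = (conv G f \<xi> + conv G f \<eta>) g" for g
      using infsum_add[OF conv_summable[OF d, of g \<xi>] conv_summable[OF d, of g \<eta>]]
      by (simp add: conv_def distrib_left)
  qed
  ultimately have "regular_rep G f \<in> bounded_families G"
    unfolding bounded_families_def
    by (auto simp: regular_rep_def conv_ell2 ell2_cmult ell2_add)
  moreover have "family_norm G (regular_rep G f - regular_rep G f) = 0"
    by (auto simp: family_norm_def ell2_opnorm_def ell2_norm_def intro!: antisym SUP_least)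
  ultimately show ?thesis
    using f unfolding reduced_cstar_def by force
qed

text \<open>Makes singularity of an element of Connes' algebra a statement about its own set of
  nonzero values. Convolution with the point mass at the unit \<open>src G g\<close> reproduces
  \<open>f\<close> on that fibre.\<close>

lemma as_function_regular_rep:
  assumes g: "g \<in> arrows G"
  shows "as_function G (regular_rep G f) g = f g"
proof -
  have x: "src G g \<in> units G" "src G g \<in> source_fibre G (src G g)" "g \<in> source_fibre G (src G g)"
    using g src_in_units by (auto simp: source_fibre_def unit_arrow src_unit)
  have "as_function G (regular_rep G f) g =
      (\<Sum>\<^sub>\<infinity>h \<in> source_fibre G (src G g). conv G f (delta (src G g)) h * cnj (delta g h))"
    using x(1) delta_ell2[OF x(2)] by (simp add: as_function_def ell2_inner_def regular_rep_def)
  also have "\<dots> = conv G f (delta (src G g)) g * cnj (delta g g)"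
    by (rule infsum_eq_single[OF x(3)]) (simp add: delta_def)
  also have "\<dots> = (\<Sum>\<^sub>\<infinity>h \<in> source_fibre G (src G g). f (gmul G g (ginv G h)) * delta (src G g) h)"
    using g by (simp add: conv_def delta_def)
  also have "\<dots> = f (gmul G g (ginv G (src G g))) * delta (src G g) (src G g)"
    by (rule infsum_eq_single[OF x(2)]) (simp add: delta_def)
  also have "\<dots> = f g"
    using g x(1) by (simp add: inv_unit mul_src delta_def)
  finally show ?thesis .
qed

section \<open>Singular functions vanish over the Hausdorff units\<close>

lemma cover_bisection:
  assumes "covered_by_countably_many_bisections G" "g \<in> arrows G"
  obtains V where "open_bisection G V" "g \<in> V"
proof -
  obtain \<U> where \<U>: "countable \<U> \<and> (\<forall>U \<in> \<U>. open_bisection G U) \<and> \<Union>\<U> = arrows G"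
    using assms(1) unfolding covered_by_countably_many_bisections_def by (elim exE)
  then have "g \<in> \<Union>\<U>"
    using assms(2) by simp
  then show thesis
    using \<U> that by blast
qed

text \<open>A cluster point \<open>y\<close> of the neighbourhood filter is a limit along the finer
  filter obtained by adding the neighbourhoods of \<open>y\<close>, so it lies in the isotropy
  group. If it differed from \<open>x\<close>, a neighbourhood of \<open>y\<close> without units
  would contradict that all members of the filter eventually are units.\<close>

lemma Hausdorff_unit_limits:
  assumes x: "x \<in> Hausdorff_unit_set G"
  defines "F \<equiv> nhdsin (topo G) x"
  shows "F \<noteq> bot" "eventually (\<lambda>z. z \<in> units G) F" "limitin (topo G) (\<lambda>z. z) x F"
    "filter_limits (topo G) F = {x}" "filter_cluster_points (topo G) F \<subseteq> {x}"
proof -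
  have xu: "x \<in> units G" and xa: "x \<in> arrows G"
    using x Hausdorff_unit_set_subset unit_arrow by auto
  have ev: "eventually P F \<longleftrightarrow> (\<exists>S. openin (topo G) S \<and> x \<in> S \<and> (\<forall>z \<in> S. P z))" for P
    using xa by (simp add: F_def eventually_nhdsin)
  show F: "F \<noteq> bot"
    unfolding trivial_limit_def ev by blast
  show evu: "eventually (\<lambda>z. z \<in> units G) F"
    unfolding ev using openin_units xu by blast
  show lim: "limitin (topo G) (\<lambda>z. z) x F"
    unfolding limitin_def ev using xa by blast
  show cl: "filter_cluster_points (topo G) F \<subseteq> {x}"
  proof
    fix y assume y: "y \<in> filter_cluster_points (topo G) F"
    then have ya: "y \<in> arrows G" and freq: "\<And>U. openin (topo G) U \<Longrightarrow> y \<in> U \<Longrightarrow> frequently (\<lambda>z. z \<in> U) F"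
      by (auto simp: filter_cluster_points_def)
    define F' where "F' = inf F (nhdsin (topo G) y)"
    have "F' \<noteq> bot"
    proof
      assume "F' = bot"
      then obtain P Q where PQ: "eventually P F" "eventually Q (nhdsin (topo G) y)" "\<And>z. P z \<Longrightarrow> Q z \<Longrightarrow> False"
        unfolding F'_def trivial_limit_def eventually_inf by blast
      obtain S where S: "openin (topo G) S" "y \<in> S" "\<And>z. z \<in> S \<Longrightarrow> Q z"
        using PQ(2) ya by (auto simp: eventually_nhdsin)
      have "\<exists>z. P z \<and> z \<in> S"
        using frequently_eventually_conj[OF freq[OF S(1,2)] PQ(1)] frequently_ex by fast
      with S(3) PQ(3) show False
        by blast
    qed
    moreover have "eventually (\<lambda>z. z \<in> units G) F'" "limitin (topo G) (\<lambda>z. z) x F'"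
      using evu lim by (auto simp: F'_def limitin_def intro: filter_leD[OF inf_le1])
    moreover have "y \<in> filter_limits (topo G) F'"
      using ya by (auto simp: filter_limits_def limitin_def F'_def eventually_nhdsin intro!: filter_leD[OF inf_le2])
    ultimately have iso: "y \<in> isotropy G x"
      using filter_limit_isotropy xu by blast
    show "y \<in> {x}"
    proof (rule ccontr)
      assume "y \<notin> {x}"
      then obtain U where U: "openin (topo G) U" "y \<in> U" "U \<inter> units G = {}"
        using x iso unfolding Hausdorff_unit_set_def by blast
      have "\<exists>z. z \<in> units G \<and> z \<in> U"
        using frequently_eventually_conj[OF freq[OF U(1,2)] evu] frequently_ex by fast
      with U(3) show False
        by blast
    qed
  qed
  show "filter_limits (topo G) F = {x}"
    using lim cl limit_of_finer_is_cluster_point[OF order_refl F] by (auto simp: filter_limits_def)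
qed

lemma singular_Cc_iff:
  assumes cov: "covered_by_countably_many_bisections G"
  shows "f \<in> singular_Cc G \<longleftrightarrow>
    f \<in> Connes_algebra G \<and> (\<forall>g \<in> arrows G. src G g \<in> Hausdorff_unit_set G \<longrightarrow> f g = 0)"
proof -
  let ?S = "{g \<in> arrows G. f g \<noteq> 0}"
  have supp: "{g \<in> arrows G. as_function G (regular_rep G f) g \<noteq> 0} = ?S"
    using as_function_regular_rep by auto
  have "topo G interior_of ?S = {} \<longleftrightarrow> (\<forall>g \<in> arrows G. src G g \<in> Hausdorff_unit_set G \<longrightarrow> f g = 0)"
    if f: "f \<in> Connes_algebra G"
  proof
    assume empty: "topo G interior_of ?S = {}"
    show "\<forall>g \<in> arrows G. src G g \<in> Hausdorff_unit_set G \<longrightarrow> f g = 0"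
    proof (intro ballI impI, rule ccontr)
      fix g assume g: "g \<in> arrows G" "src G g \<in> Hausdorff_unit_set G" "f g \<noteq> 0"
      let ?x = "src G g"
      obtain m U \<phi> where d: "decomposes f m U \<phi>"
        using Connes_algebra_decompose[OF f] by metis
      obtain V where V: "open_bisection G V" "g \<in> V"
        using cover_bisection[OF cov g(1)] by metis
      note F = Hausdorff_unit_limits[OF g(2)]
      \<comment> \<open>With limit set \<open>{?x}\<close> the coset of \<open>g\<close> is the
        singleton of \<open>g\<close>, so the coset sum is the value \<open>f g\<close> and the
        limit expresses continuity at \<open>g\<close>.\<close>
      have "((\<lambda>z. f (sec V z)) \<longlongrightarrow> (\<Sum>h \<in> {h \<in> coset G g {?x}. f h \<noteq> 0}. f h)) (nhdsin (topo G) ?x)"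
        by (rule tendsto_coset_sum[OF d V refl F(2-5)]) (use g(1) unit_isotropy src_in_units in auto)
      moreover have "{h \<in> coset G g {?x}. f h \<noteq> 0} = {g}"
        using g by (auto simp: coset_def mul_src)
      ultimately have "((\<lambda>z. f (sec V z)) \<longlongrightarrow> f g) (nhdsin (topo G) ?x)"
        by simp
      then have "eventually (\<lambda>z. f (sec V z) \<noteq> 0) (nhdsin (topo G) ?x)"
        using g(3) by (rule tendsto_imp_eventually_ne)
      then obtain W where W: "openin (topo G) W" "?x \<in> W" "\<And>z. z \<in> W \<Longrightarrow> f (sec V z) \<noteq> 0"
        using unit_arrow[OF src_in_units[OF g(1)]] by (auto simp: eventually_nhdsin)
      define V' where "V' = {h \<in> V. src G h \<in> W}"
      have "openin (topo G) V'"
        unfolding V'_def using V(1) W(1) by (intro openin_src_vimage) (simp_all add: open_bisection_iff)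
      moreover have "V' \<subseteq> ?S"
      proof
        fix h assume h: "h \<in> V'"
        then have "sec V (src G h) = h" "h \<in> arrows G"
          using sec_eqI[OF V(1)] bisection_arrow[OF V(1)] by (auto simp: V'_def)
        with h W(3)[of "src G h"] show "h \<in> ?S"
          by (simp add: V'_def)
      qed
      ultimately have "V' \<subseteq> topo G interior_of ?S"
        by (intro interior_of_maximal)
      moreover have "g \<in> V'"
        using V(2) W(2) by (simp add: V'_def)
      ultimately show False
        using empty by blast
    qed
  next
    assume van: "\<forall>g \<in> arrows G. src G g \<in> Hausdorff_unit_set G \<longrightarrow> f g = 0"
    show "topo G interior_of ?S = {}"
    proof (rule ccontr)
      let ?O = "topo G interior_of ?S"
      assume ne: "?O \<noteq> {}"
      have sub: "?O \<subseteq> ?S"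
        by (rule interior_of_subset)
      then have "src G ` ?O \<subseteq> units G"
        using src_in_units by auto
      \<comment> \<open>The source is an open map, so the interior projects to an open set of units,
        which density makes meet \<open>C\<close>.\<close>
      then have "src G ` ?O \<inter> Hausdorff_unit_set G \<noteq> {}"
        using ne by (intro Hausdorff_units_dense[OF cov openin_src_image[OF openin_interior_of]]) auto
      with sub van show False
        by auto
    qed
  qed
  then show ?thesis
    using regular_rep_reduced[of f] by (auto simp: singular_Cc_def singular_ideal_def supp)
qed

lemma singular_coset_sum:
  assumes cov: "covered_by_countably_many_bisections G" and f: "f \<in> singular_Cc G"
    and k: "k \<in> source_fibre G x" and X: "X \<in> limit_subgroups G x"
  shows "(\<Sum>g \<in> {g \<in> coset G k X. f g \<noteq> 0}. f g) = 0"
proof -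
  have van: "f \<in> Connes_algebra G" "\<And>g. g \<in> arrows G \<Longrightarrow> src G g \<in> Hausdorff_unit_set G \<Longrightarrow> f g = 0"
    using f singular_Cc_iff[OF cov] by auto
  obtain m U \<phi> where d: "decomposes f m U \<phi>"
    using Connes_algebra_decompose[OF van(1)] by metis
  have ka: "k \<in> arrows G" "src G k = x"
    using k by (auto simp: source_fibre_def)
  obtain V where V: "open_bisection G V" "k \<in> V"
    using cover_bisection[OF cov ka(1)] by metis
  have sub: "subgroup X (isotropy_group G x)"
    using X by (simp add: limit_subgroups_iff_filter)
  obtain F where F: "F \<noteq> bot" "eventually (\<lambda>z. z \<in> Hausdorff_unit_set G) F"
      "filter_limits (topo G) F = X" "filter_cluster_points (topo G) F \<subseteq> X"
    using X unfolding limit_subgroups_iff_filter by blast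
  \<comment> \<open>The identity \<open>x\<close> belongs to the subgroup \<open>X\<close>, hence is
    one of the limits: the filter converges to \<open>x\<close>.\<close>
  have "x \<in> X" "X \<subseteq> isotropy G x"
    using subgroup.one_closed[OF sub] subgroup.subset[OF sub] by (auto simp: isotropy_group_def)
  then have lim: "limitin (topo G) (\<lambda>z. z) x F"
    using F(3) by (auto simp: filter_limits_def)
  have evu: "eventually (\<lambda>z. z \<in> units G) F"
    using F(2) Hausdorff_unit_set_subset by (auto elim: eventually_mono)
  have "((\<lambda>z. f (sec V z)) \<longlongrightarrow> (\<Sum>g \<in> {g \<in> coset G k X. f g \<noteq> 0}. f g)) F"
    by (rule tendsto_coset_sum[OF d V ka(2) evu lim F(3,4)]) fact
  moreover have "eventually (\<lambda>z. z \<in> src G ` V) F"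
    using eventually_src_image[OF V] lim ka(2) by simp
  with F(2) have "eventually (\<lambda>z. f (sec V z) = 0) F"
  proof eventually_elim
    case (elim z)
    then have "sec V z \<in> arrows G" "src G (sec V z) = z"
      using sec_in src_sec bisection_arrow[OF V(1)] by auto
    with elim van(2) show ?case
      by simp
  qed
  then have "((\<lambda>z. f (sec V z)) \<longlongrightarrow> 0) F"
    by (rule tendsto_eventually)
  ultimately show ?thesis
    using tendsto_unique[OF F(1)] by blast
qed

end

section \<open>Admissible neighbourhoods\<close>

context etale_groupoid
begin

text \<open>Lets one neighbourhood of \<open>x\<close> serve all the ranges occurring in a fibre.
  Restricting to arrows with source in \<open>W'\<close> only shrinks the sets that have to avoid
  \<open>C\<close>.\<close>

lemma admissible_mono:
  assumes "admissible G x n \<gamma> h V W" and W': "openin (topo G) W'" "x \<in> W'" "W' \<subseteq> W"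
  shows "admissible G x n \<gamma> h V W'"
proof -
  let ?U = "\<lambda>W i. {g \<in> V i. src G g \<in> W}"
  let ?D = "\<lambda>W I. (\<Inter>i \<in> I. ?U W i) - (\<Union>j \<in> {1..n} - I. ?U W j)"
  \<comment> \<open>Removing the smaller sets over \<open>W'\<close> takes away fewer arrows. The
    inclusion survives because a nonempty \<open>I\<close> already forces the source into
    \<open>W'\<close>, over which both removals agree.\<close>
  have sub: "?D W' I \<subseteq> ?D W I" if "I \<noteq> {}" for I
  proof
    fix g assume g: "g \<in> ?D W' I"
    then have "src G g \<in> W'"
      using that by auto
    with g W'(3) show "g \<in> ?D W I"
      by auto
  qed
  have mono: "src G ` ?D W' I \<inter> Hausdorff_unit_set G = {}"
    if "I \<noteq> {}" "src G ` ?D W I \<inter> Hausdorff_unit_set G = {}" for I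
    using Int_mono[OF image_mono[OF sub[OF that(1)]] order_refl, of "src G" "Hausdorff_unit_set G"]
    unfolding that(2) by (rule subset_empty[THEN iffD1])
  have adm: "\<forall>I \<subseteq> {1..n}. I \<noteq> {} \<and> \<not> (\<exists>k \<in> source_fibre G x. \<exists>X \<in> limit_subgroups G x.
      (\<lambda>i. gmul G h (\<gamma> i)) ` I = coset G k X \<inter> (\<lambda>i. gmul G h (\<gamma> i)) ` {1..n}) \<longrightarrow>
      src G ` ?D W I \<inter> Hausdorff_unit_set G = {}"
    using assms(1) unfolding admissible_def Let_def by (elim conjE)
  have W: "W \<subseteq> units G" "\<forall>i \<in> {1..n}. W \<subseteq> src G ` V i"
    using assms(1) by (simp_all add: admissible_def openin_unit_space)
  show ?thesis
    unfolding admissible_def Let_def openin_unit_space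
  proof (intro conjI allI impI ballI)
    fix I assume I: "I \<subseteq> {1..n}" and trace: "I \<noteq> {} \<and> \<not> (\<exists>k \<in> source_fibre G x. \<exists>X \<in> limit_subgroups G x.
      (\<lambda>i. gmul G h (\<gamma> i)) ` I = coset G k X \<inter> (\<lambda>i. gmul G h (\<gamma> i)) ` {1..n})"
    show "src G ` ?D W' I \<inter> Hausdorff_unit_set G = {}"
      by (rule mono[OF conjunct1[OF trace] adm[rule_format, OF I trace]])
  qed (use W' W in blast)+
qed

text \<open>If no neighbourhood worked, an ultrafilter of units in \<open>C\<close> realising the
  pattern \<open>I\<close> would converge to \<open>x\<close>. Its limits form a limit subgroup
  \<open>X\<close>, and the bisections containing the section through \<open>p i0\<close> are then
  exactly those whose points lie in the coset of \<open>p i0\<close>. Thus \<open>I\<close> would be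
  a coset trace after all.\<close>

lemma exists_separating_neighbourhood:
  assumes x: "x \<in> units G" and p: "\<And>i. i \<in> N \<Longrightarrow> open_bisection G (V i) \<and> p i \<in> V i \<and> src G (p i) = x"
    and I: "I \<subseteq> N" "I \<noteq> {}"
    and no: "\<not> (\<exists>k \<in> source_fibre G x. \<exists>X \<in> limit_subgroups G x. p ` I = coset G k X \<inter> p ` N)"
  shows "\<exists>W. openin (topo G) W \<and> x \<in> W \<and>
    W \<inter> src G ` ((\<Inter>i \<in> I. V i) - (\<Union>j \<in> N - I. V j)) \<inter> Hausdorff_unit_set G = {}"
proof (rule ccontr)
  assume neg: "\<not> ?thesis"
  define S where "S = src G ` ((\<Inter>i \<in> I. V i) - (\<Union>j \<in> N - I. V j)) \<inter> Hausdorff_unit_set G"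
  have "inf (nhdsin (topo G) x) (principal S) \<noteq> bot"
  proof
    assume "inf (nhdsin (topo G) x) (principal S) = bot"
    then have "eventually (\<lambda>z. z \<notin> S) (nhdsin (topo G) x)"
      by (simp add: trivial_limit_def eventually_inf_principal)
    then obtain W where W: "openin (topo G) W" "x \<in> W" "\<And>z. z \<in> W \<Longrightarrow> z \<notin> S"
      using unit_arrow[OF x] by (auto simp: eventually_nhdsin)
    then have "W \<inter> src G ` ((\<Inter>i \<in> I. V i) - (\<Union>j \<in> N - I. V j)) \<inter> Hausdorff_unit_set G = {}"
      by (auto simp: S_def)
    with W(1,2) neg show False
      by blast
  qed
  then obtain F where F: "F \<le> inf (nhdsin (topo G) x) (principal S)" "F \<noteq> bot"
      and ultra: "\<And>P. eventually P F \<or> eventually (\<lambda>z. \<not> P z) F"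
    using exists_ultrafilter by metis
  have evS: "eventually (\<lambda>z. z \<in> S) F"
    by (rule filter_leD[OF F(1)]) (simp add: eventually_inf_principal)
  then have evC: "eventually (\<lambda>z. z \<in> Hausdorff_unit_set G) F"
    by eventually_elim (simp add: S_def)
  then have evu: "eventually (\<lambda>z. z \<in> units G) F"
    by eventually_elim (use Hausdorff_unit_set_subset in blast)
  have lim: "limitin (topo G) (\<lambda>z. z) x F"
    unfolding limitin_def
  proof (intro conjI allI impI)
    fix U assume "openin (topo G) U \<and> x \<in> U"
    then have "eventually (\<lambda>z. z \<in> U) (nhdsin (topo G) x)"
      by (auto simp: eventually_nhdsin)
    then show "eventually (\<lambda>z. z \<in> U) F"
      using F(1) by (auto intro: filter_leD)
  qed (rule unit_arrow[OF x])
  define X where "X = filter_limits (topo G) F"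
  \<comment> \<open>An ultrafilter that meets every neighbourhood frequently lies in each of them
    eventually, so cluster points are limits.\<close>
  have cl: "filter_cluster_points (topo G) F \<subseteq> X"
  proof
    fix y assume y: "y \<in> filter_cluster_points (topo G) F"
    have "eventually (\<lambda>z. z \<in> U) F" if "openin (topo G) U" "y \<in> U" for U
    proof -
      have "\<not> eventually (\<lambda>z. z \<notin> U) F"
        using y that by (simp add: filter_cluster_points_def frequently_def)
      then show ?thesis
        using ultra[of "\<lambda>z. z \<in> U"] by simp
    qed
    with y show "y \<in> X"
      by (simp add: X_def filter_limits_def limitin_def filter_cluster_points_def)
  qed
  have sub: "subgroup X (isotropy_group G x)"
    unfolding X_def by (rule subgroup_filter_limits[OF F(2) evu x lim])
  then have X: "X \<in> limit_subgroups G x"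
    unfolding limit_subgroups_iff_filter using F(2) evC cl X_def by blast
  have iso: "X \<subseteq> isotropy G x"
    using subgroup.subset[OF sub] by (simp add: isotropy_group_def)
  obtain i0 where i0: "i0 \<in> I"
    using I(2) by blast
  then have i0N: "i0 \<in> N"
    using I(1) by blast
  define k where "k = p i0"
  have V0: "open_bisection G (V i0)" "k \<in> V i0" and srck: "src G k = x"
    using p[OF i0N] by (auto simp: k_def)
  have ka: "k \<in> arrows G"
    using bisection_arrow[OF V0] .
  have kx: "k \<in> source_fibre G x"
    using ka srck by (simp add: source_fibre_def)
  have limk: "limitin (topo G) (\<lambda>z. z) (src G k) F"
    using lim srck by simp
  \<comment> \<open>The arrow witnessing that \<open>z\<close> lies in \<open>S\<close> belongs to
    \<open>V i0\<close>, since \<open>i0\<close> is in \<open>I\<close>; it is therefore the value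
    of that section at \<open>z\<close>.\<close>
  have S_sec: "(\<forall>i \<in> I. sec (V i0) z \<in> V i) \<and> (\<forall>j \<in> N - I. sec (V i0) z \<notin> V j)" if z: "z \<in> S" for z
  proof -
    obtain v where v: "v \<in> (\<Inter>i \<in> I. V i) - (\<Union>j \<in> N - I. V j)" "z = src G v"
      using z unfolding S_def by (elim IntE imageE)
    then have "sec (V i0) z = v"
      using sec_eqI[OF V0(1), of v z] i0 by blast
    with v(1) show ?thesis
      by blast
  qed
  have in_coset: "p i \<in> coset G k X" if "i \<in> I" for i
  proof -
    have Vi: "open_bisection G (V i)" "p i \<in> V i" "src G (p i) = src G k"
      using p[of i] I(1) that srck by auto
    have "eventually (\<lambda>z. sec (V i0) z \<in> V i) F"
      using evS by eventually_elim (use S_sec that in blast)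
    then have freq: "frequently (\<lambda>z. sec (V i0) z \<in> V i) F"
      by (rule eventually_frequently[OF F(2)])
    have "rng G (p i) = rng G k"
      by (rule frequently_sec_in_rng[OF V0 Vi evu limk freq])
    then have "gmul G k (gmul G (ginv G k) (p i)) = p i"
      using mul_inv_cancel[OF ka bisection_arrow[OF Vi(1,2)]] by simp
    moreover have "gmul G (ginv G k) (p i) \<in> X"
      using frequently_sec_in[OF V0 Vi evu limk freq] cl by blast
    ultimately show ?thesis
      unfolding coset_def by (metis image_eqI)
  qed
  have notin_coset: "p j \<notin> coset G k X" if "j \<in> N - I" for j
  proof
    assume "p j \<in> coset G k X"
    then obtain g where g: "g \<in> X" "p j = gmul G k g"
      by (auto simp: coset_def)
    have Vj: "openin (topo G) (V j)" "gmul G k g \<in> V j"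
      using p[of j] that g(2) by (auto simp: open_bisection_iff)
    have "(k, g) \<in> composable G"
      using ka g(1) iso srck by (auto simp: composable_def isotropy_def)
    then have "eventually (\<lambda>z. sec (V i0) z \<in> V j) F"
      using eventually_sec_in[OF V0 Vj(1) evu limk _ _ Vj(2)] g(1) by (simp add: X_def)
    moreover have "eventually (\<lambda>z. sec (V i0) z \<notin> V j) F"
      using evS by eventually_elim (use S_sec that in blast)
    ultimately have "eventually (\<lambda>z. False) F"
      by eventually_elim simp
    with F(2) show False
      by simp
  qed
  have "p ` I = coset G k X \<inter> p ` N"
    using in_coset notin_coset I(1) by blast
  with no kx X show False
    by blast
qed

text \<open>There are only finitely many index sets \<open>I\<close> to exclude, so their separating
  neighbourhoods can be intersected.\<close>

lemma admissible_exists: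
  assumes null: "coset_null G x b n \<gamma>" and bis: "bisections_at G x n \<gamma> h V"
  shows "\<exists>W. admissible G x n \<gamma> h V W"
proof -
  let ?N = "{1..n}"
  define p where "p i = gmul G h (\<gamma> i)" for i
  have x: "x \<in> units G"
    using null by (simp add: coset_null_def)
  have h: "h \<in> arrows G" "src G h = x"
    using bis by (auto simp: bisections_at_def source_fibre_def)
  have p: "open_bisection G (V i) \<and> p i \<in> V i \<and> src G (p i) = x" if "i \<in> ?N" for i
  proof -
    have "\<gamma> i \<in> isotropy G x"
      using null that by (auto simp: coset_null_def)
    then have "src G (p i) = x"
      using h by (auto simp: p_def src_mul composable_def isotropy_def)
    then show ?thesis
      using bis that by (simp add: bisections_at_def p_def)
  qed
  let ?bad = "\<lambda>I. I \<subseteq> ?N \<and> I \<noteq> {} \<and>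
    \<not> (\<exists>k \<in> source_fibre G x. \<exists>X \<in> limit_subgroups G x. p ` I = coset G k X \<inter> p ` ?N)"
  have "\<exists>W. openin (topo G) W \<and> x \<in> W \<and>
      W \<inter> src G ` ((\<Inter>i \<in> I. V i) - (\<Union>j \<in> ?N - I. V j)) \<inter> Hausdorff_unit_set G = {}"
    if "?bad I" for I
    using exists_separating_neighbourhood[of x ?N V p I, OF x p] that by blast
  then obtain Z where Z: "\<And>I. ?bad I \<Longrightarrow> openin (topo G) (Z I) \<and> x \<in> Z I \<and>
      Z I \<inter> src G ` ((\<Inter>i \<in> I. V i) - (\<Union>j \<in> ?N - I. V j)) \<inter> Hausdorff_unit_set G = {}"
    by metis
  \<comment> \<open>The factors \<open>arrows G\<close> keep the intersections open when an index
    family is empty, as for \<open>n = 0\<close>.\<close>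
  define W where "W = ((\<Inter>i \<in> ?N. src G ` V i) \<inter> arrows G) \<inter> ((\<Inter>I \<in> Collect ?bad. Z I) \<inter> arrows G) \<inter> units G"
  have fin: "finite (Collect ?bad)"
    by (rule finite_subset[of _ "Pow ?N"]) auto
  have "openin (topo G) ((\<Inter>i \<in> ?N. src G ` V i) \<inter> arrows G)"
    using p by (intro openin_INT openin_src_image) (auto simp: open_bisection_iff)
  moreover have "openin (topo G) ((\<Inter>I \<in> Collect ?bad. Z I) \<inter> arrows G)"
    using Z by (intro openin_INT fin) blast
  ultimately have opW: "openin (topo G) W"
    unfolding W_def by (intro openin_Int[OF openin_Int] openin_units)
  have xV: "x \<in> src G ` V i" if "i \<in> ?N" for i
    using p[OF that] by force
  have xW: "x \<in> W"
    unfolding W_def using x unit_arrow[OF x] xV Z by blast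
  have sep: "src G ` ((\<Inter>i \<in> I. {g \<in> V i. src G g \<in> W}) - (\<Union>j \<in> ?N - I. {g \<in> V j. src G g \<in> W}))
      \<inter> Hausdorff_unit_set G = {}" if I: "?bad I" for I
  proof (rule ccontr)
    assume "\<not> ?thesis"
    then obtain v where v: "v \<in> (\<Inter>i \<in> I. {g \<in> V i. src G g \<in> W}) - (\<Union>j \<in> ?N - I. {g \<in> V j. src G g \<in> W})"
        "src G v \<in> Hausdorff_unit_set G"
      by blast
    have vW: "src G v \<in> W"
      using v(1) I by blast
    then have "v \<in> (\<Inter>i \<in> I. V i) - (\<Union>j \<in> ?N - I. V j)"
      using v(1) by blast
    moreover have "src G v \<in> Z I"
      using vW I by (simp add: W_def)
    ultimately show False
      using Z[OF I] v(2) by blast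
  qed
  have "admissible G x n \<gamma> h V W"
    unfolding admissible_def Let_def openin_unit_space p_def[symmetric]
  proof (intro conjI allI impI ballI)
    fix I assume "I \<subseteq> ?N" "I \<noteq> {} \<and> \<not> (\<exists>k \<in> source_fibre G x. \<exists>X \<in> limit_subgroups G x.
      p ` I = coset G k X \<inter> p ` ?N)"
    then show "src G ` ((\<Inter>i \<in> I. {g \<in> V i. src G g \<in> W}) - (\<Union>j \<in> ?N - I. {g \<in> V j. src G g \<in> W}))
      \<inter> Hausdorff_unit_set G = {}"
      by (intro sep conjI) simp_all
  next
    show "W \<subseteq> src G ` V i" if "i \<in> ?N" for i
      using that unfolding W_def by blast
  qed (use opW xW in \<open>simp_all add: W_def\<close>)
  then show ?thesis
    by blast
qed

lemma f_psi_lift: "f_psi G b n \<gamma> V \<psi> g = (\<Sum>i = 1..n. b (\<gamma> i) * lift (V i) \<psi> g)"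
  by (simp add: f_psi_def lift_def)

text \<open>At an arrow \<open>g\<close> over \<open>C\<close> the value is the factor
  \<open>\<psi> (src G g)\<close> times the sum of \<open>b\<close> over the indices of bisections
  containing \<open>g\<close>. Admissibility makes these indices the trace of a coset in the fibre,
  and left translation by the inverse of \<open>h\<close> carries that coset into the isotropy
  group, where its \<open>b\<close>-sum vanishes.\<close>

lemma f_psi_singular:
  assumes cov: "covered_by_countably_many_bisections G"
    and null: "coset_null G x b n \<gamma>" and bis: "bisections_at G x n \<gamma> h V"
    and adm: "admissible G x n \<gamma> h V W" and \<psi>: "\<psi> \<in> Cc_on (topo G) W"
  shows "f_psi G b n \<gamma> V \<psi> \<in> singular_Cc G"
  unfolding singular_Cc_iff[OF cov]
proof (intro conjI ballI impI)
  have W: "openin (topo G) W" "\<And>i. i \<in> {1..n} \<Longrightarrow> W \<subseteq> src G ` V i"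
    using adm by (auto simp: admissible_def openin_unit_space)
  have V: "open_bisection G (V i)" if "i \<in> {1..n}" for i
    using bis that by (simp add: bisections_at_def)
  have "(\<lambda>g. \<Sum>i = 1..n. b (\<gamma> i) * lift (V i) \<psi> g) \<in> Connes_algebra G"
    by (intro Connes_sum Connes_cmult) (rule Cc_on_Connes[OF V lift_Cc[OF V W(1) W(2) \<psi>]])
  then show "f_psi G b n \<gamma> V \<psi> \<in> Connes_algebra G"
    by (simp add: f_psi_lift[abs_def])
  fix g assume g: "g \<in> arrows G" "src G g \<in> Hausdorff_unit_set G"
  define I where "I = {i \<in> {1..n}. g \<in> V i}"
  define p where "p i = gmul G h (\<gamma> i)" for i
  have "f_psi G b n \<gamma> V \<psi> g = (\<Sum>i = 1..n. if g \<in> V i then b (\<gamma> i) * \<psi> (src G g) else 0)"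
    unfolding f_psi_def by (intro sum.cong) auto
  also have "\<dots> = (\<Sum>i \<in> I. b (\<gamma> i) * \<psi> (src G g))"
    unfolding I_def by (rule sum.inter_filter[symmetric]) simp
  finally have eq: "f_psi G b n \<gamma> V \<psi> g = (\<Sum>i \<in> I. b (\<gamma> i)) * \<psi> (src G g)"
    by (simp add: sum_distrib_right)
  show "f_psi G b n \<gamma> V \<psi> g = 0"
  proof (cases "I = {} \<or> src G g \<notin> W")
    case True
    then show ?thesis
      using eq \<psi> by (auto simp: Cc_on_def)
  next
    case False
    then have ne: "I \<noteq> {}" and gW: "src G g \<in> W"
      by auto
    have "g \<in> (\<Inter>i \<in> I. {g \<in> V i. src G g \<in> W}) - (\<Union>j \<in> {1..n} - I. {g \<in> V j. src G g \<in> W})"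
      using gW by (auto simp: I_def)
    then have "src G ` ((\<Inter>i \<in> I. {g \<in> V i. src G g \<in> W}) - (\<Union>j \<in> {1..n} - I. {g \<in> V j. src G g \<in> W}))
        \<inter> Hausdorff_unit_set G \<noteq> {}"
      using g(2) by blast
    moreover have "I \<subseteq> {1..n}"
      by (auto simp: I_def)
    ultimately obtain k X where k: "k \<in> source_fibre G x" and X: "X \<in> limit_subgroups G x"
        and tr: "p ` I = coset G k X \<inter> p ` {1..n}"
      using adm ne unfolding admissible_def Let_def p_def by blast
    have h: "h \<in> arrows G" "src G h = x" and ka: "k \<in> arrows G" "src G k = x"
      using bis k by (auto simp: bisections_at_def source_fibre_def)
    have supp: "{g \<in> isotropy G x. b g \<noteq> 0} = \<gamma> ` {1..n}" and inj: "inj_on \<gamma> {1..n}"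
      using null by (auto simp: coset_null_def)
    have \<gamma>: "\<gamma> i \<in> isotropy G x" "b (\<gamma> i) \<noteq> 0" if "i \<in> {1..n}" for i
      using supp that by blast+
    have X_iso: "X \<subseteq> isotropy G x"
      using X subgroup.subset by (fastforce simp: limit_subgroups_iff_filter isotropy_group_def)
    have comp_h: "(h, g) \<in> composable G" if "g \<in> isotropy G x" for g
      using that h by (auto simp: composable_def isotropy_def)
    have comp_k: "(k, g) \<in> composable G" if "g \<in> X" for g
      using that ka X_iso by (auto simp: composable_def isotropy_def)
    \<comment> \<open>The trace is nonempty, so the coset of \<open>k\<close> contains some
      \<open>p i\<close>; comparing ranges makes the product of the inverse of \<open>h\<close> with
      \<open>k\<close> available.\<close>
    have rngk: "rng G k = rng G h"
    proof -
      obtain i where i: "i \<in> I"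
        using ne by blast
      then obtain y where y: "y \<in> X" "p i = gmul G k y"
        using tr unfolding coset_def by blast
      have "rng G (p i) = rng G k"
        using y comp_k rng_mul by simp
      moreover have "rng G (p i) = rng G h"
        using i \<gamma> comp_h rng_mul by (simp add: p_def I_def)
      ultimately show ?thesis
        by simp
    qed
    define k' where "k' = gmul G (ginv G h) k"
    have comp_hk: "(ginv G h, k) \<in> composable G"
      using h ka rngk by (simp add: composable_def inv_closed src_inv)
    then have k': "k' \<in> isotropy G x"
      using h ka by (simp add: k'_def isotropy_def mul_closed src_mul rng_mul rng_inv)
    have hk': "gmul G h (gmul G k' y) = gmul G k y" and k'y: "gmul G k' y = gmul G (ginv G h) (gmul G k y)"
      if "y \<in> X" for y
    proof -
      show *: "gmul G k' y = gmul G (ginv G h) (gmul G k y)"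
        unfolding k'_def by (rule mul_assoc[OF comp_hk comp_k[OF that]])
      show "gmul G h (gmul G k' y) = gmul G k y"
        unfolding * by (rule mul_inv_cancel[OF h(1) mul_closed[OF comp_k[OF that]]])
           (simp add: rng_mul[OF comp_k[OF that]] rngk)
    qed
    have inj_p: "i = j" if "i \<in> {1..n}" "j \<in> {1..n}" "p i = p j" for i j
    proof -
      have "\<gamma> i = \<gamma> j"
        using inv_mul_cancel[OF comp_h[OF \<gamma>(1)[OF that(1)]]] inv_mul_cancel[OF comp_h[OF \<gamma>(1)[OF that(2)]]]
          that(3) unfolding p_def by metis
      then show ?thesis
        using inj that(1,2) by (metis inj_onD)
    qed
    have "{g \<in> coset G k' X. b g \<noteq> 0} = \<gamma> ` I"
    proof (intro equalityI subsetI)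
      fix g' assume g': "g' \<in> {g \<in> coset G k' X. b g \<noteq> 0}"
      then obtain y where y: "y \<in> X" "g' = gmul G k' y"
        by (auto simp: coset_def)
      then have "g' \<in> isotropy G x"
        using k' X_iso mul_isotropy by blast
      then obtain i where i: "i \<in> {1..n}" "g' = \<gamma> i"
        using g' supp by blast
      then have "p i = gmul G k y"
        using hk'[OF y(1)] y(2) by (simp add: p_def)
      then have "p i \<in> coset G k X \<inter> p ` {1..n}"
        using y(1) i(1) unfolding coset_def by blast
      then obtain j where "j \<in> I" "p i = p j"
        unfolding tr[symmetric] by blast
      then show "g' \<in> \<gamma> ` I"
        using inj_p[OF i(1)] i(2) by (auto simp: I_def)
    next
      fix g' assume "g' \<in> \<gamma> ` I"
      then obtain i where i: "i \<in> I" "i \<in> {1..n}" "g' = \<gamma> i"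
        by (auto simp: I_def)
      then obtain y where y: "y \<in> X" "p i = gmul G k y"
        using tr unfolding coset_def by blast
      have "g' = gmul G (ginv G h) (p i)"
        using inv_mul_cancel[OF comp_h[OF \<gamma>(1)[OF i(2)]]] i(3) by (simp add: p_def)
      then have "g' = gmul G k' y"
        using k'y[OF y(1)] y(2) by simp
      then show "g' \<in> {g \<in> coset G k' X. b g \<noteq> 0}"
        using y(1) \<gamma>(2)[OF i(2)] i(3) by (auto simp: coset_def)
    qed
    moreover have "(\<Sum>g \<in> {g \<in> coset G k' X. b g \<noteq> 0}. b g) = 0"
      using null k' X by (simp add: coset_null_def)
    moreover have "inj_on \<gamma> I"
      using inj by (rule inj_on_subset) (auto simp: I_def)
    ultimately have "(\<Sum>i \<in> I. b (\<gamma> i)) = 0"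
      by (simp add: sum.reindex)
    then show ?thesis
      using eq by simp
  qed
qed

end

section \<open>C*-norms are dominated by the supremum norm on bisections\<close>

lemma cstar_normD:
  assumes "cstar_norm G N" "f \<in> Connes_algebra G"
  shows "0 \<le> N f" "N (\<lambda>g. c * f g) = cmod c * N f" "N (conv G (invol G f) f) = (N f)\<^sup>2"
    "f' \<in> Connes_algebra G \<Longrightarrow> N (f + f') \<le> N f + N f'"
  using assms by (simp_all add: cstar_norm_def)

context etale_groupoid
begin

text \<open>A nonzero term multiplies the inverse of one arrow of \<open>U\<close> by another arrow
  of \<open>U\<close> with the same range. On a bisection these arrows agree, so the product is a
  unit and only squared moduli remain.\<close>

lemma conv_invol_bisection:
  assumes U: "open_bisection G U" and e: "\<And>g. e g \<noteq> 0 \<Longrightarrow> g \<in> U"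
  shows "conv G (invol G e) e g = (if g \<in> src G ` U then complex_of_real ((cmod (e (sec U g)))\<^sup>2) else 0)"
proof (cases "g \<in> arrows G")
  case g: True
  have nonzero: "h \<in> U \<and> src G h = g"
    if h: "h \<in> source_fibre G (src G g)" and ne: "invol G e (gmul G g (ginv G h)) * e h \<noteq> 0" for h
  proof -
    have ha: "h \<in> arrows G" "src G h = src G g"
      using h by (auto simp: source_fibre_def)
    define a where "a = gmul G g (ginv G h)"
    have comp: "(g, ginv G h) \<in> composable G"
      using g ha by (simp add: composable_def inv_closed rng_inv)
    have a: "a \<in> arrows G" "src G a = rng G h"
      using comp ha by (simp_all add: a_def mul_closed src_mul src_inv)
    have "e (ginv G a) \<noteq> 0" "e h \<noteq> 0"
      using ne a by (auto simp: invol_def a_def[symmetric])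
    then have "ginv G a \<in> U" "h \<in> U"
      using e by auto
    moreover have "rng G (ginv G a) = rng G h"
      using a rng_inv by simp
    ultimately have "ginv G a = h"
      using U unfolding open_bisection_iff by (metis inj_onD)
    then have "gmul G g (ginv G h) = ginv G h"
      using inv_inv[OF a(1)] by (simp add: a_def)
    moreover have "gmul G (gmul G g (ginv G h)) h = gmul G g (gmul G (ginv G h) h)"
      by (rule mul_assoc[OF comp]) (simp add: composable_def inv_closed src_inv ha)
    ultimately have "src G h = gmul G g (src G g)"
      using ha by (simp add: inv_mul)
    then have "src G h = g"
      using mul_src[OF g] by simp
    with \<open>h \<in> U\<close> show ?thesis
      by blast
  qed
  show ?thesis
  proof (cases "g \<in> src G ` U")
    case True
    define h where "h = sec U g"
    have h: "h \<in> U" "src G h = g"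
      using True by (simp_all add: h_def sec_in src_sec)
    have ha: "h \<in> arrows G"
      using bisection_arrow[OF U h(1)] .
    have gu: "g \<in> units G"
      using src_in_units[OF ha] h(2) by simp
    have "conv G (invol G e) e g = invol G e (gmul G g (ginv G h)) * e h"
      unfolding conv_def if_P[OF g]
    proof (rule infsum_eq_single)
      show "h \<in> source_fibre G (src G g)"
        using ha h(2) gu by (simp add: source_fibre_def src_unit)
      show "invol G e (gmul G g (ginv G h')) * e h' = 0" if "h' \<in> source_fibre G (src G g)" "h' \<noteq> h" for h'
      proof (rule ccontr)
        assume "invol G e (gmul G g (ginv G h')) * e h' \<noteq> 0"
        then have "h' \<in> U" "src G h' = g"
          using nonzero[OF that(1)] by auto
        then show False
          using sec_eqI[OF U] that(2) by (simp add: h_def)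
      qed
    qed
    also have "gmul G g (ginv G h) = ginv G h"
      using rng_mul_left[OF inv_closed[OF ha]] rng_inv[OF ha] h(2) by simp
    also have "invol G e (ginv G h) = cnj (e h)"
      using ha by (simp add: invol_def inv_closed inv_inv)
    also have "cnj (e h) * e h = complex_of_real ((cmod (e h))\<^sup>2)"
      using complex_norm_square[of "e h"] by (simp add: mult.commute)
    finally show ?thesis
      using True by (simp add: h_def)
  next
    case False
    then have "invol G e (gmul G g (ginv G h)) * e h = 0" if "h \<in> source_fibre G (src G g)" for h
      using nonzero[OF that] by blast
    with False g show ?thesis
      by (simp add: conv_def infsum_0)
  qed
next
  case False
  then have "g \<notin> src G ` U"
    using src_bisection_subset[OF U] unit_arrow by blast
  with False show ?thesis
    by (simp add: conv_def)
qed

lemma mult_src_Cc: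
  assumes U: "open_bisection G U" and e: "e \<in> Cc_on (topo G) U"
    and c: "continuous_map (subtopology (topo G) (units G)) euclidean c"
  shows "(\<lambda>g. c (src G g) * e g) \<in> Cc_on (topo G) U"
  by (rule Cc_on_mult_left[OF Hausdorff_bisection[OF U] bisection_subset_arrows[OF U] e
      continuous_lift_factor[OF c]])

text \<open>Multiplying by a unimodular function of the source changes no modulus, hence not the
  convolution of \<open>invol G e\<close> with \<open>e\<close>; the C*-identity recovers the norm
  from it.\<close>

lemma cstar_norm_unitary:
  assumes N: "cstar_norm G N" and U: "open_bisection G U" and e: "e \<in> Cc_on (topo G) U"
    and u: "continuous_map (subtopology (topo G) (units G)) euclidean u" "\<And>z. cmod (u z) = 1"
  shows "N (\<lambda>g. u (src G g) * e g) = N e"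
proof -
  let ?e = "\<lambda>g. u (src G g) * e g"
  have e': "?e \<in> Cc_on (topo G) U"
    by (rule mult_src_Cc[OF U e u(1)])
  have zero: "e g \<noteq> 0 \<Longrightarrow> g \<in> U" for g
    using e by (auto simp: Cc_on_def)
  have "conv G (invol G ?e) ?e = conv G (invol G e) e"
  proof
    fix g
    have "conv G (invol G ?e) ?e g =
        (if g \<in> src G ` U then complex_of_real ((cmod (?e (sec U g)))\<^sup>2) else 0)"
      by (rule conv_invol_bisection[OF U]) (use zero in auto)
    moreover have "conv G (invol G e) e g =
        (if g \<in> src G ` U then complex_of_real ((cmod (e (sec U g)))\<^sup>2) else 0)"
      by (rule conv_invol_bisection[OF U]) (rule zero)
    ultimately show "conv G (invol G ?e) ?e g = conv G (invol G e) e g"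
      by (simp add: norm_mult u(2))
  qed
  moreover have "?e \<in> Connes_algebra G" "e \<in> Connes_algebra G"
    using Cc_on_Connes[OF U] e e' by auto
  ultimately have "(N ?e)\<^sup>2 = (N e)\<^sup>2" "N ?e \<ge> 0" "N e \<ge> 0"
    using cstar_normD(1,3)[OF N] by metis+
  then show ?thesis
    by (simp add: power2_eq_iff_nonneg)
qed

text \<open>A real function \<open>a\<close> with \<open>\<bar>a\<bar> \<le> 1\<close> is the mean of the unitaries \<open>a \<plusminus> i \<surd>(1 - a\<^sup>2)\<close>.\<close>

lemma cstar_norm_contraction:
  fixes a :: "'a \<Rightarrow> real"
  assumes N: "cstar_norm G N" and U: "open_bisection G U" and e: "e \<in> Cc_on (topo G) U"
    and a: "continuous_map (subtopology (topo G) (units G)) euclidean a" "\<And>z. \<bar>a z\<bar> \<le> 1"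
  shows "N (\<lambda>g. complex_of_real (a (src G g)) * e g) \<le> N e"
proof -
  define u where "u s z = Complex (a z) (s * sqrt (1 - (a z)\<^sup>2))" for s z
  have le: "(a z)\<^sup>2 \<le> 1" for z
    using a(2)[of z] by (simp add: abs_square_le_1)
  have cont: "continuous_map (subtopology (topo G) (units G)) euclidean (u s)" for s
    using a(1) unfolding u_def continuous_map_tendsto_iff
    by (auto intro!: tendsto_Complex tendsto_intros)
  have norm: "cmod (u s z) = 1" if "s\<^sup>2 = 1" for s z
    using that le[of z] by (simp add: u_def cmod_def power_mult_distrib)
  let ?e = "\<lambda>s g. u s (src G g) * e g"
  have e': "?e s \<in> Connes_algebra G" for s
    by (rule Cc_on_Connes[OF U mult_src_Cc[OF U e cont]])
  have half: "(\<lambda>g. 1/2 * ?e s g) \<in> Connes_algebra G" for s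
    by (rule Connes_cmult[OF e'])
  have eq: "(\<lambda>g. complex_of_real (a (src G g)) * e g) = (\<lambda>g. 1/2 * ?e 1 g) + (\<lambda>g. 1/2 * ?e (-1) g)"
  proof
    fix g
    have "complex_of_real (a (src G g)) = 1/2 * u 1 (src G g) + 1/2 * u (-1) (src G g)"
      by (simp add: u_def complex_eq_iff)
    then show "complex_of_real (a (src G g)) * e g = ((\<lambda>g. 1/2 * ?e 1 g) + (\<lambda>g. 1/2 * ?e (-1) g)) g"
      by (simp add: distrib_right)
  qed
  have Nhalf: "N (\<lambda>g. 1/2 * ?e s g) = 1/2 * N e" if "s\<^sup>2 = 1" for s
  proof -
    have "N (\<lambda>g. 1/2 * ?e s g) = cmod (1/2) * N (?e s)"
      by (rule cstar_normD(2)[OF N e'])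
    then show ?thesis
      using cstar_norm_unitary[OF N U e cont norm[OF that]] by simp
  qed
  have "N ((\<lambda>g. 1/2 * ?e 1 g) + (\<lambda>g. 1/2 * ?e (-1) g)) \<le> N (\<lambda>g. 1/2 * ?e 1 g) + N (\<lambda>g. 1/2 * ?e (-1) g)"
    by (rule cstar_normD(4)[OF N half half])
  also have "\<dots> = N e"
    using Nhalf[of 1] Nhalf[of "-1"] by simp
  finally show ?thesis
    unfolding eq .
qed

text \<open>The element \<open>p\<close> lives on the units, where convolution is pointwise: its
  square is \<open>p\<close> times its modulus, that is \<delta>^2 times \<open>a\<close> times
  \<open>p\<close> with \<open>a\<close> at most one. Contractivity gives N(p)^2 \<le> \<delta>^2
  N(p), and the C*-identity passes from \<open>p\<close> back to \<open>e\<close>.\<close>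

lemma cstar_norm_le_sup:
  assumes N: "cstar_norm G N" and U: "open_bisection G U" and e: "e \<in> Cc_on (topo G) U"
    and \<delta>: "\<delta> > 0" "\<And>g. cmod (e g) \<le> \<delta>"
  shows "N e \<le> \<delta>"
proof -
  let ?Y = "src G ` U"
  define p where "p = conv G (invol G e) e"
  have Y: "open_bisection G ?Y"
    using open_bisection_subset[OF open_bisection_units openin_src_image src_bisection_subset[OF U]] U
    by (simp add: open_bisection_iff)
  have p_val: "p g = (if g \<in> ?Y then complex_of_real ((cmod (e (sec U g)))\<^sup>2) else 0)" for g
    unfolding p_def by (rule conv_invol_bisection[OF U]) (use e in \<open>auto simp: Cc_on_def\<close>)
  have "(\<lambda>g. cnj (e g) * e g) \<in> Cc_on (topo G) U"
    by (rule Cc_on_mult_left[OF Hausdorff_bisection[OF U] bisection_subset_arrows[OF U] e])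
       (use Cc_on_continuous[OF e] in \<open>auto simp: continuous_map_tendsto_iff intro: tendsto_cnj\<close>)
  then have "descend U (\<lambda>g. cnj (e g) * e g) \<in> Cc_on (topo G) ?Y"
    by (rule descend_Cc[OF U])
  moreover have "descend U (\<lambda>g. cnj (e g) * e g) = p"
    using complex_norm_square by (auto simp: descend_def p_val fun_eq_iff mult.commute)
  ultimately have p: "p \<in> Cc_on (topo G) ?Y"
    by simp
  have units: "?Y \<subseteq> units G"
    by (rule src_bisection_subset[OF U])
  have pc: "continuous_map (subtopology (topo G) (units G)) euclidean p"
    by (rule Cc_on_units_extend[OF _ units p]) (use Y in \<open>simp add: open_bisection_iff\<close>)
  define a where "a z = cmod (p z) / \<delta>\<^sup>2" for z
  have p_le: "cmod (p z) \<le> \<delta>\<^sup>2" for z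
    using \<delta> by (auto simp: p_val norm_power intro: power_mono)
  have pp: "conv G (invol G p) p = (\<lambda>g. complex_of_real (\<delta>\<^sup>2) * (complex_of_real (a (src G g)) * p g))"
  proof
    fix g
    have "conv G (invol G p) p g = (if g \<in> src G ` ?Y then complex_of_real ((cmod (p (sec ?Y g)))\<^sup>2) else 0)"
      by (rule conv_invol_bisection[OF Y]) (simp add: p_val split: if_splits)
    also have "\<dots> = complex_of_real (cmod (p g)) * p g"
    proof (cases "g \<in> ?Y")
      case True
      then have "src G g = g"
        using units src_unit by blast
      then have "g \<in> src G ` ?Y" "sec ?Y g = g"
        using True sec_eqI[OF Y True] by (auto intro: rev_image_eqI)
      moreover have "p g = complex_of_real (cmod (p g))"
        using True by (simp add: p_val norm_power)
      ultimately show ?thesis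
        by (metis of_real_mult power2_eq_square)
    next
      case False
      then have "g \<notin> src G ` ?Y"
        using units src_unit by auto
      with False show ?thesis
        by (simp add: p_val)
    qed
    also have "\<dots> = complex_of_real (\<delta>\<^sup>2) * (complex_of_real (a (src G g)) * p g)"
    proof (cases "g \<in> ?Y")
      case True
      then have "src G g = g"
        using units src_unit by blast
      then show ?thesis
        using \<delta>(1) by (simp add: a_def)
    qed (simp add: p_val)
    finally show "conv G (invol G p) p g = complex_of_real (\<delta>\<^sup>2) * (complex_of_real (a (src G g)) * p g)" .
  qed
  have ac: "continuous_map (subtopology (topo G) (units G)) euclidean a"
    unfolding a_def using pc \<delta>(1) by (auto simp: continuous_map_tendsto_iff intro!: tendsto_intros)
  have a1: "\<bar>a z\<bar> \<le> 1" for z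
    using p_le[of z] \<delta>(1) by (simp add: a_def)
  have eA: "e \<in> Connes_algebra G" and pA: "p \<in> Connes_algebra G"
    using Cc_on_Connes U e Y p by auto
  have aA: "(\<lambda>g. complex_of_real (a (src G g)) * p g) \<in> Connes_algebra G"
  proof (rule Cc_on_Connes[OF Y mult_src_Cc[OF Y p]])
    show "continuous_map (subtopology (topo G) (units G)) euclidean (\<lambda>z. complex_of_real (a z))"
      using ac by (auto simp: continuous_map_tendsto_iff intro!: tendsto_of_real)
  qed
  have "(N p)\<^sup>2 = N (conv G (invol G p) p)"
    by (rule cstar_normD(3)[OF N pA, symmetric])
  also have "\<dots> = cmod (complex_of_real (\<delta>\<^sup>2)) * N (\<lambda>g. complex_of_real (a (src G g)) * p g)"
    unfolding pp by (rule cstar_normD(2)[OF N aA])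
  also have "\<dots> \<le> \<delta>\<^sup>2 * N p"
    using cstar_norm_contraction[OF N Y p ac a1] \<delta>(1) by (simp add: norm_power mult_left_mono)
  finally have "N p * N p \<le> \<delta>\<^sup>2 * N p"
    by (simp add: power2_eq_square)
  moreover have Np: "N p \<ge> 0" and Ne: "N e \<ge> 0"
    using cstar_normD(1)[OF N] pA eA by auto
  ultimately have "N p \<le> \<delta>\<^sup>2"
    by (metis less_eq_real_def mult_right_le_imp_le zero_le_power2)
  moreover have "(N e)\<^sup>2 = N p"
    unfolding p_def by (rule cstar_normD(3)[OF N eA, symmetric])
  ultimately have "(N e)\<^sup>2 \<le> \<delta>\<^sup>2"
    by simp
  then show ?thesis
    using \<delta>(1) by (simp add: power2_le_iff_abs_le Ne)
qed

lemma cstar_norm_sum: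
  assumes N: "cstar_norm G N" and e: "\<And>i. i < m \<Longrightarrow> e i \<in> Connes_algebra G"
    and \<delta>: "\<And>i. i < m \<Longrightarrow> N (e i) \<le> \<delta>"
  shows "N (\<lambda>g. \<Sum>i < m. e i g) \<le> real m * \<delta>"
  using e \<delta>
proof (induction m)
  case 0
  have "(0 :: 'a \<Rightarrow> complex) \<in> Connes_algebra G"
    unfolding Connes_algebra_def by (rule cfun.span_zero)
  then have "N 0 = 0"
    using N by (simp add: cstar_norm_def)
  then show ?case
    by (simp add: zero_fun_def)
next
  case (Suc m)
  have "(\<lambda>g. \<Sum>i < m. e i g) \<in> Connes_algebra G"
    using Suc.prems(1) by (intro Connes_sum) auto
  then have "N ((\<lambda>g. \<Sum>i < m. e i g) + e m) \<le> N (\<lambda>g. \<Sum>i < m. e i g) + N (e m)"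
    using cstar_normD(4)[OF N] Suc.prems(1)[of m] by simp
  also have "\<dots> \<le> real m * \<delta> + \<delta>"
    using Suc by (intro add_mono) auto
  finally show ?case
    by (simp add: plus_fun_def algebra_simps)
qed

end

section \<open>Local approximation and density\<close>

context etale_groupoid
begin

definition psi_functions :: "('a \<Rightarrow> complex) set"
  where "psi_functions = {f_psi G b n \<gamma> V \<psi> | x b n \<gamma> h V W \<psi>.
    coset_null G x b n \<gamma> \<and> bisections_at G x n \<gamma> h V \<and>
    admissible G x n \<gamma> h V W \<and> \<psi> \<in> Cc_on (topo G) W}"

text \<open>The arrows of the fibre with range \<open>y\<close> form one translate of the isotropy
  group by \<open>h\<close>. Transporting \<open>f\<close> along this translation gives
  \<open>b\<close>, and the coset sums of \<open>b\<close> become those of \<open>f\<close> over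
  cosets of \<open>gmul G h k\<close>. Smaller \<open>W'\<close> are included because several ranges
  must share one neighbourhood.\<close>

lemma orbit_psi_function:
  assumes x: "x \<in> units G" and S: "S = {g \<in> source_fibre G x. f g \<noteq> 0}" "finite S"
    and null: "\<And>k X. k \<in> source_fibre G x \<Longrightarrow> X \<in> limit_subgroups G x \<Longrightarrow>
      (\<Sum>g \<in> {g \<in> coset G k X. f g \<noteq> 0}. f g) = 0"
    and B: "\<And>s. s \<in> S \<Longrightarrow> open_bisection G (B s) \<and> s \<in> B s" and y: "y \<in> rng G ` S"
  shows "\<exists>W. openin (topo G) W \<and> x \<in> W \<and> (\<forall>W' \<psi>. openin (topo G) W' \<longrightarrow> x \<in> W' \<longrightarrow> W' \<subseteq> W \<longrightarrow>
    \<psi> \<in> Cc_on (topo G) W' \<longrightarrow> (\<lambda>g. \<Sum>s \<in> {s \<in> S. rng G s = y}. f s * lift (B s) \<psi> g) \<in> psi_functions)"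
proof -
  obtain h where h: "h \<in> S" "y = rng G h"
    using y by blast
  then have hx: "h \<in> source_fibre G x" and ha: "h \<in> arrows G" "src G h = x"
    using S(1) by (auto simp: source_fibre_def)
  define T where "T = {s \<in> S. rng G s = y}"
  define T' where "T' = gmul G (ginv G h) ` T"
  define b where "b g = f (gmul G h g)" for g
  have comp: "(h, g) \<in> composable G" if "g \<in> isotropy G x" for g
    using that ha by (simp add: composable_def isotropy_def)
  have T_cancel: "gmul G h (gmul G (ginv G h) s) = s" and T_iso: "gmul G (ginv G h) s \<in> isotropy G x"
    if "s \<in> T" for s
  proof -
    have s: "s \<in> arrows G" "src G s = x" "rng G s = rng G h"
      using that S(1) h(2) by (auto simp: T_def source_fibre_def)
    show "gmul G h (gmul G (ginv G h) s) = s"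
      using mul_inv_cancel[OF ha(1) s(1)] s(3) by simp
    have "(ginv G h, s) \<in> composable G"
      using ha s by (simp add: composable_def inv_closed src_inv)
    then show "gmul G (ginv G h) s \<in> isotropy G x"
      using ha s by (simp add: isotropy_def mul_closed src_mul rng_mul rng_inv)
  qed
  have finT: "finite T" "finite T'"
    using S(2) by (simp_all add: T_def T'_def)
  obtain \<gamma> where \<gamma>: "bij_betw \<gamma> {1..card T'} T'"
    using ex_bij_betw_nat_finite_1[OF finT(2)] by blast
  define n where "n = card T'"
  note \<gamma> = \<gamma>[folded n_def]
  define p where "p i = gmul G h (\<gamma> i)" for i
  have bijT: "bij_betw (gmul G h) T' T"
  proof (rule bij_betw_byWitness[where f' = "gmul G (ginv G h)"])
    show "\<forall>g \<in> T'. gmul G (ginv G h) (gmul G h g) = g"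
      using T_cancel by (auto simp: T'_def)
    show "\<forall>s \<in> T. gmul G h (gmul G (ginv G h) s) = s"
      using T_cancel by blast
    show "gmul G h ` T' \<subseteq> T" "gmul G (ginv G h) ` T \<subseteq> T'"
      using T_cancel by (auto simp: T'_def)
  qed
  have bijp: "bij_betw p {1..n} T"
    using bij_betw_trans[OF \<gamma> bijT] by (simp add: p_def[abs_def] o_def)
  have pT: "p i \<in> T" if "i \<in> {1..n}" for i
    using bij_betwE[OF bijp] that by blast
  have null': "coset_null G x b n \<gamma>"
    unfolding coset_null_def
  proof (intro conjI ballI)
    show "x \<in> units G"
      by (rule x)
    show "inj_on \<gamma> {1..n}"
      using \<gamma> by (simp add: bij_betw_def)
    have "\<gamma> ` {1..n} = T'"
      using \<gamma> by (simp add: bij_betw_def)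
    also have "T' = {g \<in> isotropy G x. b g \<noteq> 0}"
    proof (intro equalityI subsetI)
      fix g assume "g \<in> T'"
      then obtain s where s: "s \<in> T" "g = gmul G (ginv G h) s"
        by (auto simp: T'_def)
      then show "g \<in> {g \<in> isotropy G x. b g \<noteq> 0}"
        using T_cancel[OF s(1)] T_iso[OF s(1)] S(1) by (simp add: b_def T_def)
    next
      fix g assume g: "g \<in> {g \<in> isotropy G x. b g \<noteq> 0}"
      then have c: "(h, g) \<in> composable G" "src G g = x"
        using comp by (auto simp: isotropy_def)
      have "gmul G h g \<in> T"
        using g c h(2) S(1) by (simp add: T_def b_def source_fibre_def mul_closed src_mul rng_mul)
      then show "g \<in> T'"
        using inv_mul_cancel[OF c(1)] unfolding T'_def by (metis image_eqI)
    qed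
    finally show "{g \<in> isotropy G x. b g \<noteq> 0} = \<gamma> ` {1..n}"
      by simp
    fix k X assume k: "k \<in> isotropy G x" and X: "X \<in> limit_subgroups G x"
    have X_iso: "X \<subseteq> isotropy G x"
      using X subgroup.subset by (fastforce simp: limit_subgroups_iff_filter isotropy_group_def)
    have hk: "gmul G h k \<in> source_fibre G x"
      using comp[OF k] k by (simp add: source_fibre_def isotropy_def mul_closed src_mul)
    have assoc: "gmul G (gmul G h k) g = gmul G h (gmul G k g)" if "g \<in> X" for g
      using that X_iso k by (intro mul_assoc[OF comp[OF k]]) (auto simp: composable_def isotropy_def)
    have iso: "gmul G k g \<in> isotropy G x" if "g \<in> X" for g
      using that X_iso k mul_isotropy by blast
    have "(\<Sum>g \<in> {g \<in> coset G k X. b g \<noteq> 0}. b g) = (\<Sum>g \<in> {g \<in> coset G (gmul G h k) X. f g \<noteq> 0}. f g)"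
    proof (rule sum.reindex_bij_witness[where i = "gmul G (ginv G h)" and j = "gmul G h"])
      fix g assume "g \<in> {g \<in> coset G k X. b g \<noteq> 0}"
      then obtain z where z: "z \<in> X" "g = gmul G k z" and bg: "b g \<noteq> 0"
        by (auto simp: coset_def)
      show "gmul G (ginv G h) (gmul G h g) = g"
        using inv_mul_cancel[OF comp[OF iso[OF z(1)]]] z(2) by simp
      show "gmul G h g \<in> {g \<in> coset G (gmul G h k) X. f g \<noteq> 0}"
        using bg z assoc[OF z(1), symmetric] by (auto simp: b_def coset_def)
      show "f (gmul G h g) = b g"
        by (simp add: b_def)
    next
      fix s assume "s \<in> {g \<in> coset G (gmul G h k) X. f g \<noteq> 0}"
      then obtain z where z: "z \<in> X" "s = gmul G (gmul G h k) z" and fs: "f s \<noteq> 0"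
        by (auto simp: coset_def)
      have s: "s = gmul G h (gmul G k z)"
        using z assoc by simp
      then have i: "gmul G (ginv G h) s = gmul G k z"
        using inv_mul_cancel[OF comp[OF iso[OF z(1)]]] by simp
      show "gmul G h (gmul G (ginv G h) s) = s"
        unfolding i using s by simp
      show "gmul G (ginv G h) s \<in> {g \<in> coset G k X. b g \<noteq> 0}"
        unfolding i using z(1) s fs by (auto simp: b_def coset_def)
    qed
    then show "(\<Sum>g \<in> {g \<in> coset G k X. b g \<noteq> 0}. b g) = 0"
      using null[OF hk X] by simp
  qed
  define V where "V i = B (p i)" for i
  have bis: "bisections_at G x n \<gamma> h V"
    using hx B pT by (simp add: bisections_at_def V_def p_def[symmetric] T_def)
  obtain W where W: "admissible G x n \<gamma> h V W"
    using admissible_exists[OF null' bis] by blast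
  have eq: "f_psi G b n \<gamma> V \<psi> = (\<lambda>g. \<Sum>s \<in> T. f s * lift (B s) \<psi> g)" for \<psi>
  proof
    fix g
    have "f_psi G b n \<gamma> V \<psi> g = (\<Sum>i = 1..n. f (p i) * lift (B (p i)) \<psi> g)"
      by (simp add: f_psi_lift b_def V_def p_def)
    also have "\<dots> = (\<Sum>s \<in> T. f s * lift (B s) \<psi> g)"
      by (rule sum.reindex_bij_betw[OF bijp])
    finally show "f_psi G b n \<gamma> V \<psi> g = (\<Sum>s \<in> T. f s * lift (B s) \<psi> g)" .
  qed
  show ?thesis
  proof (intro exI[of _ W] conjI allI impI)
    show "openin (topo G) W" "x \<in> W"
      using W by (auto simp: admissible_def openin_unit_space)
    fix W' \<psi> assume W': "openin (topo G) W'" "x \<in> W'" "W' \<subseteq> W" and \<psi>: "\<psi> \<in> Cc_on (topo G) W'"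
    have "admissible G x n \<gamma> h V W'"
      by (rule admissible_mono[OF W W'])
    then have "f_psi G b n \<gamma> V \<psi> \<in> psi_functions"
      unfolding psi_functions_def using null' bis \<psi> by blast
    then show "(\<lambda>g. \<Sum>s \<in> {s \<in> S. rng G s = y}. f s * lift (B s) \<psi> g) \<in> psi_functions"
      unfolding eq T_def .
  qed
qed

lemma span_sum_fun:
  assumes "\<And>i. i \<in> I \<Longrightarrow> f i \<in> cfun.span A"
  shows "(\<lambda>g. \<Sum>i \<in> I. f i g) \<in> cfun.span A"
proof -
  have "sum f I \<in> cfun.span A"
    by (rule cfun.span_sum) (rule assms)
  moreover have "sum f I = (\<lambda>g. \<Sum>i \<in> I. f i g)"
    by (induction I rule: infinite_finite_induct) auto
  ultimately show ?thesis
    by simp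
qed

text \<open>Off the source image smallness would be too weak: no neighbourhood of \<open>x\<close>
  fits inside that image to carry a correction term. Compactness of the support in the Hausdorff
  unit space makes it closed, so at such a point the function vanishes identically nearby.\<close>

lemma descend_near:
  assumes U: "open_bisection G U" and e: "e \<in> Cc_on (topo G) U" and x: "x \<in> units G" and \<delta>: "\<delta> > 0"
  shows "eventually (\<lambda>z. if x \<in> src G ` U then cmod (descend U e z - descend U e x) < \<delta>
    else descend U e z = 0) (nhdsin (topo G) x)"
proof (cases "x \<in> src G ` U")
  case True
  have "limitin (topo G) (\<lambda>z. z) x (nhdsin (topo G) x)"
    using unit_arrow[OF x] by (auto simp: limitin_def eventually_nhdsin)
  then have "(descend U e \<longlongrightarrow> descend U e x) (nhdsin (topo G) x)"
    by (rule unit_function_tendsto[OF descend_continuous[OF U e] x])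
  from tendstoD[OF this \<delta>] True show ?thesis
    by (simp add: dist_norm)
next
  case False
  have sub: "src G ` U \<subseteq> units G"
    by (rule src_bisection_subset[OF U])
  obtain K where K: "compactin (topo G) K" "K \<subseteq> src G ` U" "\<And>z. descend U e z \<noteq> 0 \<Longrightarrow> z \<in> K"
    using Cc_on_support[OF descend_Cc[OF U e]] sub units_subset_arrows by (metis order_trans)
  have "compactin (subtopology (topo G) (units G)) K"
    using K sub by (auto simp: compactin_subtopology)
  then have "closedin (subtopology (topo G) (units G)) K"
    using compactin_imp_closedin[OF Hausdorff_units] by blast
  then have "openin (subtopology (topo G) (units G)) (units G - K)"
    by (metis closedin_def topspace_units)
  then have "openin (topo G) (units G - K)"
    by (simp add: openin_unit_space)
  moreover have "x \<in> units G - K"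
    using x False K(2) by blast
  ultimately have "eventually (\<lambda>z. z \<in> units G - K) (nhdsin (topo G) x)"
    using unit_arrow[OF x] by (auto simp: eventually_nhdsin)
  then show ?thesis
    using K(3) False by (auto elim!: eventually_mono)
qed

text \<open>Near \<open>x\<close> the function \<open>f\<close> is, up to \<open>\<delta>\<close>, a combination of indicator functions of bisections
  whose coefficients are the values of \<open>f\<close> on the fibre of \<open>x\<close>; these satisfy the coset conditions.\<close>

lemma local_approximation:
  assumes cov: "covered_by_countably_many_bisections G" and f: "f \<in> singular_Cc G"
    and d: "decomposes f m U \<phi>" and x: "x \<in> units G" and \<delta>: "\<delta> > 0"
  shows "\<exists>W P. openin (topo G) W \<and> x \<in> W \<and> W \<subseteq> units G \<and> P \<subseteq> {..<m} \<and>
    (\<forall>i \<in> P. W \<subseteq> src G ` U i \<and> (\<forall>z \<in> W. cmod (descend (U i) (\<phi> i) z - descend (U i) (\<phi> i) x) < \<delta>)) \<and>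
    (\<forall>i \<in> {..<m} - P. \<forall>z \<in> W. descend (U i) (\<phi> i) z = 0) \<and>
    (\<forall>\<psi> \<in> Cc_on (topo G) W.
      (\<lambda>g. \<Sum>i \<in> P. descend (U i) (\<phi> i) x * lift (U i) \<psi> g) \<in> cfun.span psi_functions)"
proof -
  define P where "P = {i. i < m \<and> x \<in> src G ` U i}"
  define k where "k i = sec (U i) x" for i
  define c where "c i = descend (U i) (\<phi> i) x" for i
  define S where "S = {g \<in> source_fibre G x. f g \<noteq> 0}"
  \<comment> \<open>Several \<open>U i\<close> may pass through one arrow of the fibre. Their
    intersection provides the single bisection that a function f^\<psi> uses at that arrow.\<close>
  define B where "B g = (\<Inter>i \<in> {i \<in> P. k i = g}. U i)" for g
  have finP: "finite P"
    by (simp add: P_def)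
  have bisU: "open_bisection G (U i)" if "i \<in> P" for i
    using decomposesD(1)[OF d] that by (simp add: P_def)
  have k: "k i \<in> U i" "src G (k i) = x" "k i \<in> source_fibre G x" if "i \<in> P" for i
    using that sec_in[of x "U i"] src_sec[of x "U i"] bisection_arrow[OF bisU[OF that]]
    by (auto simp: P_def k_def source_fibre_def)
  have fk: "f g = (\<Sum>i \<in> {i \<in> P. k i = g}. c i)" if g: "g \<in> source_fibre G x" for g
  proof -
    have srcg: "src G g = x"
      using g by (simp add: source_fibre_def)
    have "\<phi> i g = (if i \<in> P \<and> k i = g then c i else 0)" if i: "i < m" for i
    proof -
      have "g \<in> U i \<longleftrightarrow> i \<in> P \<and> k i = g"
      proof
        assume "g \<in> U i"
        then show "i \<in> P \<and> k i = g"
          using sec_eqI[OF decomposesD(1)[OF d i]] srcg i by (auto simp: P_def k_def)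
      qed (use k in auto)
      then show ?thesis
        using decomposes_value[OF d i, of g] srcg by (simp add: c_def)
    qed
    then have "f g = (\<Sum>i < m. if i \<in> P \<and> k i = g then c i else 0)"
      by (simp add: decomposesD(3)[OF d])
    also have "\<dots> = (\<Sum>i \<in> {i \<in> {..<m}. i \<in> P \<and> k i = g}. c i)"
      by (rule sum.inter_filter[symmetric]) simp
    also have "{i \<in> {..<m}. i \<in> P \<and> k i = g} = {i \<in> P. k i = g}"
      by (auto simp: P_def)
    finally show ?thesis .
  qed
  \<comment> \<open>The inclusion may be proper: the coefficients of different indices through the
    same arrow can cancel in \<open>f\<close>.\<close>
  have SP: "S \<subseteq> k ` P"
  proof
    fix g assume "g \<in> S"
    then have g: "g \<in> source_fibre G x" "f g \<noteq> 0"
      by (auto simp: S_def)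
    then have "{i \<in> P. k i = g} \<noteq> {}"
      using fk by (metis sum.empty)
    then show "g \<in> k ` P"
      by blast
  qed
  then have finS: "finite S"
    using finP finite_surj by blast
  have B: "open_bisection G (B g) \<and> g \<in> B g" if g: "g \<in> k ` P" for g
  proof -
    obtain i where i: "i \<in> P" "k i = g"
      using g by blast
    have "openin (topo G) (B g)"
      unfolding B_def using finP i bisU by (intro openin_INT2) (auto simp: open_bisection_iff)
    then have "open_bisection G (B g)"
      by (rule open_bisection_subset[OF bisU[OF i(1)]]) (use i in \<open>auto simp: B_def\<close>)
    moreover have "g \<in> B g"
      using k(1) by (auto simp: B_def)
    ultimately show ?thesis
      by blast
  qed
  have "\<forall>y \<in> rng G ` S. \<exists>W. openin (topo G) W \<and> x \<in> W \<and>
    (\<forall>W' \<psi>. openin (topo G) W' \<longrightarrow> x \<in> W' \<longrightarrow> W' \<subseteq> W \<longrightarrow> \<psi> \<in> Cc_on (topo G) W' \<longrightarrow>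
      (\<lambda>g. \<Sum>s \<in> {s \<in> S. rng G s = y}. f s * lift (B s) \<psi> g) \<in> psi_functions)"
    by (intro ballI orbit_psi_function[OF x S_def finS singular_coset_sum[OF cov f]] B)
       (use SP in auto)
  then obtain Wy where Wy: "\<forall>y \<in> rng G ` S. openin (topo G) (Wy y) \<and> x \<in> Wy y \<and>
    (\<forall>W' \<psi>. openin (topo G) W' \<longrightarrow> x \<in> W' \<longrightarrow> W' \<subseteq> Wy y \<longrightarrow> \<psi> \<in> Cc_on (topo G) W' \<longrightarrow>
      (\<lambda>g. \<Sum>s \<in> {s \<in> S. rng G s = y}. f s * lift (B s) \<psi> g) \<in> psi_functions)"
    by (rule bchoice[THEN exE])
  have "eventually (\<lambda>z. \<forall>i \<in> {..<m}. if x \<in> src G ` U i then cmod (descend (U i) (\<phi> i) z - c i) < \<delta>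
      else descend (U i) (\<phi> i) z = 0) (nhdsin (topo G) x)"
    unfolding c_def using descend_near[OF decomposesD(1,2)[OF d] x \<delta>]
    by (intro eventually_ball_finite) auto
  then obtain W0 where W0: "openin (topo G) W0" "x \<in> W0" "\<And>z i. z \<in> W0 \<Longrightarrow> i < m \<Longrightarrow>
      if x \<in> src G ` U i then cmod (descend (U i) (\<phi> i) z - c i) < \<delta> else descend (U i) (\<phi> i) z = 0"
    using unit_arrow[OF x] unfolding eventually_nhdsin by auto
  \<comment> \<open>The sets \<open>Wy y\<close> put the sum for each range among the functions
    f^\<psi>; the source images of the \<open>B g\<close> make \<open>U i\<close> and
    \<open>B (k i)\<close> agree over \<open>W\<close>.\<close>
  define W where "W = W0 \<inter> units G \<inter> ((\<Inter>y \<in> rng G ` S. Wy y) \<inter> arrows G) \<inter>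
    ((\<Inter>g \<in> k ` P. src G ` B g) \<inter> arrows G)"
  have "openin (topo G) ((\<Inter>y \<in> rng G ` S. Wy y) \<inter> arrows G)"
    using finS Wy by (intro openin_INT) auto
  moreover have "openin (topo G) ((\<Inter>g \<in> k ` P. src G ` B g) \<inter> arrows G)"
    using finP B by (intro openin_INT openin_src_image) (auto simp: open_bisection_iff)
  ultimately have opW: "openin (topo G) W"
    unfolding W_def using W0(1) openin_units by (intro openin_Int[OF openin_Int[OF openin_Int]])
  have "x \<in> src G ` B g" if "g \<in> k ` P" for g
    using B[OF that] k(2) that by force
  then have xW: "x \<in> W"
    unfolding W_def using W0(2) x unit_arrow[OF x] Wy by blast
  have WB: "W \<subseteq> src G ` B (k i)" if "i \<in> P" for i
    using that unfolding W_def by blast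
  have BU: "B (k i) \<subseteq> U i" if "i \<in> P" for i
    using that by (auto simp: B_def)
  have span: "(\<lambda>g. \<Sum>i \<in> P. c i * lift (U i) \<psi> g) \<in> cfun.span psi_functions"
    if \<psi>: "\<psi> \<in> Cc_on (topo G) W" for \<psi>
  proof -
    have "(\<lambda>g. \<Sum>i \<in> P. c i * lift (U i) \<psi> g) =
        (\<lambda>g. \<Sum>y \<in> rng G ` S. \<Sum>s \<in> {s \<in> S. rng G s = y}. f s * lift (B s) \<psi> g)"
    proof
      fix g
      \<comment> \<open>Over a point of \<open>W\<close> there is an arrow of
        \<open>B (k i)\<close>. It lies in \<open>U i\<close>, which has only one arrow with that
        source, so the two bisections coincide there.\<close>
      have lift_eq: "lift (U i) \<psi> g = lift (B (k i)) \<psi> g" if i: "i \<in> P" for i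
      proof (cases "src G g \<in> W")
        case True
        have "g \<in> B (k i)" if "g \<in> U i"
        proof -
          obtain v where v: "v \<in> B (k i)" "src G v = src G g"
            using True WB[OF i] by force
          then have "v = g"
            using BU[OF i] bisU[OF i] \<open>g \<in> U i\<close> unfolding open_bisection_iff by (meson inj_onD subsetD)
          with v(1) show ?thesis
            by simp
        qed
        then show ?thesis
          using BU[OF i] by (auto simp: lift_def)
      next
        case False
        then show ?thesis
          using \<psi> by (simp add: lift_def Cc_on_def)
      qed
      have "(\<Sum>i \<in> P. c i * lift (U i) \<psi> g) = (\<Sum>i \<in> P. c i * lift (B (k i)) \<psi> g)"
        by (simp add: lift_eq)
      also have "\<dots> = (\<Sum>s \<in> k ` P. \<Sum>i \<in> {i \<in> P. k i = s}. c i * lift (B (k i)) \<psi> g)"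
        by (rule sum.image_gen[OF finP])
      also have "\<dots> = (\<Sum>s \<in> k ` P. f s * lift (B s) \<psi> g)"
      proof (rule sum.cong[OF refl])
        fix s assume "s \<in> k ` P"
        then have "s \<in> source_fibre G x"
          using k(3) by blast
        then show "(\<Sum>i \<in> {i \<in> P. k i = s}. c i * lift (B (k i)) \<psi> g) = f s * lift (B s) \<psi> g"
          by (simp add: fk sum_distrib_right)
      qed
      also have "\<dots> = (\<Sum>s \<in> S. f s * lift (B s) \<psi> g)"
        using finP SP k(3) by (intro sum.mono_neutral_right) (auto simp: S_def)
      also have "\<dots> = (\<Sum>y \<in> rng G ` S. \<Sum>s \<in> {s \<in> S. rng G s = y}. f s * lift (B s) \<psi> g)"
        by (rule sum.image_gen[OF finS])
      finally show "(\<Sum>i \<in> P. c i * lift (U i) \<psi> g) =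
        (\<Sum>y \<in> rng G ` S. \<Sum>s \<in> {s \<in> S. rng G s = y}. f s * lift (B s) \<psi> g)" .
    qed
    moreover have "(\<lambda>g. \<Sum>s \<in> {s \<in> S. rng G s = y}. f s * lift (B s) \<psi> g) \<in> cfun.span psi_functions"
      if y: "y \<in> rng G ` S" for y
    proof (rule cfun.span_base)
      have "W \<subseteq> Wy y"
        using y unfolding W_def by blast
      then show "(\<lambda>g. \<Sum>s \<in> {s \<in> S. rng G s = y}. f s * lift (B s) \<psi> g) \<in> psi_functions"
        using Wy y opW xW \<psi> by blast
    qed
    ultimately show ?thesis
      using span_sum_fun[of "rng G ` S" "\<lambda>y g. \<Sum>s \<in> {s \<in> S. rng G s = y}. f s * lift (B s) \<psi> g"] by simp
  qed
  show ?thesis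
  proof (intro exI[of _ W] exI[of _ P] conjI ballI)
    show "W \<subseteq> src G ` U i" if "i \<in> P" for i
      using WB[OF that] BU[OF that] by blast
    show "cmod (descend (U i) (\<phi> i) z - descend (U i) (\<phi> i) x) < \<delta>" if "i \<in> P" "z \<in> W" for i z
      using W0(3)[of z i] that by (simp add: P_def W_def c_def)
    show "descend (U i) (\<phi> i) z = 0" if "i \<in> {..<m} - P" "z \<in> W" for i z
      using W0(3)[of z i] that by (simp add: P_def W_def)
    show "(\<lambda>g. \<Sum>i \<in> P. descend (U i) (\<phi> i) x * lift (U i) \<psi> g) \<in> cfun.span psi_functions"
      if "\<psi> \<in> Cc_on (topo G) W" for \<psi>
      using span[OF that] unfolding c_def .
  qed (use opW xW in \<open>auto simp: W_def P_def\<close>)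
qed

text \<open>Local compactness supplies a compact neighbourhood of \<open>x\<close> inside
  \<open>W\<close>, and complete regularity a function vanishing outside it.\<close>

lemma exists_bump:
  assumes W: "openin (topo G) W" "W \<subseteq> units G" and x: "x \<in> W"
  obtains \<eta> :: "'a \<Rightarrow> real" where "continuous_map (subtopology (topo G) (units G)) euclidean \<eta>"
    "\<eta> x = 1" "\<And>z. \<eta> z \<ge> 0" "(\<lambda>z. complex_of_real (\<eta> z)) \<in> Cc_on (topo G) W"
proof -
  let ?X = "subtopology (topo G) (units G)"
  have "neighbourhood_base_of (\<lambda>C. compactin ?X C \<and> closedin ?X C) ?X"
    using locally_compact_units regular_units locally_compact_regular_space_neighbourhood_base by blast
  moreover have "openin ?X W"
    using W by (simp add: openin_unit_space)
  ultimately obtain O' K where OK: "openin ?X O'" "compactin ?X K" "x \<in> O'" "O' \<subseteq> K" "K \<subseteq> W"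
    using x unfolding neighbourhood_base_of by meson
  have "completely_regular_space ?X"
    using locally_compact_regular_imp_completely_regular_space locally_compact_units regular_units by blast
  then obtain \<eta>0 :: "'a \<Rightarrow> real" where \<eta>0: "continuous_map ?X euclidean \<eta>0" "\<eta>0 x = 1"
      "\<eta>0 ` (topspace ?X - O') \<subseteq> {0}"
    unfolding completely_regular_space_gen_alt'[of 1 0, simplified] using OK(1,3) by meson
  \<comment> \<open>The absolute value, and the value zero off the units, make the function
    nonnegative everywhere.\<close>
  define \<eta> where "\<eta> z = (if z \<in> units G then \<bar>\<eta>0 z\<bar> else 0)" for z
  have xu: "x \<in> units G"
    using x W(2) by blast
  have cont: "continuous_map ?X euclidean \<eta>"
    by (rule continuous_map_eq[OF continuous_map_real_abs[OF \<eta>0(1)]]) (simp add: \<eta>_def)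
  have supp: "z \<in> K" if "\<eta> z \<noteq> 0" for z
  proof (rule ccontr)
    assume "z \<notin> K"
    moreover have "z \<in> units G" "\<eta>0 z \<noteq> 0"
      using that by (auto simp: \<eta>_def split: if_splits)
    ultimately show False
      using \<eta>0(3) OK(4) unfolding topspace_units by blast
  qed
  have "(\<lambda>z. complex_of_real (\<eta> z)) \<in> Cc_on (topo G) W"
  proof (rule Cc_onI[OF Hausdorff_subset_units[OF W(2)]])
    have "continuous_map ?X euclidean (\<lambda>z. complex_of_real (\<eta> z))"
      using cont unfolding continuous_map_tendsto_iff by (auto intro: tendsto_of_real)
    then have "continuous_map (subtopology ?X W) euclidean (\<lambda>z. complex_of_real (\<eta> z))"
      by (rule continuous_map_from_subtopology)
    then show "continuous_map (subtopology (topo G) W) euclidean (\<lambda>z. complex_of_real (\<eta> z))"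
      using W(2) by (simp add: subtopology_subtopology inf.absorb2)
    show "compactin (topo G) K"
      using OK(2) by (simp add: compactin_subtopology)
  qed (use OK(5) supp in auto)
  with cont show thesis
    using \<eta>0(2) xu by (intro that[of \<eta>]) (auto simp: \<eta>_def)
qed

text \<open>On \<open>U i\<close> the remainder averages the differences between \<open>D i\<close>
  at the current source and at the chosen centres. The weights are nonnegative with sum at most one,
  so the bound \<delta> does not grow with the number of centres.\<close>

lemma singular_approximation:
  assumes cov: "covered_by_countably_many_bisections G" and N: "cstar_norm G N"
    and f: "f \<in> singular_Cc G" and \<epsilon>: "\<epsilon> > 0"
  shows "\<exists>f' \<in> cfun.span psi_functions. N (f - f') < \<epsilon>"
proof -
  let ?X = "subtopology (topo G) (units G)"
  have "f \<in> Connes_algebra G"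
    using f by (simp add: singular_Cc_def)
  then obtain m U \<phi> where d: "decomposes f m U \<phi>"
    by (rule Connes_algebra_decompose)
  define D where "D i = descend (U i) (\<phi> i)" for i
  note bisU = decomposesD(1)[OF d] and \<phi>Cc = decomposesD(2)[OF d]
  \<comment> \<open>There will be \<open>m\<close> remainders of norm at most \<delta>; the added
    one keeps the total strictly below \<epsilon> and covers \<open>m = 0\<close>.\<close>
  define \<delta> where "\<delta> = \<epsilon> / (real m + 1)"
  have \<delta>: "\<delta> > 0" "real m * \<delta> < \<epsilon>"
    using \<epsilon> by (auto simp: \<delta>_def field_simps)
  define Q where "Q x W P \<longleftrightarrow> openin (topo G) W \<and> x \<in> W \<and> W \<subseteq> units G \<and> P \<subseteq> {..<m} \<and>
    (\<forall>i \<in> P. W \<subseteq> src G ` U i \<and> (\<forall>z \<in> W. cmod (D i z - D i x) < \<delta>)) \<and>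
    (\<forall>i \<in> {..<m} - P. \<forall>z \<in> W. D i z = 0) \<and>
    (\<forall>\<psi> \<in> Cc_on (topo G) W. (\<lambda>g. \<Sum>i \<in> P. D i x * lift (U i) \<psi> g) \<in> cfun.span psi_functions)" for x W P
  have "\<forall>x \<in> units G. \<exists>W P. Q x W P"
    unfolding Q_def D_def by (intro ballI local_approximation[OF cov f d _ \<delta>(1)])
  then obtain W where "\<forall>x \<in> units G. \<exists>P. Q x (W x) P"
    by (rule bchoice[THEN exE])
  then obtain P where "\<forall>x \<in> units G. Q x (W x) (P x)"
    by (rule bchoice[THEN exE])
  then have WP: "Q x (W x) (P x)" if "x \<in> units G" for x
    using that by blast
  have W: "openin (topo G) (W x)" "x \<in> W x" "W x \<subseteq> units G" "P x \<subseteq> {..<m}" if "x \<in> units G" for x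
    using WP[OF that] by (auto simp: Q_def)
  have WU: "W x \<subseteq> src G ` U i" "\<And>z. z \<in> W x \<Longrightarrow> cmod (D i z - D i x) < \<delta>"
    if "x \<in> units G" "i \<in> P x" for x i
    using WP[OF that(1)] that(2) by (auto simp: Q_def)
  have W0: "D i z = 0" if "x \<in> units G" "i < m" "i \<notin> P x" "z \<in> W x" for x i z
    using WP[OF that(1)] that(2-4) by (auto simp: Q_def)
  have Wspan: "(\<lambda>g. \<Sum>i \<in> P x. D i x * lift (U i) \<psi> g) \<in> cfun.span psi_functions"
    if "x \<in> units G" "\<psi> \<in> Cc_on (topo G) (W x)" for x \<psi>
    using WP[OF that(1)] that(2) by (simp add: Q_def)
  have "\<forall>x \<in> units G. \<exists>\<eta> :: 'a \<Rightarrow> real. continuous_map ?X euclidean \<eta> \<and> \<eta> x = 1 \<and> (\<forall>z. \<eta> z \<ge> 0) \<and>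
      (\<lambda>z. complex_of_real (\<eta> z)) \<in> Cc_on (topo G) (W x)"
    using exists_bump[OF W(1,3,2)] by metis
  then obtain \<eta> :: "'a \<Rightarrow> 'a \<Rightarrow> real" where \<eta>: "\<forall>x \<in> units G. continuous_map ?X euclidean (\<eta> x) \<and> \<eta> x x = 1 \<and>
      (\<forall>z. \<eta> x z \<ge> 0) \<and> (\<lambda>z. complex_of_real (\<eta> x z)) \<in> Cc_on (topo G) (W x)"
    by (rule bchoice[THEN exE])
  have "\<exists>K. compactin (topo G) K \<and> K \<subseteq> units G \<and> (\<forall>z. D i z \<noteq> 0 \<longrightarrow> z \<in> K)" if i: "i < m" for i
  proof -
    have sub: "src G ` U i \<subseteq> units G"
      by (rule src_bisection_subset[OF bisU[OF i]])
    obtain K where "compactin (topo G) K" "K \<subseteq> src G ` U i" "\<And>z. D i z \<noteq> 0 \<Longrightarrow> z \<in> K"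
      using Cc_on_support[OF descend_Cc[OF bisU[OF i] \<phi>Cc[OF i]]] sub units_subset_arrows
      unfolding D_def by (metis order_trans)
    with sub show ?thesis
      by blast
  qed
  then obtain Ki where Ki: "\<And>i. i < m \<Longrightarrow> compactin (topo G) (Ki i)" "\<And>i. i < m \<Longrightarrow> Ki i \<subseteq> units G"
      "\<And>i z. i < m \<Longrightarrow> D i z \<noteq> 0 \<Longrightarrow> z \<in> Ki i"
    by metis
  define K where "K = (\<Union>i < m. Ki i)"
  have K: "compactin ?X K"
    unfolding K_def using Ki(1,2) by (auto simp: compactin_subtopology intro!: compactin_Union)
  have Ku: "K \<subseteq> units G"
    unfolding K_def using Ki(2) by blast
  \<comment> \<open>Any threshold below the value one of the bump at its centre gives an open cover
    of \<open>K\<close>; one half reappears as the floor in \<sigma>.\<close>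
  define H where "H x = {z \<in> units G. \<eta> x z > 1/2}" for x
  have opH: "openin ?X (H x)" if "x \<in> units G" for x
  proof -
    have "openin ?X {z \<in> topspace ?X. \<eta> x z \<in> {1/2<..}}"
      using \<eta> that by (intro openin_continuous_map_preimage[of _ euclidean]) auto
    then show ?thesis
      unfolding topspace_units H_def by simp
  qed
  have "K \<subseteq> \<Union>(H ` K)"
    using Ku \<eta> unfolding H_def by force
  then obtain \<F> where \<F>: "finite \<F>" "\<F> \<subseteq> H ` K" "K \<subseteq> \<Union>\<F>"
    using compactinD[OF K, of "H ` K"] opH Ku by blast
  then obtain T where T: "T \<subseteq> K" "finite T" "\<F> = H ` T"
    using finite_subset_image by metis
  have Tu: "t \<in> units G" if "t \<in> T" for t
    using T(1) Ku that by blast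
  \<comment> \<open>On \<open>K\<close> some bump exceeds one half, so \<sigma> is the sum of the
    bumps and the quotients add up to one. Elsewhere the floor keeps the denominator positive and
    continuous, and the quotients add up to at most one.\<close>
  define \<sigma> where "\<sigma> z = max (1/2) (\<Sum>t \<in> T. \<eta> t z)" for z
  define \<rho> where "\<rho> t z = \<eta> t z / \<sigma> z" for t z
  define \<psi> where "\<psi> t z = complex_of_real (\<rho> t z)" for t z
  have \<sigma>_pos: "\<sigma> z > 0" for z
    by (simp add: \<sigma>_def)
  have \<rho>_nonneg: "\<rho> t z \<ge> 0" if "t \<in> T" for t z
    using \<eta> Tu[OF that] \<sigma>_pos[of z] by (simp add: \<rho>_def)
  have \<rho>_sum_le: "(\<Sum>t \<in> T. \<rho> t z) \<le> 1" for z
  proof -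
    have "(\<Sum>t \<in> T. \<eta> t z) / \<sigma> z \<le> 1"
      using \<sigma>_pos[of z] by (simp add: \<sigma>_def)
    then show ?thesis
      by (simp add: \<rho>_def sum_divide_distrib)
  qed
  have \<rho>_sum: "(\<Sum>t \<in> T. \<rho> t z) = 1" if z: "z \<in> K" for z
  proof -
    obtain t where t: "t \<in> T" "z \<in> H t"
      using z \<F>(3) T(3) by auto
    have "\<eta> t z \<le> (\<Sum>t \<in> T. \<eta> t z)"
      by (rule member_le_sum[OF t(1)]) (use \<eta> Tu T(2) in auto)
    moreover have "\<eta> t z > 1/2"
      using t(2) by (simp add: H_def)
    ultimately have "\<sigma> z = (\<Sum>t \<in> T. \<eta> t z)"
      by (simp add: \<sigma>_def)
    then show ?thesis
      using \<sigma>_pos[of z] by (simp add: \<rho>_def sum_divide_distrib[symmetric])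
  qed
  have \<psi>Cc: "\<psi> t \<in> Cc_on (topo G) (W t)" if t: "t \<in> T" for t
  proof -
    have "continuous_map ?X euclidean \<sigma>"
      unfolding \<sigma>_def using \<eta> Tu T(2)
      by (intro continuous_map_real_max continuous_map_sum) auto
    then have "continuous_map ?X euclidean (\<lambda>z. complex_of_real (inverse (\<sigma> z)))"
      unfolding continuous_map_tendsto_iff
      using \<sigma>_pos by (auto intro!: tendsto_of_real tendsto_inverse simp: less_imp_neq[symmetric])
    then have "continuous_map (subtopology ?X (W t)) euclidean (\<lambda>z. complex_of_real (inverse (\<sigma> z)))"
      by (rule continuous_map_from_subtopology)
    then have c: "continuous_map (subtopology (topo G) (W t)) euclidean (\<lambda>z. complex_of_real (inverse (\<sigma> z)))"
      using W(3)[OF Tu[OF t]] by (simp add: subtopology_subtopology inf.absorb2)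
    have "(\<lambda>z. complex_of_real (inverse (\<sigma> z)) * complex_of_real (\<eta> t z)) \<in> Cc_on (topo G) (W t)"
      by (rule Cc_on_mult_left[OF Hausdorff_subset_units _ _ c])
         (use W[OF Tu[OF t]] \<eta> Tu[OF t] units_subset_arrows in auto)
    moreover have "\<psi> t = (\<lambda>z. complex_of_real (inverse (\<sigma> z)) * complex_of_real (\<eta> t z))"
      by (auto simp: \<psi>_def \<rho>_def divide_inverse mult.commute)
    ultimately show ?thesis
      by simp
  qed
  have \<psi>0: "\<psi> t z = 0" if "t \<in> T" "z \<notin> W t" for t z
    using \<psi>Cc[OF that(1)] that(2) by (simp add: Cc_on_def)
  define f' where "f' g = (\<Sum>t \<in> T. \<Sum>i \<in> P t. D i t * lift (U i) (\<psi> t) g)" for g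
  define e where "e i g = \<phi> i g - (\<Sum>t \<in> {t \<in> T. i \<in> P t}. D i t * lift (U i) (\<psi> t) g)" for i g
  have "(\<lambda>g. \<Sum>t \<in> T. \<Sum>i \<in> P t. D i t * lift (U i) (\<psi> t) g) \<in> cfun.span psi_functions"
    by (rule span_sum_fun) (use Wspan \<psi>Cc Tu in blast)
  then have f'span: "f' \<in> cfun.span psi_functions"
    by (simp add: f'_def[abs_def])
  have eCc: "e i \<in> Cc_on (topo G) (U i)" if i: "i < m" for i
  proof -
    note ha = Hausdorff_bisection[OF bisU[OF i]] bisection_subset_arrows[OF bisU[OF i]]
    have "(\<lambda>g. \<Sum>t \<in> {t \<in> T. i \<in> P t}. D i t * lift (U i) (\<psi> t) g) \<in> Cc_on (topo G) (U i)"
      by (intro Cc_on_sum[OF ha] Cc_on_cmult[OF ha] lift_Cc[OF bisU[OF i] W(1) WU(1) \<psi>Cc] Tu) auto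
    from Cc_on_add[OF ha \<phi>Cc[OF i] Cc_on_cmult[OF ha this, of "-1"]] show ?thesis
      by (simp add: e_def[abs_def])
  qed
  have e_le: "cmod (e i g) \<le> \<delta>" if i: "i < m" for i g
  proof (cases "g \<in> U i")
    case False
    then show ?thesis
      using eCc[OF i] \<delta>(1) by (simp add: Cc_on_def)
  next
    case True
    let ?z = "src G g" and ?T = "{t \<in> T. i \<in> P t}"
    \<comment> \<open>If \<open>D i\<close> does not vanish at the point, the centres
      \<open>t\<close> with \<open>i\<close> outside \<open>P t\<close> carry no weight there,
      because \<open>D i\<close> is zero on their neighbourhoods; the remaining weights already add
      up to one.\<close>
    have D_sum: "D i ?z = (\<Sum>t \<in> ?T. \<psi> t ?z * D i ?z)"
    proof (cases "D i ?z = 0")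
      case False
      then have "?z \<in> K"
        using Ki(3)[OF i] i by (auto simp: K_def)
      then have "(\<Sum>t \<in> T. \<psi> t ?z) = 1"
        using \<rho>_sum by (simp add: \<psi>_def of_real_sum[symmetric] del: of_real_sum)
      moreover have "(\<Sum>t \<in> T. \<psi> t ?z) = (\<Sum>t \<in> ?T. \<psi> t ?z)"
      proof (rule sum.mono_neutral_right[OF T(2)])
        show "\<forall>t \<in> T - ?T. \<psi> t ?z = 0"
          using W0[OF Tu i] \<psi>0 False by blast
      qed auto
      ultimately show ?thesis
        by (simp add: sum_distrib_right[symmetric])
    qed simp
    have "e i g = D i ?z - (\<Sum>t \<in> ?T. D i t * \<psi> t ?z)"
      using True decomposes_value[OF d i, of g] by (simp add: e_def D_def lift_def)
    also have "\<dots> = (\<Sum>t \<in> ?T. \<psi> t ?z * (D i ?z - D i t))"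
      by (subst D_sum) (simp add: sum_subtractf right_diff_distrib mult.commute)
    finally have "cmod (e i g) \<le> (\<Sum>t \<in> ?T. cmod (\<psi> t ?z * (D i ?z - D i t)))"
      by (simp add: norm_sum)
    also have "\<dots> \<le> (\<Sum>t \<in> ?T. \<rho> t ?z * \<delta>)"
    proof (rule sum_mono)
      fix t assume t: "t \<in> ?T"
      show "cmod (\<psi> t ?z * (D i ?z - D i t)) \<le> \<rho> t ?z * \<delta>"
      proof (cases "?z \<in> W t")
        case True
        then have "cmod (D i ?z - D i t) \<le> \<delta>"
          using WU(2)[of t i ?z] t Tu by auto
        then show ?thesis
          using \<rho>_nonneg[of t ?z] t by (simp add: norm_mult \<psi>_def mult_left_mono)
      next
        case False
        then show ?thesis
          using \<psi>0[of t ?z] \<rho>_nonneg[of t ?z] t \<delta>(1) by simp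
      qed
    qed
    also have "\<dots> \<le> (\<Sum>t \<in> T. \<rho> t ?z * \<delta>)"
      using \<rho>_nonneg \<delta>(1) T(2) by (intro sum_mono2) auto
    also have "\<dots> \<le> 1 * \<delta>"
      using \<rho>_sum_le[of ?z] \<delta>(1) unfolding sum_distrib_right[symmetric] by (intro mult_right_mono) auto
    finally show ?thesis
      by simp
  qed
  have "f - f' = (\<lambda>g. \<Sum>i < m. e i g)"
  proof
    fix g
    have "f' g = (\<Sum>t \<in> T. \<Sum>i < m. if i \<in> P t then D i t * lift (U i) (\<psi> t) g else 0)"
      unfolding f'_def
    proof (rule sum.cong[OF refl])
      fix t assume "t \<in> T"
      then have "P t = {i \<in> {..<m}. i \<in> P t}"
        using W(4)[OF Tu] by blast
      then show "(\<Sum>i \<in> P t. D i t * lift (U i) (\<psi> t) g) =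
          (\<Sum>i < m. if i \<in> P t then D i t * lift (U i) (\<psi> t) g else 0)"
        using sum.inter_filter[of "{..<m}" "\<lambda>i. D i t * lift (U i) (\<psi> t) g" "\<lambda>i. i \<in> P t"] by simp
    qed
    also have "\<dots> = (\<Sum>i < m. \<Sum>t \<in> T. if i \<in> P t then D i t * lift (U i) (\<psi> t) g else 0)"
      by (rule sum.swap)
    also have "\<dots> = (\<Sum>i < m. \<Sum>t \<in> {t \<in> T. i \<in> P t}. D i t * lift (U i) (\<psi> t) g)"
      using T(2) by (simp add: sum.inter_filter)
    finally show "(f - f') g = (\<Sum>i < m. e i g)"
      by (simp add: e_def sum_subtractf decomposesD(3)[OF d])
  qed
  moreover have "N (\<lambda>g. \<Sum>i < m. e i g) \<le> real m * \<delta>"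
    by (rule cstar_norm_sum[OF N]) (use cstar_norm_le_sup[OF N bisU eCc \<delta>(1) e_le] Cc_on_Connes[OF bisU eCc] in auto)
  ultimately have "N (f - f') < \<epsilon>"
    using \<delta>(2) by simp
  with f'span show ?thesis
    by blast
qed

text \<open>Emptiness of the interior of a support is not visibly stable under sums; vanishing over
  the Hausdorff units is a linear condition.\<close>

lemma psi_functions_singular:
  assumes cov: "covered_by_countably_many_bisections G"
  shows "cfun.span psi_functions \<subseteq> singular_Cc G"
proof (rule cfun.span_minimal)
  show "psi_functions \<subseteq> singular_Cc G"
    using f_psi_singular[OF cov] by (auto simp: psi_functions_def)
  have C: "cfun.subspace (Connes_algebra G)"
    unfolding Connes_algebra_def by (rule cfun.subspace_span)
  show "cfun.subspace (singular_Cc G)"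
    using cfun.subspace_0[OF C] cfun.subspace_add[OF C] cfun.subspace_scale[OF C]
    by (auto simp: cfun.subspace_def singular_Cc_iff[OF cov])
qed

end

theorem theorem5:
  fixes G :: "'a groupoid"
  assumes "etale_groupoid G"
    and "covered_by_countably_many_bisections G"
  shows "(\<forall>x b n \<gamma>. coset_null G x b n \<gamma> \<longrightarrow>
      (\<forall>h V. bisections_at G x n \<gamma> h V \<longrightarrow>
        (\<exists>W. admissible G x n \<gamma> h V W) \<and>
        (\<forall>W. admissible G x n \<gamma> h V W \<longrightarrow>
          (\<forall>\<psi> \<in> Cc_on (topo G) W. f_psi G b n \<gamma> V \<psi> \<in> singular_Cc G))))
    \<and> (\<forall>N. cstar_norm G N \<longrightarrow>
        norm_dense N
          (cfun.span {f_psi G b n \<gamma> V \<psi> | x b n \<gamma> h V W \<psi>.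
            coset_null G x b n \<gamma> \<and> bisections_at G x n \<gamma> h V \<and>
            admissible G x n \<gamma> h V W \<and> \<psi> \<in> Cc_on (topo G) W})
          (singular_Cc G))"
proof -
  interpret etale_groupoid G
    by (rule assms(1))
  show ?thesis
    unfolding norm_dense_def psi_functions_def[symmetric]
    using admissible_exists f_psi_singular[OF assms(2)] psi_functions_singular[OF assms(2)]
      singular_approximation[OF assms(2)] by (intro conjI allI impI ballI) auto
qed

end
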